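(* Let $A=A(\mathcal{A}^{(4)},W)$, where $W$ is any cell system on $\mathcal{A}^{(4)}$, and let $X$ be a graded vector space with Hilbert series $H_X(t)=t^3$. Then the Hochschild cohomology of $A$ is given, as graded vector spaces, by $HH^0(A) \cong X[-3]$, $HH^1(A) \cong X[-3]$, $HH^6(A) \cong X^{\ast}[-3]$, $HH^7(A) \cong X^{\ast}[-3]$, $HH^{12}(A) \cong X[-15]$, $HH^j(A)=0$ for $j=2,3,4,5,8,9,10,11$, and $HH^{12+i}(A) \cong HH^i(A)[-12]$ for $i \geq 1$.
   Context: All vector spaces and algebras are over $\mathbb{C}$. For a finite directed graph $\mathcal{G}$ (loops and multiple edges allowed), $s(a)$, $r(a)$ denote the source and range of an edge $a$. The path algebra $\mathbb{C}\mathcal{G}$ has as basis all finite paths (vertices are the paths of length 0), with product $ab$ the concatenation (first $a$, then $b$) if $r(a)=s(b)$ and $0$ otherwise; it is graded by path length. The graph $\mathcal{A}^{(n)}$, $n\ge4$ (Coxeter number $h=n$), has vertices $(\lambda_1,\lambda_2)$ with $\lambda_1,\lambda_2\ge0$ integers and $\lambda_1+\lambda_2\le n-3$, and one edge from $(\lambda_1,\lambda_2)$ to each of $(\lambda_1+1,\lambda_2)$, $(\lambda_1-1,\lambda_2+1)$, $(\lambda_1,\lambda_2-1)$ that is a vertex. Here $n=4$. Cell systems. Let $h$ be the Coxeter number of $\mathcal{G}$, $q=e^{i\pi/h}$, $[m]_q=(q^m-q^{-m})/(q-q^{-1})$, and let $(\phi_v)_v$ be the Perron-Frobenius eigenvector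 of $\mathcal{G}$ (eigenvalue $[3]_q$). A cell system $W$ on $\mathcal{G}$ assigns to each closed path $abc$ of length 3 a complex number $W(abc)=W(bca)=W(cab)$ such that: (I) for all vertices $i,j$ and edges $a,a'$ from $i$ to $j$, $\sum W(ab_1b_2)\overline{W(a'b_1b_2)}=\delta_{a,a'}[2]_q\phi_i\phi_j$, summed over all paths $b_1b_2$ of length 2 from $j$ to $i$; (II) for all edges $a_1:i_4\to i_1$, $a_2:i_2\to i_1$, $a_3:i_2\to i_3$, $a_4:i_4\to i_3$, $\sum \phi_k^{-1}W(a_2b_1b_2)\overline{W(a_3b_3b_2)}W(a_4b_3b_4)\overline{W(a_1b_1b_4)}=\delta_{a_1,a_4}\delta_{a_2,a_3}\phi_{i_4}\phi_{i_1}\phi_{i_2}+\delta_{a_1,a_2}\delta_{a_3,a_4}\phi_{i_1}\phi_{i_2}\phi_{i_3}$, summed over all vertices $k$ and edges $b_1:i_1\to k$, $b_2:k\to i_2$, $b_3:i_3\to k$, $b_4:k\to i_4$. The almost Calabi-Yau algebra $A(\mathcal{G},W)$ is the quotient of $\mathbb{C}\mathcal{G}$ by the two-sided ideal generated by the elements $\sum_{b,b'}W(abb')\,bb'$, one for each edge $a$, the sum being over all paths $bb'$ of length 2 from $r(a)$ to $s(a)$. It is graded by path length. Conventions. $HH^n(A)=\mathrm{Ext}^n_{A^e}(A,A)$, where $A^e=A^{\mathrm{op}}\otimes A$ is the enveloping algebra, with the grading induced by path length (a homomorphism raising path length by $d$ has degree $d$; $HH^0(A)$ is the center of $A$ with its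 path-length grading). Isomorphisms are of graded vector spaces. $V[n]$ is $V$ with degrees raised by $n$ ($V[n]_j=V_{j-n}$); $V^\ast$ is the graded dual, $(V^\ast)_j=(V_{-j})^\ast$. The Hilbert series of $V$ is $H_V(t)=\sum_j\dim(V_j)t^j$. *)

theory Defs
  imports
    "HOL-Library.Poly_Mapping"
    "HOL-Computational_Algebra.Formal_Laurent_Series"
    "HOL-Algebra.QuotRing"
    "Graph_Theory.Arc_Walk"
    "Jordan_Normal_Form.Missing_VectorSpace"
begin

section \<open>Records: spaces, algebras and modules with a grading\<close>

text \<open>
  Algebras and modules are HOL-Algebra \<open>module\<close> records.  A complex vector space has
  scalar type \<^typ>\<open>complex\<close>; its \<open>mult\<close> and \<open>one\<close> are irrelevant.  A complex algebra is the same
  record with \<open>mult\<close> and \<open>one\<close> meaningful.  A left module over an algebra with elements of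
  type \<open>'r\<close> has scalar type \<open>'r\<close>, and the complex numbers act on it through the algebra.
  The extra field \<open>part\<close> gives the homogeneous components of a \<open>\<int>\<close>-grading.
\<close>

record ('r, 'm) graded_module = "('r, 'm) module" +
  part :: "int \<Rightarrow> 'm set"

definition complex_field :: "complex ring" where
  "complex_field = \<lparr>carrier = UNIV, mult = (*), one = 1, zero = 0, add = (+)\<rparr>"

definition regular :: "('r, 'z) ring_scheme \<Rightarrow> ('r, 'r) module" where
  "regular R = \<lparr>carrier = carrier R, mult = mult R, one = one R, zero = zero R, add = add R,
                smult = mult R\<rparr>"

definition quotient :: "('r, 'm, 'z) module_scheme \<Rightarrow> 'm set \<Rightarrow> ('r, 'm set) module" where
  "quotient M I = \<lparr>carrier = carrier (M Quot I), mult = mult (M Quot I), one = one (M Quot I),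
     zero = zero (M Quot I), add = add (M Quot I),
     smult = (\<lambda>r S. \<Union>x\<in>S. I +>\<^bsub>M\<^esub> (r \<odot>\<^bsub>M\<^esub> x))\<rparr>"

definition graded_quotient ::
    "('r, 'm) graded_module \<Rightarrow> 'm set \<Rightarrow> ('r, 'm set) graded_module" where
  "graded_quotient M I = module.extend (quotient M I)
     (graded_module.fields (\<lambda>d. (\<lambda>x. I +>\<^bsub>M\<^esub> x) ` part M d))"

text \<open>Functions on \<open>D\<close> belonging to \<open>H\<close> and taking values in \<open>N\<close>, with pointwise operations.
  The elements of \<open>H\<close> are meant to be extensional on \<open>D\<close>.\<close>

definition pointwise ::
    "'x set \<Rightarrow> ('x \<Rightarrow> 'n) set \<Rightarrow> ('r, 'n, 'z) module_scheme \<Rightarrow> ('r, 'x \<Rightarrow> 'n) module" where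
  "pointwise D H N = \<lparr>carrier = H, mult = undefined, one = undefined,
     zero = (\<lambda>x\<in>D. \<zero>\<^bsub>N\<^esub>),
     add = (\<lambda>f g. \<lambda>x\<in>D. f x \<oplus>\<^bsub>N\<^esub> g x),
     smult = (\<lambda>r f. \<lambda>x\<in>D. r \<odot>\<^bsub>N\<^esub> f x)\<rparr>"


section \<open>Algebras with a basis closed under multiplication up to zero\<close>

text \<open>
  Elements are finite formal linear combinations of elements of \<open>B\<close>.  The product of two basis
  elements is the basis element given by \<open>pr\<close>, or \<open>0\<close> if \<open>pr\<close> yields \<^const>\<open>None\<close>; the unit is
  the sum of the basis elements in \<open>E\<close>; \<open>deg d\<close> consists of the basis elements of degree \<open>d\<close>.
\<close>

definition basis_algebra ::
    "'b set \<Rightarrow> 'b set \<Rightarrow> ('b \<Rightarrow> 'b \<Rightarrow> 'b option) \<Rightarrow> (int \<Rightarrow> 'b set)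
      \<Rightarrow> (complex, 'b \<Rightarrow>\<^sub>0 complex) graded_module" where
  "basis_algebra B E pr deg = \<lparr>
     carrier = {f. Poly_Mapping.keys f \<subseteq> B},
     mult = (\<lambda>f g. \<Sum>a\<in>Poly_Mapping.keys f. \<Sum>b\<in>Poly_Mapping.keys g.
               (case pr a b of None \<Rightarrow> 0
                | Some c \<Rightarrow> Poly_Mapping.single c (Poly_Mapping.lookup f a * Poly_Mapping.lookup g b))),
     one = (\<Sum>e\<in>E. Poly_Mapping.single e 1),
     zero = 0,
     add = (+),
     smult = (\<lambda>c. Poly_Mapping.map (\<lambda>y. c * y)),
     part = (\<lambda>d. {f. Poly_Mapping.keys f \<subseteq> B \<inter> deg d})\<rparr>"


section \<open>Path algebras\<close>

text \<open>A path is a pair of its starting vertex and its list of edges; the starting vertex is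
  needed to tell apart the paths of length 0.\<close>

type_synonym ('v, 'e) path = "'v \<times> 'e list"

definition paths :: "('v, 'e) pre_digraph \<Rightarrow> ('v, 'e) path set" where
  "paths G = {(u, p). \<exists>v. pre_digraph.awalk G u p v}"

definition path_concat ::
    "('v, 'e) pre_digraph \<Rightarrow> ('v, 'e) path \<Rightarrow> ('v, 'e) path \<Rightarrow> ('v, 'e) path option" where
  "path_concat G = (\<lambda>(u, p) (v, q).
     if last (pre_digraph.awalk_verts G u p) = v then Some (u, p @ q) else None)"

definition path_algebra ::
    "('v, 'e) pre_digraph \<Rightarrow> (complex, ('v, 'e) path \<Rightarrow>\<^sub>0 complex) graded_module" where
  "path_algebra G = basis_algebra (paths G) ((\<lambda>v. (v, [])) ` verts G) (path_concat G)
     (\<lambda>d. {(u, p). int (length p) = d})"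


section \<open>The graphs, cell systems and almost Calabi-Yau algebras\<close>

text \<open>There are no multiple edges, so an edge is represented by the pair of its endpoints.\<close>

definition graph_A :: "nat \<Rightarrow> (int \<times> int, (int \<times> int) \<times> (int \<times> int)) pre_digraph" where
  "graph_A n = (let V = {(x, y). 0 \<le> x \<and> 0 \<le> y \<and> x + y \<le> int n - 3} in
     \<lparr>verts = V,
      arcs = {((x, y), w). (x, y) \<in> V \<and> w \<in> V
                 \<and> w \<in> {(x + 1, y), (x - 1, y + 1), (x, y - 1)}},
      tail = fst, head = snd\<rparr>)"

definition arcs_from_to :: "('v, 'e) pre_digraph \<Rightarrow> 'v \<Rightarrow> 'v \<Rightarrow> 'e set" where
  "arcs_from_to G i j = {a \<in> arcs G. tail G a = i \<and> head G a = j}"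

definition quantum_int :: "nat \<Rightarrow> int \<Rightarrow> complex" where
  "quantum_int h m = (let q = exp (\<i> * complex_of_real pi / of_nat h)
     in (q powi m - q powi (- m)) / (q - inverse q))"

text \<open>The eigenvector is determined up to a positive factor only; no normalisation is imposed.\<close>

definition perron_frobenius_eigenvector ::
    "('v, 'e) pre_digraph \<Rightarrow> nat \<Rightarrow> ('v \<Rightarrow> real) \<Rightarrow> bool" where
  "perron_frobenius_eigenvector G h \<phi> \<longleftrightarrow>
     (\<forall>v\<in>verts G. 0 < \<phi> v) \<and>
     (\<forall>v\<in>verts G. (\<Sum>w\<in>verts G. of_nat (card (arcs_from_to G v w)) * complex_of_real (\<phi> w))
                   = quantum_int h 3 * complex_of_real (\<phi> v))"

text \<open>Only the values of \<open>W\<close> on closed paths of length 3 matter.\<close>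

definition cell_system ::
    "('v, 'e) pre_digraph \<Rightarrow> nat \<Rightarrow> ('v \<Rightarrow> real) \<Rightarrow> ('e \<Rightarrow> 'e \<Rightarrow> 'e \<Rightarrow> complex) \<Rightarrow> bool" where
  "cell_system G h \<phi> W \<longleftrightarrow>
     (\<forall>i\<in>verts G. \<forall>j\<in>verts G. \<forall>k\<in>verts G.
        \<forall>a\<in>arcs_from_to G i j. \<forall>b\<in>arcs_from_to G j k. \<forall>c\<in>arcs_from_to G k i.
          W a b c = W b c a \<and> W b c a = W c a b) \<and>
     (\<forall>i\<in>verts G. \<forall>j\<in>verts G. \<forall>a\<in>arcs_from_to G i j. \<forall>a'\<in>arcs_from_to G i j.
        (\<Sum>k\<in>verts G. \<Sum>b\<^sub>1\<in>arcs_from_to G j k. \<Sum>b\<^sub>2\<in>arcs_from_to G k i.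
            W a b\<^sub>1 b\<^sub>2 * cnj (W a' b\<^sub>1 b\<^sub>2))
        = (if a = a' then 1 else 0) * quantum_int h 2 * of_real (\<phi> i) * of_real (\<phi> j)) \<and>
     (\<forall>i\<^sub>1\<in>verts G. \<forall>i\<^sub>2\<in>verts G. \<forall>i\<^sub>3\<in>verts G. \<forall>i\<^sub>4\<in>verts G.
        \<forall>a\<^sub>1\<in>arcs_from_to G i\<^sub>4 i\<^sub>1. \<forall>a\<^sub>2\<in>arcs_from_to G i\<^sub>2 i\<^sub>1.
        \<forall>a\<^sub>3\<in>arcs_from_to G i\<^sub>2 i\<^sub>3. \<forall>a\<^sub>4\<in>arcs_from_to G i\<^sub>4 i\<^sub>3.
        (\<Sum>k\<in>verts G. \<Sum>b\<^sub>1\<in>arcs_from_to G i\<^sub>1 k. \<Sum>b\<^sub>2\<in>arcs_from_to G k i\<^sub>2.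
         \<Sum>b\<^sub>3\<in>arcs_from_to G i\<^sub>3 k. \<Sum>b\<^sub>4\<in>arcs_from_to G k i\<^sub>4.
            inverse (of_real (\<phi> k)) * W a\<^sub>2 b\<^sub>1 b\<^sub>2 * cnj (W a\<^sub>3 b\<^sub>3 b\<^sub>2)
              * W a\<^sub>4 b\<^sub>3 b\<^sub>4 * cnj (W a\<^sub>1 b\<^sub>1 b\<^sub>4))
        = (if a\<^sub>1 = a\<^sub>4 \<and> a\<^sub>2 = a\<^sub>3 then 1 else 0)
            * of_real (\<phi> i\<^sub>4) * of_real (\<phi> i\<^sub>1) * of_real (\<phi> i\<^sub>2)
        + (if a\<^sub>1 = a\<^sub>2 \<and> a\<^sub>3 = a\<^sub>4 then 1 else 0)
            * of_real (\<phi> i\<^sub>1) * of_real (\<phi> i\<^sub>2) * of_real (\<phi> i\<^sub>3))"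

definition cell_relation ::
    "('v, 'e) pre_digraph \<Rightarrow> ('e \<Rightarrow> 'e \<Rightarrow> 'e \<Rightarrow> complex) \<Rightarrow> 'e \<Rightarrow> ('v, 'e) path \<Rightarrow>\<^sub>0 complex" where
  "cell_relation G W a =
     (\<Sum>k\<in>verts G. \<Sum>b\<in>arcs_from_to G (head G a) k. \<Sum>b'\<in>arcs_from_to G k (tail G a).
        Poly_Mapping.single (head G a, [b, b']) (W a b b'))"

definition almost_calabi_yau_algebra ::
    "('v, 'e) pre_digraph \<Rightarrow> ('e \<Rightarrow> 'e \<Rightarrow> 'e \<Rightarrow> complex)
      \<Rightarrow> (complex, (('v, 'e) path \<Rightarrow>\<^sub>0 complex) set) graded_module" where
  "almost_calabi_yau_algebra G W =
     graded_quotient (path_algebra G) (Idl\<^bsub>path_algebra G\<^esub> (cell_relation G W ` arcs G))"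


section \<open>The enveloping algebra\<close>

definition opposite :: "('k, 'a) graded_module \<Rightarrow> ('k, 'a) graded_module" where
  "opposite A = A\<lparr>mult := (\<lambda>x y. y \<otimes>\<^bsub>A\<^esub> x)\<rparr>"

text \<open>The tensor product of two algebras: the free vector space on pairs \<open>(a, b)\<close>, which
  multiply componentwise, modulo the bilinearity relations.  The span of these relations is
  already a two-sided ideal.\<close>

definition bilinear_relations ::
    "(complex, 'a) graded_module \<Rightarrow> (complex, 'b) graded_module \<Rightarrow> ('a \<times> 'b \<Rightarrow>\<^sub>0 complex) set" where
  "bilinear_relations A B =
     {Poly_Mapping.single (a \<oplus>\<^bsub>A\<^esub> a', b) 1 - Poly_Mapping.single (a, b) 1
        - Poly_Mapping.single (a', b) 1 | a a' b.
        a \<in> carrier A \<and> a' \<in> carrier A \<and> b \<in> carrier B} \<union>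
     {Poly_Mapping.single (a, b \<oplus>\<^bsub>B\<^esub> b') 1 - Poly_Mapping.single (a, b) 1
        - Poly_Mapping.single (a, b') 1 | a b b'.
        a \<in> carrier A \<and> b \<in> carrier B \<and> b' \<in> carrier B} \<union>
     {Poly_Mapping.single (c \<odot>\<^bsub>A\<^esub> a, b) 1 - Poly_Mapping.single (a, b) c | c a b.
        a \<in> carrier A \<and> b \<in> carrier B} \<union>
     {Poly_Mapping.single (a, c \<odot>\<^bsub>B\<^esub> b) 1 - Poly_Mapping.single (a, b) c | c a b.
        a \<in> carrier A \<and> b \<in> carrier B}"

definition tensor_algebra ::
    "(complex, 'a) graded_module \<Rightarrow> (complex, 'b) graded_module
      \<Rightarrow> (complex, ('a \<times> 'b \<Rightarrow>\<^sub>0 complex) set) graded_module" where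
  "tensor_algebra A B =
     (let F = basis_algebra (carrier A \<times> carrier B) {(one A, one B)}
                (\<lambda>(a, b) (a', b'). Some (a \<otimes>\<^bsub>A\<^esub> a', b \<otimes>\<^bsub>B\<^esub> b'))
                (\<lambda>d. {(a, b). \<exists>i j. i + j = d \<and> a \<in> part A i \<and> b \<in> part B j})
      in graded_quotient F (Idl\<^bsub>F\<^esub> (bilinear_relations A B)))"

definition enveloping_algebra ::
    "(complex, 'a) graded_module \<Rightarrow> (complex, ('a \<times> 'a \<Rightarrow>\<^sub>0 complex) set) graded_module" where
  "enveloping_algebra A = tensor_algebra (opposite A) A"

text \<open>\<open>A\<close> as a left module over its enveloping algebra: \<open>a \<otimes> b\<close> maps \<open>x\<close> to \<open>b x a\<close>.  The sum
  below takes the same value on all representatives of the class \<open>t\<close>.\<close>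

definition algebra_as_bimodule ::
    "(complex, 'a) graded_module \<Rightarrow> (('a \<times> 'a \<Rightarrow>\<^sub>0 complex) set, 'a) graded_module" where
  "algebra_as_bimodule A = \<lparr>carrier = carrier A, mult = mult A, one = one A, zero = zero A,
     add = add A,
     smult = (\<lambda>t x. the_elem ((\<lambda>f. \<Oplus>\<^bsub>A\<^esub>p\<in>Poly_Mapping.keys f.
                Poly_Mapping.lookup f p \<odot>\<^bsub>A\<^esub> (snd p \<otimes>\<^bsub>A\<^esub> x \<otimes>\<^bsub>A\<^esub> fst p)) ` t)),
     part = part A\<rparr>"


section \<open>Graded Ext and Hochschild cohomology\<close>

text \<open>The library locale \<^locale>\<open>module\<close> insists on a commutative ring of scalars; its module
  axioms (the predicate \<^const>\<open>module_axioms\<close>) do not.\<close>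

definition left_module :: "('r, 'z) ring_scheme \<Rightarrow> ('r, 'm, 'y) module_scheme \<Rightarrow> bool" where
  "left_module R M \<longleftrightarrow> ring R \<and> abelian_group M \<and> module_axioms R M"

definition graded_left_module ::
    "(complex, 'r) graded_module \<Rightarrow> ('r, 'm) graded_module \<Rightarrow> bool" where
  "graded_left_module R M \<longleftrightarrow> left_module R M \<and>
     (\<forall>d. additive_subgroup (part M d) M) \<and>
     (\<forall>m\<in>carrier M. \<exists>!c. (\<forall>d. c d \<in> part M d) \<and> finite {d. c d \<noteq> \<zero>\<^bsub>M\<^esub>} \<and>
        m = (\<Oplus>\<^bsub>M\<^esub>d\<in>{d. c d \<noteq> \<zero>\<^bsub>M\<^esub>}. c d)) \<and>
     (\<forall>i j. \<forall>r\<in>part R i. \<forall>m\<in>part M j. r \<odot>\<^bsub>M\<^esub> m \<in> part M (i + j))"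

definition graded_homs ::
    "(complex, 'r) graded_module \<Rightarrow> ('r, 'm) graded_module \<Rightarrow> ('r, 'n) graded_module \<Rightarrow> int
      \<Rightarrow> ('m \<Rightarrow> 'n) set" where
  "graded_homs R M N d = {f \<in> module_hom R M N \<inter> extensional (carrier M).
     \<forall>j. f ` part M j \<subseteq> part N (j + d)}"

definition restrict_scalars ::
    "(complex, 'r) graded_module \<Rightarrow> ('r, 'n) graded_module \<Rightarrow> (complex, 'n) module" where
  "restrict_scalars R N = \<lparr>carrier = carrier N, mult = mult N, one = one N, zero = zero N,
     add = add N, smult = (\<lambda>c x. (c \<odot>\<^bsub>R\<^esub> \<one>\<^bsub>R\<^esub>) \<odot>\<^bsub>N\<^esub> x)\<rparr>"

definition hom_space ::
    "(complex, 'r) graded_module \<Rightarrow> ('r, 'm) graded_module \<Rightarrow> ('r, 'n) graded_module \<Rightarrow> int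
      \<Rightarrow> (complex, 'm \<Rightarrow> 'n) module" where
  "hom_space R M N d = pointwise (carrier M) (graded_homs R M N d) (restrict_scalars R N)"

definition free_module :: "('r, 'z) ring_scheme \<Rightarrow> nat \<Rightarrow> ('r, nat \<Rightarrow> 'r) module" where
  "free_module R k = pointwise {..<k} ({..<k} \<rightarrow>\<^sub>E carrier R) (regular R)"

text \<open>A finitely generated projective module is a direct summand of some \<open>R\<^sup>k\<close>.\<close>

definition fg_projective :: "('r, 'z) ring_scheme \<Rightarrow> ('r, 'm, 'y) module_scheme \<Rightarrow> bool" where
  "fg_projective R P \<longleftrightarrow> (\<exists>k. \<exists>\<sigma>\<in>module_hom R P (free_module R k).
     \<exists>\<pi>\<in>module_hom R (free_module R k) P. \<forall>x\<in>carrier P. \<pi> (\<sigma> x) = x)"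

text \<open>Exactness of \<open>\<dots> \<rightarrow> P 2 \<rightarrow> P 1 \<rightarrow> P 0 \<rightarrow> M \<rightarrow> 0\<close> with differentials \<open>D n\<close> from \<open>P (Suc n)\<close>
  to \<open>P n\<close> and augmentation \<open>e\<close>, all of degree 0.\<close>

definition graded_projective_resolution ::
    "(complex, 'r) graded_module \<Rightarrow> ('r, 'm) graded_module
      \<Rightarrow> (nat \<Rightarrow> ('r, 'p) graded_module) \<Rightarrow> (nat \<Rightarrow> 'p \<Rightarrow> 'p) \<Rightarrow> ('p \<Rightarrow> 'm) \<Rightarrow> bool" where
  "graded_projective_resolution R M P D e \<longleftrightarrow>
     (\<forall>n. graded_left_module R (P n) \<and> fg_projective R (P n)) \<and>
     (\<forall>n. D n \<in> graded_homs R (P (Suc n)) (P n) 0) \<and>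
     e \<in> graded_homs R (P 0) M 0 \<and>
     e ` carrier (P 0) = carrier M \<and>
     {x \<in> carrier (P 0). e x = \<zero>\<^bsub>M\<^esub>} = D 0 ` carrier (P 1) \<and>
     (\<forall>n. {x \<in> carrier (P (Suc n)). D n x = \<zero>\<^bsub>P n\<^esub>} = D (Suc n) ` carrier (P (Suc (Suc n))))"

definition cocycles ::
    "(complex, 'r) graded_module \<Rightarrow> (nat \<Rightarrow> ('r, 'p) graded_module) \<Rightarrow> (nat \<Rightarrow> 'p \<Rightarrow> 'p)
      \<Rightarrow> ('r, 'n) graded_module \<Rightarrow> nat \<Rightarrow> int \<Rightarrow> ('p \<Rightarrow> 'n) set" where
  "cocycles R P D N n d =
     {f \<in> graded_homs R (P n) N d. \<forall>x\<in>carrier (P (Suc n)). f (D n x) = \<zero>\<^bsub>N\<^esub>}"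

definition coboundaries ::
    "(complex, 'r) graded_module \<Rightarrow> (nat \<Rightarrow> ('r, 'p) graded_module) \<Rightarrow> (nat \<Rightarrow> 'p \<Rightarrow> 'p)
      \<Rightarrow> ('r, 'n) graded_module \<Rightarrow> nat \<Rightarrow> int \<Rightarrow> ('p \<Rightarrow> 'n) set" where
  "coboundaries R P D N n d = (case n of
       0 \<Rightarrow> {\<zero>\<^bsub>hom_space R (P 0) N d\<^esub>}
     | Suc m \<Rightarrow> (\<lambda>f. compose (carrier (P n)) f (D m)) ` graded_homs R (P m) N d)"

definition cohomology ::
    "(complex, 'r) graded_module \<Rightarrow> (nat \<Rightarrow> ('r, 'p) graded_module) \<Rightarrow> (nat \<Rightarrow> 'p \<Rightarrow> 'p)
      \<Rightarrow> ('r, 'n) graded_module \<Rightarrow> nat \<Rightarrow> int \<Rightarrow> (complex, ('p \<Rightarrow> 'n) set) module" where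
  "cohomology R P D N n d =
     quotient ((hom_space R (P n) N d)\<lparr>carrier := cocycles R P D N n d\<rparr>)
       (coboundaries R P D N n d)"

text \<open>
  \<open>Ext\<^sup>n(M, N)\<close> is computed from a chosen graded projective resolution of \<open>M\<close> by finitely
  generated modules.  Such a resolution exists whenever \<open>M\<close> is finitely generated and \<open>R\<close> is
  finite-dimensional, and finite generation makes the space of all homomorphisms \<open>P n \<rightarrow> N\<close> the
  direct sum of the spaces of homomorphisms of degree \<open>d\<close>.  The type \<^typ>\<open>nat \<Rightarrow> 'r\<close> is no
  restriction: every finitely generated projective module is isomorphic to a submodule of some
  \<open>R\<^sup>k\<close>, which lives on this type.
\<close>

definition chosen_resolution ::
    "(complex, 'r) graded_module \<Rightarrow> ('r, 'm) graded_module
      \<Rightarrow> (nat \<Rightarrow> ('r, nat \<Rightarrow> 'r) graded_module) \<times> (nat \<Rightarrow> (nat \<Rightarrow> 'r) \<Rightarrow> (nat \<Rightarrow> 'r))" where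
  "chosen_resolution R M =
     (SOME Q. \<exists>e. graded_projective_resolution R M (fst Q) (snd Q) e)"

text \<open>\<open>Ext R M N n d\<close> is the degree \<open>d\<close> component of \<open>Ext\<^sup>n\<close>.\<close>

definition Ext ::
    "(complex, 'r) graded_module \<Rightarrow> ('r, 'm) graded_module \<Rightarrow> ('r, 'n) graded_module
      \<Rightarrow> nat \<Rightarrow> int \<Rightarrow> (complex, ((nat \<Rightarrow> 'r) \<Rightarrow> 'n) set) module" where
  "Ext R M N n d =
     cohomology R (fst (chosen_resolution R M)) (snd (chosen_resolution R M)) N n d"

definition HH ::
    "(complex, 'a) graded_module \<Rightarrow> nat \<Rightarrow> int
      \<Rightarrow> (complex, ((nat \<Rightarrow> ('a \<times> 'a \<Rightarrow>\<^sub>0 complex) set) \<Rightarrow> 'a) set) module" where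
  "HH A = Ext (enveloping_algebra A) (algebra_as_bimodule A) (algebra_as_bimodule A)"


section \<open>Graded vector spaces as families of vector spaces\<close>

type_synonym 'x graded_space = "int \<Rightarrow> (complex, 'x) module"

definition graded_vector_space :: "'x graded_space \<Rightarrow> bool" where
  "graded_vector_space V \<longleftrightarrow> (\<forall>j. vectorspace complex_field (V j))"

definition shift :: "'x graded_space \<Rightarrow> int \<Rightarrow> 'x graded_space" where
  "shift V n = (\<lambda>j. V (j - n))"

definition graded_dual :: "'x graded_space \<Rightarrow> ('x \<Rightarrow> complex) graded_space" where
  "graded_dual V = (\<lambda>j. pointwise (carrier (V (- j)))
     (module_hom complex_field (V (- j)) (regular complex_field) \<inter> extensional (carrier (V (- j))))
     (regular complex_field))"

definition has_hilbert_series :: "'x graded_space \<Rightarrow> int fls \<Rightarrow> bool" where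
  "has_hilbert_series V H \<longleftrightarrow> (\<forall>j. vectorspace.fin_dim complex_field (V j) \<and>
     fls_nth H j = int (vectorspace.dim complex_field (V j)))"

definition graded_iso :: "'x graded_space \<Rightarrow> 'y graded_space \<Rightarrow> bool" where
  "graded_iso V U \<longleftrightarrow> (\<forall>j. \<exists>f\<in>module_hom complex_field (V j) (U j).
     bij_betw f (carrier (V j)) (carrier (U j)))"

definition graded_zero :: "'x graded_space \<Rightarrow> bool" where
  "graded_zero V \<longleftrightarrow> (\<forall>j. carrier (V j) = {\<zero>\<^bsub>V j\<^esub>})"

end

theory Submission
  imports Defs "HOL-Library.Numeral_Type"
begin

text \<open>
  For \<open>n = 4\<close> the graph is an oriented 3-cycle, so every edge lies on exactly one closed path of
  length 3.  Condition (I) makes the weight of that path nonzero because \<open>[2]\<^sub>q \<noteq> 0\<close>; hence the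
  relations are exactly the paths of length 2 and \<open>A\<close> is the path algebra of the 3-cycle modulo the
  square of its arrow ideal, of dimension 6 with basis \<open>e\<^sub>i, a\<^sub>i\<close> for \<open>i\<close> in \<open>\<int>/3\<close>.

  This algebra is Koszul, and its Koszul bimodule resolution has the terms
  \<open>\<Oplus>\<^sub>i A e\<^sub>i \<otimes> e\<^bsub>i+n\<^esub> A\<close>.  After applying \<open>Hom(-, A)\<close> the \<open>n\<close>-th term is \<open>\<Oplus>\<^sub>i e\<^sub>i A e\<^bsub>i+n\<^esub>\<close>: it has
  dimension 3 if \<open>n\<close> is 0 or 1 modulo 3, and vanishes otherwise.  The only nonzero differentials
  start at \<open>n = 3 m\<close> and are \<open>(f\<^sub>i) \<mapsto> (f\<^bsub>i+1\<^esub> - (-1)\<^bsup>n\<^esup> f\<^sub>i)\<close>.  For even \<open>n\<close> kernel and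
  cokernel have dimension 1; for odd \<open>n\<close> the map is bijective, as \<open>f = -f\<close> after going once around
  the cycle.  So the cohomology is one-dimensional for \<open>n = 6 m\<close> and \<open>n = 6 m + 1\<close>, in degree
  \<open>-6 m\<close>, and zero otherwise.

  The resolution in the definition of \<open>Ext\<close> is an arbitrary choice; the comparison theorem for graded
  projective resolutions transfers the result to it.
\<close>


section \<open>Graded modules\<close>

text \<open>Elements of \<open>A\<close> are cosets of formal sums of paths, and elements of the
  enveloping algebra are cosets of formal sums of pairs of such cosets, so direct computation in
  these nested quotients is unwieldy. Both algebras are therefore described by coordinate functions,
  on 6 and on 36 indices, through the same locale \<open>presented_alg\<close>; ring identities
  become identities between structure constants. Each term of the Koszul resolution is a left ideal
  \<open>E \<epsilon>\<close> of the enveloping algebra generated by one idempotent, and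
  homomorphisms from it to a module \<open>N\<close> are the elements of
  \<open>\<epsilon> N\<close>, so exactness and cohomology reduce to multiplication by explicit
  elements. Since every graded piece of the cohomology has dimension at most one, it is captured by
  a single linear functional on cocycles whose kernel is the space of coboundaries; such a
  functional passes easily from one resolution to another. The nonzero terms depend on
  \<open>n\<close> modulo 3 and the signs on \<open>n\<close> modulo 2, which gives period 6; the
  shift by 12 in the theorem is two such periods.\<close>

lemma additive_map_zero:
  assumes "abelian_group M" "abelian_group N" "h \<in> carrier M \<rightarrow> carrier N"
    and "\<And>x y. x \<in> carrier M \<Longrightarrow> y \<in> carrier M \<Longrightarrow> h (x \<oplus>\<^bsub>M\<^esub> y) = h x \<oplus>\<^bsub>N\<^esub> h y"
  shows "h \<zero>\<^bsub>M\<^esub> = \<zero>\<^bsub>N\<^esub>"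
proof -
  interpret M: abelian_group M by fact
  interpret N: abelian_group N by fact
  have c: "h \<zero>\<^bsub>M\<^esub> \<in> carrier N" using assms(3) by auto
  have "h \<zero>\<^bsub>M\<^esub> \<oplus>\<^bsub>N\<^esub> h \<zero>\<^bsub>M\<^esub> = h \<zero>\<^bsub>M\<^esub>"
    using assms(4)[of "\<zero>\<^bsub>M\<^esub>" "\<zero>\<^bsub>M\<^esub>"] by simp
  then show ?thesis using c by (simp add: N.add.l_cancel_one')
qed

lemma additive_map_minus:
  assumes "abelian_group M" "abelian_group N" "h \<in> carrier M \<rightarrow> carrier N"
    and add: "\<And>x y. x \<in> carrier M \<Longrightarrow> y \<in> carrier M \<Longrightarrow> h (x \<oplus>\<^bsub>M\<^esub> y) = h x \<oplus>\<^bsub>N\<^esub> h y"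
    and x: "x \<in> carrier M"
  shows "h (\<ominus>\<^bsub>M\<^esub> x) = \<ominus>\<^bsub>N\<^esub> h x"
proof -
  interpret M: abelian_group M by fact
  interpret N: abelian_group N by fact
  have "h (\<ominus>\<^bsub>M\<^esub> x) \<oplus>\<^bsub>N\<^esub> h x = h (\<ominus>\<^bsub>M\<^esub> x \<oplus>\<^bsub>M\<^esub> x)"
    using add[of "\<ominus>\<^bsub>M\<^esub> x" x] x by simp
  also have "\<dots> = \<zero>\<^bsub>N\<^esub>"
    using additive_map_zero[OF assms(1-4)] x by (simp add: M.l_neg)
  finally show ?thesis
    using assms(3) x by (intro N.minus_equality[symmetric]) auto
qed

text \<open>Only additivity is assumed, because the map is often not a module homomorphism:
  multiplication by a fixed element of a noncommutative ring, or a projection to a homogeneous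
  component.\<close>

lemma additive_map_finsum:
  assumes "abelian_group M" "abelian_group N" "h \<in> carrier M \<rightarrow> carrier N"
    and add: "\<And>x y. x \<in> carrier M \<Longrightarrow> y \<in> carrier M \<Longrightarrow> h (x \<oplus>\<^bsub>M\<^esub> y) = h x \<oplus>\<^bsub>N\<^esub> h y"
    and "finite S" "c \<in> S \<rightarrow> carrier M"
  shows "h (finsum M c S) = finsum N (\<lambda>d. h (c d)) S"
proof -
  interpret M: abelian_group M by fact
  interpret N: abelian_group N by fact
  show ?thesis using \<open>finite S\<close> \<open>c \<in> S \<rightarrow> carrier M\<close>
  proof (induction S rule: finite_induct)
    case empty
    show ?case using additive_map_zero[OF assms(1-4)] by simp
  next
    case (insert a S)
    then have c: "c a \<in> carrier M" "c \<in> S \<rightarrow> carrier M" by auto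
    then have hc: "h (c a) \<in> carrier N" "(\<lambda>d. h (c d)) \<in> S \<rightarrow> carrier N" using assms(3) by auto
    have "h (finsum M c (insert a S)) = h (c a \<oplus>\<^bsub>M\<^esub> finsum M c S)"
      using insert c by simp
    also have "\<dots> = h (c a) \<oplus>\<^bsub>N\<^esub> h (finsum M c S)" using c by (intro add) auto
    also have "\<dots> = finsum N (\<lambda>d. h (c d)) (insert a S)"
      using insert c hc by simp
    finally show ?case .
  qed
qed

lemma (in abelian_group) finsum_neutral_superset:
  assumes "finite T" "S \<subseteq> T" "\<And>d. d \<in> T - S \<Longrightarrow> c d = \<zero>" "c \<in> S \<rightarrow> carrier G"
  shows "finsum G c T = finsum G c S"
  using assms by (intro add.finprod_mono_neutral_cong_right) auto

section \<open>Left modules over a ring that need not be commutative\<close>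

lemma left_moduleI:
  assumes "ring R" "abelian_group M"
    and "\<And>r x. r \<in> carrier R \<Longrightarrow> x \<in> carrier M \<Longrightarrow> r \<odot>\<^bsub>M\<^esub> x \<in> carrier M"
    and "\<And>r s x. r \<in> carrier R \<Longrightarrow> s \<in> carrier R \<Longrightarrow> x \<in> carrier M \<Longrightarrow>
      (r \<oplus>\<^bsub>R\<^esub> s) \<odot>\<^bsub>M\<^esub> x = r \<odot>\<^bsub>M\<^esub> x \<oplus>\<^bsub>M\<^esub> s \<odot>\<^bsub>M\<^esub> x"
    and "\<And>r x y. r \<in> carrier R \<Longrightarrow> x \<in> carrier M \<Longrightarrow> y \<in> carrier M \<Longrightarrow>
      r \<odot>\<^bsub>M\<^esub> (x \<oplus>\<^bsub>M\<^esub> y) = r \<odot>\<^bsub>M\<^esub> x \<oplus>\<^bsub>M\<^esub> r \<odot>\<^bsub>M\<^esub> y"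
    and "\<And>r s x. r \<in> carrier R \<Longrightarrow> s \<in> carrier R \<Longrightarrow> x \<in> carrier M \<Longrightarrow>
      (r \<otimes>\<^bsub>R\<^esub> s) \<odot>\<^bsub>M\<^esub> x = r \<odot>\<^bsub>M\<^esub> (s \<odot>\<^bsub>M\<^esub> x)"
    and "\<And>x. x \<in> carrier M \<Longrightarrow> \<one>\<^bsub>R\<^esub> \<odot>\<^bsub>M\<^esub> x = x"
  shows "left_module R M"
  unfolding left_module_def module_axioms_def using assms by auto

locale left_mod =
  fixes R :: "('r, 'z) ring_scheme" and M :: "('r, 'm, 'y) module_scheme"
  assumes left_module: "left_module R M"
begin

sublocale R: ring R using left_module by (simp add: left_module_def)
sublocale M: abelian_group M using left_module by (simp add: left_module_def)

lemma axs: "module_axioms R M" using left_module by (simp add: left_module_def)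

lemma smult_closed [simp, intro]:
  "r \<in> carrier R \<Longrightarrow> x \<in> carrier M \<Longrightarrow> r \<odot>\<^bsub>M\<^esub> x \<in> carrier M"
  using axs by (simp add: module_axioms_def)

lemma smult_l_distr: "r \<in> carrier R \<Longrightarrow> s \<in> carrier R \<Longrightarrow> x \<in> carrier M \<Longrightarrow>
    (r \<oplus>\<^bsub>R\<^esub> s) \<odot>\<^bsub>M\<^esub> x = r \<odot>\<^bsub>M\<^esub> x \<oplus>\<^bsub>M\<^esub> s \<odot>\<^bsub>M\<^esub> x"
  using axs by (simp add: module_axioms_def)

lemma smult_r_distr: "r \<in> carrier R \<Longrightarrow> x \<in> carrier M \<Longrightarrow> y \<in> carrier M \<Longrightarrow>
    r \<odot>\<^bsub>M\<^esub> (x \<oplus>\<^bsub>M\<^esub> y) = r \<odot>\<^bsub>M\<^esub> x \<oplus>\<^bsub>M\<^esub> r \<odot>\<^bsub>M\<^esub> y"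
  using axs by (simp add: module_axioms_def)

lemma smult_assoc: "r \<in> carrier R \<Longrightarrow> s \<in> carrier R \<Longrightarrow> x \<in> carrier M \<Longrightarrow>
    (r \<otimes>\<^bsub>R\<^esub> s) \<odot>\<^bsub>M\<^esub> x = r \<odot>\<^bsub>M\<^esub> (s \<odot>\<^bsub>M\<^esub> x)"
  using axs by (simp add: module_axioms_def)

lemma smult_one [simp]: "x \<in> carrier M \<Longrightarrow> \<one>\<^bsub>R\<^esub> \<odot>\<^bsub>M\<^esub> x = x"
  using axs by (simp add: module_axioms_def)

lemma smult_zero [simp]: "r \<in> carrier R \<Longrightarrow> r \<odot>\<^bsub>M\<^esub> \<zero>\<^bsub>M\<^esub> = \<zero>\<^bsub>M\<^esub>"
  by (rule additive_map_zero[OF M.abelian_group_axioms M.abelian_group_axioms])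
    (auto simp: smult_r_distr)

lemma zero_smult [simp]: "x \<in> carrier M \<Longrightarrow> \<zero>\<^bsub>R\<^esub> \<odot>\<^bsub>M\<^esub> x = \<zero>\<^bsub>M\<^esub>"
  by (rule additive_map_zero[OF R.abelian_group_axioms M.abelian_group_axioms,
      where h = "\<lambda>r. r \<odot>\<^bsub>M\<^esub> x"]) (auto simp: smult_l_distr)

end

lemma module_homI:
  assumes "\<And>x. x \<in> carrier M \<Longrightarrow> f x \<in> carrier N"
    and "\<And>x y. x \<in> carrier M \<Longrightarrow> y \<in> carrier M \<Longrightarrow> f (x \<oplus>\<^bsub>M\<^esub> y) = f x \<oplus>\<^bsub>N\<^esub> f y"
    and "\<And>r x. r \<in> carrier R \<Longrightarrow> x \<in> carrier M \<Longrightarrow> f (r \<odot>\<^bsub>M\<^esub> x) = r \<odot>\<^bsub>N\<^esub> f x"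
  shows "f \<in> module_hom R M N"
  using assms by (auto simp: module_hom_def)

lemma module_hom_in: "f \<in> module_hom R M N \<Longrightarrow> x \<in> carrier M \<Longrightarrow> f x \<in> carrier N"
  by (auto simp: module_hom_def)

lemma module_hom_zero:
  "abelian_group M \<Longrightarrow> abelian_group N \<Longrightarrow> f \<in> module_hom R M N \<Longrightarrow> f \<zero>\<^bsub>M\<^esub> = \<zero>\<^bsub>N\<^esub>"
  by (rule additive_map_zero) (auto simp: module_hom_def)

lemma module_hom_minus:
  "abelian_group M \<Longrightarrow> abelian_group N \<Longrightarrow> f \<in> module_hom R M N \<Longrightarrow> x \<in> carrier M \<Longrightarrow>
    y \<in> carrier M \<Longrightarrow> f (x \<ominus>\<^bsub>M\<^esub> y) = f x \<ominus>\<^bsub>N\<^esub> f y"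
  using additive_map_minus[of M N f y]
  by (auto simp: module_hom_def a_minus_def abelian_group.a_inv_closed)

lemma module_hom_finsum:
  "abelian_group M \<Longrightarrow> abelian_group N \<Longrightarrow> f \<in> module_hom R M N \<Longrightarrow> finite S \<Longrightarrow>
    c \<in> S \<rightarrow> carrier M \<Longrightarrow> f (finsum M c S) = finsum N (\<lambda>d. f (c d)) S"
  by (rule additive_map_finsum) (auto simp: module_hom_def)


section \<open>Homogeneous components\<close>

definition component :: "('r, 'm) graded_module \<Rightarrow> int \<Rightarrow> 'm \<Rightarrow> 'm" where
  "component M d x = (THE c. (\<forall>d. c d \<in> part M d) \<and> finite {d. c d \<noteq> \<zero>\<^bsub>M\<^esub>} \<and>
     x = (\<Oplus>\<^bsub>M\<^esub>d\<in>{d. c d \<noteq> \<zero>\<^bsub>M\<^esub>}. c d)) d"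

locale graded_mod =
  fixes R :: "(complex, 'r) graded_module" and M :: "('r, 'm) graded_module"
  assumes graded: "graded_left_module R M"
begin

sublocale left_mod R M
  using graded by unfold_locales (simp add: graded_left_module_def)

lemma part_subgroup: "additive_subgroup (part M d) M"
  using graded by (simp add: graded_left_module_def)

lemma part_carrier: "x \<in> part M d \<Longrightarrow> x \<in> carrier M"
  using additive_subgroup.a_Hcarr[OF part_subgroup] .

lemma part_add: "x \<in> part M d \<Longrightarrow> y \<in> part M d \<Longrightarrow> x \<oplus>\<^bsub>M\<^esub> y \<in> part M d"
  using additive_subgroup.a_closed[OF part_subgroup] .

lemma part_zero: "\<zero>\<^bsub>M\<^esub> \<in> part M d"
  using additive_subgroup.zero_closed[OF part_subgroup] .

lemma part_smult: "r \<in> part R i \<Longrightarrow> x \<in> part M j \<Longrightarrow> r \<odot>\<^bsub>M\<^esub> x \<in> part M (i + j)"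
  using graded by (simp add: graded_left_module_def)

lemma decomposition: "x \<in> carrier M \<Longrightarrow> \<exists>!c. (\<forall>d. c d \<in> part M d) \<and> finite {d. c d \<noteq> \<zero>\<^bsub>M\<^esub>} \<and>
     x = (\<Oplus>\<^bsub>M\<^esub>d\<in>{d. c d \<noteq> \<zero>\<^bsub>M\<^esub>}. c d)"
  using graded by (simp add: graded_left_module_def)

lemma component_part: "x \<in> carrier M \<Longrightarrow> component M d x \<in> part M d"
  and component_finite: "x \<in> carrier M \<Longrightarrow> finite {d. component M d x \<noteq> \<zero>\<^bsub>M\<^esub>}"
  and component_sum: "x \<in> carrier M \<Longrightarrow>
    x = (\<Oplus>\<^bsub>M\<^esub>d\<in>{d. component M d x \<noteq> \<zero>\<^bsub>M\<^esub>}. component M d x)"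
  using theI'[OF decomposition[of x]] unfolding component_def by blast+

text \<open>Extended by zero outside \<open>S\<close>, the family \<open>c\<close> satisfies the
  clauses that define \<open>component\<close>, and decompositions are unique. Terms indexed by
  \<open>S\<close> may vanish, so \<open>S\<close> can be larger than the support.\<close>

lemma component_unique:
  assumes "finite S" "\<And>d. d \<in> S \<Longrightarrow> c d \<in> part M d" "x = (\<Oplus>\<^bsub>M\<^esub>d\<in>S. c d)"
  shows "component M d x = (if d \<in> S then c d else \<zero>\<^bsub>M\<^esub>)"
proof -
  let ?c = "\<lambda>d. if d \<in> S then c d else \<zero>\<^bsub>M\<^esub>"
  have cS: "c \<in> S \<rightarrow> carrier M" using assms(2) part_carrier by auto
  have sub: "{d. ?c d \<noteq> \<zero>\<^bsub>M\<^esub>} \<subseteq> S" by auto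
  have "x = (\<Oplus>\<^bsub>M\<^esub>d\<in>S. ?c d)"
    unfolding assms(3) using cS by (intro M.finsum_cong') auto
  also have "\<dots> = (\<Oplus>\<^bsub>M\<^esub>d\<in>{d. ?c d \<noteq> \<zero>\<^bsub>M\<^esub>}. ?c d)"
    using assms(1) sub cS by (intro M.finsum_neutral_superset) auto
  finally have x: "x = (\<Oplus>\<^bsub>M\<^esub>d\<in>{d. ?c d \<noteq> \<zero>\<^bsub>M\<^esub>}. ?c d)" .
  have xc: "x \<in> carrier M" unfolding assms(3) using cS by (rule M.finsum_closed)
  have "(THE c. (\<forall>d. c d \<in> part M d) \<and> finite {d. c d \<noteq> \<zero>\<^bsub>M\<^esub>} \<and>
     x = (\<Oplus>\<^bsub>M\<^esub>d\<in>{d. c d \<noteq> \<zero>\<^bsub>M\<^esub>}. c d)) = ?c"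
    using x assms(1,2) sub
    by (intro the1_equality[OF decomposition[OF xc]] conjI allI)
      (auto simp: part_zero intro: finite_subset)
  then show ?thesis unfolding component_def by simp
qed

lemma component_closed [simp, intro]: "x \<in> carrier M \<Longrightarrow> component M d x \<in> carrier M"
  using component_part part_carrier by blast

lemma component_sum_superset:
  assumes "x \<in> carrier M" "finite S" "{d. component M d x \<noteq> \<zero>\<^bsub>M\<^esub>} \<subseteq> S"
  shows "x = (\<Oplus>\<^bsub>M\<^esub>d\<in>S. component M d x)"
  using M.finsum_neutral_superset[OF assms(2,3)] component_sum[OF assms(1)] assms(1)
  by auto

lemma component_homogeneous:
  "x \<in> part M j \<Longrightarrow> component M d x = (if d = j then x else \<zero>\<^bsub>M\<^esub>)"
  using component_unique[of "{j}" "\<lambda>_. x" x d] part_carrier by simp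

lemma component_add:
  assumes "x \<in> carrier M" "y \<in> carrier M"
  shows "component M d (x \<oplus>\<^bsub>M\<^esub> y) = component M d x \<oplus>\<^bsub>M\<^esub> component M d y"
proof -
  let ?S = "{d. component M d x \<noteq> \<zero>\<^bsub>M\<^esub>} \<union> {d. component M d y \<noteq> \<zero>\<^bsub>M\<^esub>}"
  have f: "finite ?S" using component_finite assms by blast
  have "x \<oplus>\<^bsub>M\<^esub> y = (\<Oplus>\<^bsub>M\<^esub>d\<in>?S. component M d x) \<oplus>\<^bsub>M\<^esub> (\<Oplus>\<^bsub>M\<^esub>d\<in>?S. component M d y)"
    using component_sum_superset[of x ?S] component_sum_superset[of y ?S] assms f by simp
  also have "\<dots> = (\<Oplus>\<^bsub>M\<^esub>d\<in>?S. component M d x \<oplus>\<^bsub>M\<^esub> component M d y)"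
    using assms by (intro M.finsum_addf[symmetric]) auto
  finally show ?thesis
    using component_unique[OF f, of "\<lambda>d. component M d x \<oplus>\<^bsub>M\<^esub> component M d y" "x \<oplus>\<^bsub>M\<^esub> y" d]
      component_part assms part_add by (auto split: if_splits)
qed

lemma component_zero [simp]: "component M d \<zero>\<^bsub>M\<^esub> = \<zero>\<^bsub>M\<^esub>"
  using component_homogeneous[OF part_zero] by auto

text \<open>An element is the finite sum of its components. Zero lies in every
  \<open>part M d\<close>, so the empty sum falls under the homogeneous case.\<close>

lemma graded_induct [consumes 1, case_names homogeneous add]:
  assumes "x \<in> carrier M"
    and hom: "\<And>j x. x \<in> part M j \<Longrightarrow> Q x"
    and add: "\<And>x y. x \<in> carrier M \<Longrightarrow> y \<in> carrier M \<Longrightarrow> Q x \<Longrightarrow> Q y \<Longrightarrow> Q (x \<oplus>\<^bsub>M\<^esub> y)"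
  shows "Q x"
proof -
  have "Q (\<Oplus>\<^bsub>M\<^esub>d\<in>S. component M d x)" if "finite S" for S
    using that
  proof (induction S rule: finite_induct)
    case empty
    show ?case using hom[OF part_zero] by simp
  next
    case (insert a S)
    have "Q (component M a x)" using hom component_part assms(1) by blast
    then show ?case using insert assms(1) by (auto intro!: add)
  qed
  then show ?thesis using component_sum[OF assms(1)] component_finite[OF assms(1)] by metis
qed

text \<open>Additivity in \<open>x\<close> reduces this to homogeneous \<open>x\<close>, where both
  sides are \<open>r x\<close> or zero. Membership of \<open>r\<close> in \<open>carrier R\<close>
  is a separate assumption, as the locale relates \<open>part R\<close> to the action on
  \<open>M\<close> only.\<close>

lemma component_smult:
  assumes "r \<in> part R i" "r \<in> carrier R" "x \<in> carrier M"
  shows "component M (i + k) (r \<odot>\<^bsub>M\<^esub> x) = r \<odot>\<^bsub>M\<^esub> component M k x"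
  using assms(3)
proof (induction rule: graded_induct)
  case (homogeneous j x)
  then have "r \<odot>\<^bsub>M\<^esub> x \<in> part M (i + j)" using part_smult assms by blast
  then show ?case
    using homogeneous assms(2) by (simp add: component_homogeneous)
next
  case (add x y)
  then show ?case using assms(2) by (simp add: smult_r_distr component_add)
qed

end

text \<open>A grading obtained from projections \<open>pr d\<close>. Uniqueness of the decomposition
  follows by applying \<open>pr k\<close> to any other one: only the term of degree \<open>k\<close>
  survives.\<close>

lemma graded_left_moduleI:
  assumes lm: "left_module R M"
    and sub: "\<And>d. additive_subgroup (part M d) M"
    and sm: "\<And>i j r x. r \<in> part R i \<Longrightarrow> x \<in> part M j \<Longrightarrow> r \<odot>\<^bsub>M\<^esub> x \<in> part M (i + j)"
    and pr_part: "\<And>d x. x \<in> carrier M \<Longrightarrow> pr d x \<in> part M d"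
    and pr_add: "\<And>d x y. x \<in> carrier M \<Longrightarrow> y \<in> carrier M \<Longrightarrow>
      pr d (x \<oplus>\<^bsub>M\<^esub> y) = pr d x \<oplus>\<^bsub>M\<^esub> pr d y"
    and pr_hom: "\<And>d j x. x \<in> part M j \<Longrightarrow> pr d x = (if d = j then x else \<zero>\<^bsub>M\<^esub>)"
    and dec: "\<And>x. x \<in> carrier M \<Longrightarrow>
      \<exists>S. finite S \<and> (\<forall>d. d \<notin> S \<longrightarrow> pr d x = \<zero>\<^bsub>M\<^esub>) \<and> x = (\<Oplus>\<^bsub>M\<^esub>d\<in>S. pr d x)"
  shows "graded_left_module R M"
  unfolding graded_left_module_def
proof (intro conjI allI ballI)
  interpret left_mod R M by unfold_locales fact
  have pc: "x \<in> part M d \<Longrightarrow> x \<in> carrier M" for x d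
    using additive_subgroup.a_Hcarr[OF sub] .
  fix x assume x: "x \<in> carrier M"
  obtain S where S: "finite S" "\<And>d. d \<notin> S \<Longrightarrow> pr d x = \<zero>\<^bsub>M\<^esub>" "x = (\<Oplus>\<^bsub>M\<^esub>d\<in>S. pr d x)"
    using dec[OF x] by blast
  have sub': "{d. pr d x \<noteq> \<zero>\<^bsub>M\<^esub>} \<subseteq> S" using S(2) by blast
  show "\<exists>!c. (\<forall>d. c d \<in> part M d) \<and> finite {d. c d \<noteq> \<zero>\<^bsub>M\<^esub>} \<and>
        x = (\<Oplus>\<^bsub>M\<^esub>d\<in>{d. c d \<noteq> \<zero>\<^bsub>M\<^esub>}. c d)"
  proof (rule ex1I[of _ "\<lambda>d. pr d x"])
    have "(\<Oplus>\<^bsub>M\<^esub>d\<in>S. pr d x) = (\<Oplus>\<^bsub>M\<^esub>d\<in>{d. pr d x \<noteq> \<zero>\<^bsub>M\<^esub>}. pr d x)"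
      using S(1) sub' pr_part[OF x] pc by (intro M.finsum_neutral_superset) auto
    then show "(\<forall>d. pr d x \<in> part M d) \<and> finite {d. pr d x \<noteq> \<zero>\<^bsub>M\<^esub>} \<and>
        x = (\<Oplus>\<^bsub>M\<^esub>d\<in>{d. pr d x \<noteq> \<zero>\<^bsub>M\<^esub>}. pr d x)"
      using S pr_part[OF x] finite_subset[OF sub' S(1)] by simp
  next
    fix c assume c: "(\<forall>d. c d \<in> part M d) \<and> finite {d. c d \<noteq> \<zero>\<^bsub>M\<^esub>} \<and>
        x = (\<Oplus>\<^bsub>M\<^esub>d\<in>{d. c d \<noteq> \<zero>\<^bsub>M\<^esub>}. c d)"
    let ?T = "{d. c d \<noteq> \<zero>\<^bsub>M\<^esub>}"
    have cc: "c d \<in> carrier M" for d using c pc by blast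
    have pz: "pr k \<zero>\<^bsub>M\<^esub> = \<zero>\<^bsub>M\<^esub>" for k
      using pr_hom[OF additive_subgroup.zero_closed[OF sub], of k k] by simp
    have "c k = pr k x" for k
    proof -
      have "pr k x = pr k (\<Oplus>\<^bsub>M\<^esub>d\<in>?T. c d)" using c by simp
      also have "\<dots> = (\<Oplus>\<^bsub>M\<^esub>d\<in>?T. pr k (c d))"
        using c cc pc[OF pr_part] pr_add
        by (intro additive_map_finsum[OF M.abelian_group_axioms M.abelian_group_axioms]) auto
      also have "\<dots> = (\<Oplus>\<^bsub>M\<^esub>d\<in>?T. if k = d then c d else \<zero>\<^bsub>M\<^esub>)"
      proof -
        have "pr k (c d) = (if k = d then c d else \<zero>\<^bsub>M\<^esub>)" for d
          using pr_hom[of "c d" d k] c by simp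
        then show ?thesis by simp
      qed
      also have "\<dots> = c k"
      proof (cases "k \<in> ?T")
        case True
        then show ?thesis using c cc by (subst M.finsum_singleton) auto
      next
        case False
        then have "(\<Oplus>\<^bsub>M\<^esub>d\<in>?T. if k = d then c d else \<zero>\<^bsub>M\<^esub>) = (\<Oplus>\<^bsub>M\<^esub>d\<in>?T. \<zero>\<^bsub>M\<^esub>)"
          by (intro M.finsum_cong') auto
        then show ?thesis using False by simp
      qed
      finally show ?thesis by simp
    qed
    then show "c = (\<lambda>d. pr d x)" by auto
  qed
qed (use assms in auto)


section \<open>Lifting along projective modules\<close>

lemma graded_homs_module_hom: "f \<in> graded_homs R M N d \<Longrightarrow> f \<in> module_hom R M N"
  by (simp add: graded_homs_def)

lemma graded_homs_closed: "f \<in> graded_homs R M N d \<Longrightarrow> x \<in> carrier M \<Longrightarrow> f x \<in> carrier N"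
  by (auto simp: graded_homs_def module_hom_def)

lemma graded_homs_add: "f \<in> graded_homs R M N d \<Longrightarrow> x \<in> carrier M \<Longrightarrow> y \<in> carrier M \<Longrightarrow>
    f (x \<oplus>\<^bsub>M\<^esub> y) = f x \<oplus>\<^bsub>N\<^esub> f y"
  by (auto simp: graded_homs_def module_hom_def)

lemma graded_homs_smult: "f \<in> graded_homs R M N d \<Longrightarrow> r \<in> carrier R \<Longrightarrow> x \<in> carrier M \<Longrightarrow>
    f (r \<odot>\<^bsub>M\<^esub> x) = r \<odot>\<^bsub>N\<^esub> f x"
  by (auto simp: graded_homs_def module_hom_def)

lemma graded_homs_part: "f \<in> graded_homs R M N d \<Longrightarrow> x \<in> part M j \<Longrightarrow> f x \<in> part N (j + d)"
  by (auto simp: graded_homs_def)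

lemma graded_homs_extensional: "f \<in> graded_homs R M N d \<Longrightarrow> f \<in> extensional (carrier M)"
  by (auto simp: graded_homs_def)

lemma graded_homs_restrictI:
  assumes M: "graded_mod R M"
    and "\<And>x. x \<in> carrier M \<Longrightarrow> f x \<in> carrier N"
    and "\<And>x y. x \<in> carrier M \<Longrightarrow> y \<in> carrier M \<Longrightarrow> f (x \<oplus>\<^bsub>M\<^esub> y) = f x \<oplus>\<^bsub>N\<^esub> f y"
    and "\<And>r x. r \<in> carrier R \<Longrightarrow> x \<in> carrier M \<Longrightarrow> f (r \<odot>\<^bsub>M\<^esub> x) = r \<odot>\<^bsub>N\<^esub> f x"
    and "\<And>x j. x \<in> part M j \<Longrightarrow> f x \<in> part N (j + d)"
  shows "restrict f (carrier M) \<in> graded_homs R M N d"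
proof -
  interpret graded_mod R M by fact
  show ?thesis
    using assms part_carrier by (auto simp: graded_homs_def module_hom_def)
qed

lemma graded_homs_compose:
  assumes "graded_mod R L" "f \<in> graded_homs R L M d" "g \<in> graded_homs R M N k"
  shows "compose (carrier L) g f \<in> graded_homs R L N (d + k)"
  unfolding compose_def
  using assms(2,3) graded_homs_part[OF assms(3) graded_homs_part[OF assms(2)]]
  by (intro graded_homs_restrictI assms(1))
    (auto simp: graded_homs_closed[OF assms(2)] graded_homs_closed[OF assms(3)]
      graded_homs_add[OF assms(2)] graded_homs_add[OF assms(3)]
      graded_homs_smult[OF assms(2)] graded_homs_smult[OF assms(3)] add.assoc)

lemma free_module_simps [simp]:
  "carrier (free_module R k) = {..<k} \<rightarrow>\<^sub>E carrier R"
  "add (free_module R k) f g = (\<lambda>i\<in>{..<k}. f i \<oplus>\<^bsub>R\<^esub> g i)"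
  "smult (free_module R k) r f = (\<lambda>i\<in>{..<k}. r \<otimes>\<^bsub>R\<^esub> f i)"
  "zero (free_module R k) = (\<lambda>i\<in>{..<k}. \<zero>\<^bsub>R\<^esub>)"
  by (simp_all add: free_module_def pointwise_def regular_def)

text \<open>A vector is the sum of its entries times unit vectors, and \<open>u i\<close> is the
  image of the \<open>i\<close>-th unit vector. The induction on \<open>m\<close> concerns the
  vector truncated after its first \<open>m\<close> entries.\<close>

lemma free_module_hom_expansion:
  assumes R: "ring R" and M: "abelian_group M" and p: "p \<in> module_hom R (free_module R k) M"
    and x: "x \<in> {..<k} \<rightarrow>\<^sub>E carrier R"
  defines "u \<equiv> \<lambda>i. p (\<lambda>j\<in>{..<k}. if j = i then \<one>\<^bsub>R\<^esub> else \<zero>\<^bsub>R\<^esub>)"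
  shows "p x = (\<Oplus>\<^bsub>M\<^esub>i\<in>{..<k}. x i \<odot>\<^bsub>M\<^esub> u i)"
proof -
  interpret R: ring R by fact
  interpret M: abelian_group M by fact
  have xi: "x i \<in> carrier R" if "i < k" for i using x that by auto
  have e: "(\<lambda>j\<in>{..<k}. if j = i then \<one>\<^bsub>R\<^esub> else \<zero>\<^bsub>R\<^esub>) \<in> carrier (free_module R k)" for i
    by auto
  have uc: "u i \<in> carrier M" for i unfolding u_def using p e by (rule module_hom_in)
  have xu: "x i \<odot>\<^bsub>M\<^esub> u i = p (\<lambda>j\<in>{..<k}. if j = i then x i else \<zero>\<^bsub>R\<^esub>)" if "i < k" for i
  proof -
    have "x i \<odot>\<^bsub>M\<^esub> u i = p (x i \<odot>\<^bsub>free_module R k\<^esub> (\<lambda>j\<in>{..<k}. if j = i then \<one>\<^bsub>R\<^esub> else \<zero>\<^bsub>R\<^esub>))"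
      unfolding u_def by (rule LinearCombinations.module_hom_smult[OF p xi[OF that] e, symmetric])
    also have "x i \<odot>\<^bsub>free_module R k\<^esub> (\<lambda>j\<in>{..<k}. if j = i then \<one>\<^bsub>R\<^esub> else \<zero>\<^bsub>R\<^esub>)
        = (\<lambda>j\<in>{..<k}. if j = i then x i else \<zero>\<^bsub>R\<^esub>)"
      using xi[OF that] by auto
    finally show ?thesis .
  qed
  have "p (\<lambda>j\<in>{..<k}. if j < m then x j else \<zero>\<^bsub>R\<^esub>) = (\<Oplus>\<^bsub>M\<^esub>i\<in>{..<m}. x i \<odot>\<^bsub>M\<^esub> u i)"
    if "m \<le> k" for m
    using that
  proof (induction m)
    case 0
    let ?z = "\<lambda>j\<in>{..<k}. \<zero>\<^bsub>R\<^esub>"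
    have z: "?z \<in> carrier (free_module R k)" by auto
    \<comment> \<open>The zero vector equals its double, so its image vanishes by cancellation in
      \<open>M\<close>.\<close>
    have "p (?z \<oplus>\<^bsub>free_module R k\<^esub> ?z) = p ?z \<oplus>\<^bsub>M\<^esub> p ?z"
      by (rule LinearCombinations.module_hom_add[OF p z z])
    moreover have "?z \<oplus>\<^bsub>free_module R k\<^esub> ?z = ?z" by auto
    ultimately have "p ?z = \<zero>\<^bsub>M\<^esub>"
      using module_hom_in[OF p z] by (simp add: M.add.l_cancel_one')
    then show ?case by (simp add: restrict_def)
  next
    case (Suc m)
    let ?a = "\<lambda>j\<in>{..<k}. if j < m then x j else \<zero>\<^bsub>R\<^esub>"
    let ?b = "\<lambda>j\<in>{..<k}. if j = m then x m else \<zero>\<^bsub>R\<^esub>"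
    have ab: "?a \<in> carrier (free_module R k)" "?b \<in> carrier (free_module R k)"
      using xi Suc.prems by auto
    have "(\<lambda>j\<in>{..<k}. if j < Suc m then x j else \<zero>\<^bsub>R\<^esub>) = ?b \<oplus>\<^bsub>free_module R k\<^esub> ?a"
      using xi by (auto simp: fun_eq_iff less_Suc_eq)
    then have "p (\<lambda>j\<in>{..<k}. if j < Suc m then x j else \<zero>\<^bsub>R\<^esub>) = p ?b \<oplus>\<^bsub>M\<^esub> p ?a"
      by (simp only: LinearCombinations.module_hom_add[OF p ab(2,1)])
    also have "\<dots> = x m \<odot>\<^bsub>M\<^esub> u m \<oplus>\<^bsub>M\<^esub> (\<Oplus>\<^bsub>M\<^esub>i\<in>{..<m}. x i \<odot>\<^bsub>M\<^esub> u i)"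
      by (simp only: Suc.IH[OF Suc_leD[OF Suc.prems]] xu[OF Suc_le_lessD[OF Suc.prems]])
    also have "\<dots> = (\<Oplus>\<^bsub>M\<^esub>i\<in>{..<Suc m}. x i \<odot>\<^bsub>M\<^esub> u i)"
    proof -
      have "x i \<odot>\<^bsub>M\<^esub> u i \<in> carrier M" if "i < k" for i
        using xu[OF that] xi[OF that] module_hom_in[OF p, of "\<lambda>j\<in>{..<k}. if j = i then x i else \<zero>\<^bsub>R\<^esub>"]
        by auto
      then show ?thesis using Suc.prems by (subst lessThan_Suc, subst M.finsum_insert) auto
    qed
    finally show ?case .
  qed
  from this[of k] have "p (\<lambda>j\<in>{..<k}. if j < k then x j else \<zero>\<^bsub>R\<^esub>)
      = (\<Oplus>\<^bsub>M\<^esub>i\<in>{..<k}. x i \<odot>\<^bsub>M\<^esub> u i)" by simp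
  moreover have "(\<lambda>j\<in>{..<k}. if j < k then x j else \<zero>\<^bsub>R\<^esub>) = x"
    using PiE_arb[OF x] by (auto simp: restrict_def fun_eq_iff)
  ultimately show ?thesis by simp
qed

text \<open>As a summand of \<open>R\<^sup>k\<close>, the module \<open>P\<close> is generated by
  the images \<open>u i\<close> of the unit vectors. A preimage \<open>m i\<close> of
  \<open>f (u i)\<close> is chosen for each, and \<open>h x\<close> combines the \<open>m i\<close>
  with the entries of \<open>s x\<close>. In place of surjectivity of \<open>g\<close> only an
  inclusion of images is assumed, which is what exactness of a resolution provides.\<close>

lemma fg_projective_lift:
  assumes P: "left_module R P" "fg_projective R P" and M: "left_module R M" and N: "left_module R N"
    and g: "g \<in> module_hom R M N" and f: "f \<in> module_hom R P N"
    and fg: "f ` carrier P \<subseteq> g ` carrier M"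
  obtains h where "h \<in> module_hom R P M" "\<And>x. x \<in> carrier P \<Longrightarrow> g (h x) = f x"
proof -
  interpret P: left_mod R P by unfold_locales fact
  interpret M: left_mod R M by unfold_locales fact
  interpret N: left_mod R N by unfold_locales fact
  obtain k s p where s: "s \<in> module_hom R P (free_module R k)"
    and p: "p \<in> module_hom R (free_module R k) P" and ps: "\<And>x. x \<in> carrier P \<Longrightarrow> p (s x) = x"
    using P(2) unfolding fg_projective_def by blast
  define u where "u = (\<lambda>i. p (\<lambda>j\<in>{..<k}. if j = i then \<one>\<^bsub>R\<^esub> else \<zero>\<^bsub>R\<^esub>))"
  have u: "u i \<in> carrier P" for i unfolding u_def by (rule module_hom_in[OF p]) auto
  have "\<exists>m. m \<in> carrier M \<and> g m = f (u i)" for i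
  proof -
    have "f (u i) \<in> g ` carrier M" using fg u[of i] by blast
    then show ?thesis by auto
  qed
  then have "\<exists>m. \<forall>i. m i \<in> carrier M \<and> g (m i) = f (u i)" by (intro choice) blast
  then obtain m where m: "\<And>i. m i \<in> carrier M" "\<And>i. g (m i) = f (u i)" by blast
  have sx: "s x \<in> {..<k} \<rightarrow>\<^sub>E carrier R" if "x \<in> carrier P" for x
    using module_hom_in[OF s that] by simp
  have sxi: "s x i \<in> carrier R" if "x \<in> carrier P" "i < k" for x i
    using sx[OF that(1)] that(2) by auto
  let ?h = "\<lambda>x. \<Oplus>\<^bsub>M\<^esub>i\<in>{..<k}. s x i \<odot>\<^bsub>M\<^esub> m i"
  have "?h \<in> module_hom R P M"
  proof (rule module_homI)
    fix x y assume xy: "x \<in> carrier P" "y \<in> carrier P"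
    have "?h (x \<oplus>\<^bsub>P\<^esub> y) = (\<Oplus>\<^bsub>M\<^esub>i\<in>{..<k}. s x i \<odot>\<^bsub>M\<^esub> m i \<oplus>\<^bsub>M\<^esub> s y i \<odot>\<^bsub>M\<^esub> m i)"
      using xy m sxi LinearCombinations.module_hom_add[OF s xy]
      by (intro M.M.finsum_cong') (auto simp: M.smult_l_distr)
    also have "\<dots> = ?h x \<oplus>\<^bsub>M\<^esub> ?h y"
      using xy m sxi by (intro M.M.finsum_addf) auto
    finally show "?h (x \<oplus>\<^bsub>P\<^esub> y) = ?h x \<oplus>\<^bsub>M\<^esub> ?h y" .
  next
    fix r x assume r: "r \<in> carrier R" and x: "x \<in> carrier P"
    have "?h (r \<odot>\<^bsub>P\<^esub> x) = (\<Oplus>\<^bsub>M\<^esub>i\<in>{..<k}. r \<odot>\<^bsub>M\<^esub> (s x i \<odot>\<^bsub>M\<^esub> m i))"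
      using r x m sxi LinearCombinations.module_hom_smult[OF s r x]
      by (intro M.M.finsum_cong') (auto simp: M.smult_assoc)
    also have "\<dots> = r \<odot>\<^bsub>M\<^esub> ?h x"
      using r x m sxi M.smult_r_distr
      by (intro additive_map_finsum[OF M.M.abelian_group_axioms M.M.abelian_group_axioms, symmetric]) auto
    finally show "?h (r \<odot>\<^bsub>P\<^esub> x) = r \<odot>\<^bsub>M\<^esub> ?h x" .
  qed (use m sxi in auto)
  moreover have "g (?h x) = f x" if x: "x \<in> carrier P" for x
  proof -
    have "g (?h x) = (\<Oplus>\<^bsub>N\<^esub>i\<in>{..<k}. g (s x i \<odot>\<^bsub>M\<^esub> m i))"
      using x m sxi by (intro module_hom_finsum[OF M.M.abelian_group_axioms N.M.abelian_group_axioms g]) auto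
    also have "\<dots> = (\<Oplus>\<^bsub>N\<^esub>i\<in>{..<k}. f (s x i \<odot>\<^bsub>P\<^esub> u i))"
      using x m sxi u module_hom_in[OF f]
        LinearCombinations.module_hom_smult[OF g] LinearCombinations.module_hom_smult[OF f]
      by (intro N.M.finsum_cong') (auto)
    also have "\<dots> = f (\<Oplus>\<^bsub>P\<^esub>i\<in>{..<k}. s x i \<odot>\<^bsub>P\<^esub> u i)"
      using x sxi u
      by (intro module_hom_finsum[OF P.M.abelian_group_axioms N.M.abelian_group_axioms f, symmetric]) auto
    also have "(\<Oplus>\<^bsub>P\<^esub>i\<in>{..<k}. s x i \<odot>\<^bsub>P\<^esub> u i) = p (s x)"
      unfolding u_def
      by (rule free_module_hom_expansion[OF P.R.ring_axioms P.M.abelian_group_axioms p sx[OF x], symmetric])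
    finally show ?thesis using ps[OF x] by simp
  qed
  ultimately show thesis using that by blast
qed

section \<open>Graded algebras and lifts of a given degree\<close>

definition graded_regular :: "(complex, 'r) graded_module \<Rightarrow> ('r, 'r) graded_module" where
  "graded_regular R = module.extend (regular R) (graded_module.fields (part R))"

lemma graded_regular_simps [simp]:
  "carrier (graded_regular R) = carrier R" "mult (graded_regular R) = mult R"
  "one (graded_regular R) = one R" "zero (graded_regular R) = zero R"
  "add (graded_regular R) = add R" "smult (graded_regular R) = mult R"
  "part (graded_regular R) = part R"
  by (simp_all add: graded_regular_def regular_def module.extend_def graded_module.fields_def)

text \<open>The last five assumptions say that \<open>c \<mapsto> c 1\<close> is a unital ring map
  from the complex numbers to central elements of degree 0. This makes the spaces of graded
  homomorphisms complex vector spaces.\<close>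

locale graded_alg =
  fixes R :: "(complex, 'r) graded_module"
  assumes graded_regular: "graded_left_module R (graded_regular R)"
    and scalar_part: "c \<odot>\<^bsub>R\<^esub> \<one>\<^bsub>R\<^esub> \<in> part R 0"
    and scalar_central: "r \<in> carrier R \<Longrightarrow>
      (c \<odot>\<^bsub>R\<^esub> \<one>\<^bsub>R\<^esub>) \<otimes>\<^bsub>R\<^esub> r = r \<otimes>\<^bsub>R\<^esub> (c \<odot>\<^bsub>R\<^esub> \<one>\<^bsub>R\<^esub>)"
    and scalar_add: "(c + c') \<odot>\<^bsub>R\<^esub> \<one>\<^bsub>R\<^esub> = c \<odot>\<^bsub>R\<^esub> \<one>\<^bsub>R\<^esub> \<oplus>\<^bsub>R\<^esub> c' \<odot>\<^bsub>R\<^esub> \<one>\<^bsub>R\<^esub>"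
    and scalar_mult: "(c * c') \<odot>\<^bsub>R\<^esub> \<one>\<^bsub>R\<^esub> = (c \<odot>\<^bsub>R\<^esub> \<one>\<^bsub>R\<^esub>) \<otimes>\<^bsub>R\<^esub> (c' \<odot>\<^bsub>R\<^esub> \<one>\<^bsub>R\<^esub>)"
    and scalar_one: "1 \<odot>\<^bsub>R\<^esub> \<one>\<^bsub>R\<^esub> = \<one>\<^bsub>R\<^esub>"
begin

sublocale Reg: graded_mod R "graded_regular R"
  by unfold_locales (fact graded_regular)

lemma scalar_carrier [simp, intro]: "c \<odot>\<^bsub>R\<^esub> \<one>\<^bsub>R\<^esub> \<in> carrier R"
  using Reg.part_carrier[of _ 0] scalar_part by simp

text \<open>The degree \<open>d\<close> part of \<open>h\<close>: for \<open>x\<close> of degree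
  \<open>j\<close> the component of \<open>h x\<close> in degree \<open>j + d\<close> is kept, and
  the result is extended additively. Linearity over \<open>R\<close> is checked for homogeneous
  scalars and elements, where a scalar of degree \<open>i\<close> moves components by
  \<open>i\<close>.\<close>

lemma degree_shift_hom:
  assumes P: "graded_mod R P" and M: "graded_mod R M" and h: "h \<in> module_hom R P M"
  obtains h' where "h' \<in> graded_homs R P M d"
    "\<And>j x. x \<in> part P j \<Longrightarrow> h' x = component M (j + d) (h x)"
proof -
  interpret P: graded_mod R P by fact
  interpret M: graded_mod R M by fact
  let ?t = "\<lambda>j x. component M (j + d) (h (component P j x))"
  let ?S = "\<lambda>x. {j. component P j x \<noteq> \<zero>\<^bsub>P\<^esub>}"
  let ?h = "\<lambda>x. \<Oplus>\<^bsub>M\<^esub>j\<in>?S x. ?t j x"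
  have hc: "h x \<in> carrier M" if "x \<in> carrier P" for x using module_hom_in[OF h that] .
  have h0: "h \<zero>\<^bsub>P\<^esub> = \<zero>\<^bsub>M\<^esub>"
    using module_hom_zero[OF P.M.abelian_group_axioms M.M.abelian_group_axioms h] .
  have t0: "?t j x = \<zero>\<^bsub>M\<^esub>" if "j \<notin> ?S x" for j x using that h0 by simp
  have tc: "?t j x \<in> carrier M" if "x \<in> carrier P" for j x using that hc by auto
  \<comment> \<open>Indices outside the support contribute zero, so the index set may be enlarged
    until \<open>x\<close>, \<open>y\<close> and their sum share one.\<close>
  have sup: "?h x = (\<Oplus>\<^bsub>M\<^esub>j\<in>T. ?t j x)" if "finite T" "?S x \<subseteq> T" "x \<in> carrier P" for T x
  proof (rule M.M.finsum_neutral_superset[symmetric])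
    show "?t j x = \<zero>\<^bsub>M\<^esub>" if "j \<in> T - ?S x" for j using that by (intro t0) blast
  qed (use that tc in auto)
  have hom: "?h x = component M (j + d) (h x)" if x: "x \<in> part P j" for j x
  proof -
    have "?h x = (\<Oplus>\<^bsub>M\<^esub>i\<in>{j}. ?t i x)"
      using x by (intro sup) (auto simp: P.component_homogeneous P.part_carrier)
    then show ?thesis using x hc P.part_carrier by (simp add: P.component_homogeneous)
  qed
  have cl: "?h x \<in> carrier M" if "x \<in> carrier P" for x
    using tc that by (intro M.M.finsum_closed) auto
  have add: "?h (x \<oplus>\<^bsub>P\<^esub> y) = ?h x \<oplus>\<^bsub>M\<^esub> ?h y" if xy: "x \<in> carrier P" "y \<in> carrier P" for x y
  proof -
    let ?T = "?S x \<union> ?S y \<union> ?S (x \<oplus>\<^bsub>P\<^esub> y)"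
    have f: "finite ?T" using xy P.component_finite[of x] P.component_finite[of y]
        P.component_finite[of "x \<oplus>\<^bsub>P\<^esub> y"] by auto
    have "?h (x \<oplus>\<^bsub>P\<^esub> y) = (\<Oplus>\<^bsub>M\<^esub>j\<in>?T. ?t j (x \<oplus>\<^bsub>P\<^esub> y))" using f xy by (intro sup) auto
    also have "\<dots> = (\<Oplus>\<^bsub>M\<^esub>j\<in>?T. ?t j x \<oplus>\<^bsub>M\<^esub> ?t j y)"
    proof -
      have "?t j (x \<oplus>\<^bsub>P\<^esub> y) = ?t j x \<oplus>\<^bsub>M\<^esub> ?t j y" for j
        using xy hc by (simp add: P.component_add M.component_add LinearCombinations.module_hom_add[OF h])
      then show ?thesis by simp
    qed
    also have "\<dots> = (\<Oplus>\<^bsub>M\<^esub>j\<in>?T. ?t j x) \<oplus>\<^bsub>M\<^esub> (\<Oplus>\<^bsub>M\<^esub>j\<in>?T. ?t j y)"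
      using tc xy by (intro M.M.finsum_addf) auto
    also have "(\<Oplus>\<^bsub>M\<^esub>j\<in>?T. ?t j x) = ?h x" using f xy by (intro sup[symmetric]) auto
    also have "(\<Oplus>\<^bsub>M\<^esub>j\<in>?T. ?t j y) = ?h y" using f xy by (intro sup[symmetric]) auto
    finally show ?thesis .
  qed
  have sm: "?h (r \<odot>\<^bsub>P\<^esub> x) = r \<odot>\<^bsub>M\<^esub> ?h x" if r: "r \<in> carrier R" and x: "x \<in> carrier P" for r x
    using x
  proof (induction x rule: P.graded_induct)
    case (homogeneous j x)
    then have xc: "x \<in> carrier P" using P.part_carrier by blast
    have "r \<in> carrier (graded_regular R)" using r by simp
    then show ?case
    proof (induction r rule: Reg.graded_induct)
      case (homogeneous i r)
      then have ri: "r \<in> part R i" "r \<in> carrier R" using Reg.part_carrier by auto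
      have "?h (r \<odot>\<^bsub>P\<^esub> x) = component M (i + (j + d)) (r \<odot>\<^bsub>M\<^esub> h x)"
        using hom[OF P.part_smult[OF ri(1) \<open>x \<in> part P j\<close>]] LinearCombinations.module_hom_smult[OF h ri(2) xc]
        by (simp add: add.assoc)
      also have "\<dots> = r \<odot>\<^bsub>M\<^esub> component M (j + d) (h x)"
        using M.component_smult[OF ri hc[OF xc]] .
      finally show ?case using hom[OF \<open>x \<in> part P j\<close>] by simp
    next
      case (add r s)
      then show ?case
        using xc \<open>\<And>x y. x \<in> carrier P \<Longrightarrow> y \<in> carrier P \<Longrightarrow> ?h (x \<oplus>\<^bsub>P\<^esub> y) = ?h x \<oplus>\<^bsub>M\<^esub> ?h y\<close> cl
        by (simp add: P.smult_l_distr M.smult_l_distr)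
    qed
  next
    case (add x y)
    then show ?case
      using r \<open>\<And>x y. x \<in> carrier P \<Longrightarrow> y \<in> carrier P \<Longrightarrow> ?h (x \<oplus>\<^bsub>P\<^esub> y) = ?h x \<oplus>\<^bsub>M\<^esub> ?h y\<close> cl
      by (simp add: P.smult_r_distr M.smult_r_distr)
  qed
  have "restrict ?h (carrier P) \<in> graded_homs R P M d"
  proof (rule graded_homs_restrictI[OF P])
    show "?h x \<in> part M (j + d)" if "x \<in> part P j" for x j
      using hom[OF that] M.component_part hc P.part_carrier[OF that] by simp
  qed (use add sm cl in auto)
  then show thesis using that hom P.part_carrier by (metis (no_types, lifting) restrict_apply')
qed

text \<open>An ungraded lift is cut down to its degree \<open>d\<close> part. This is still a lift:
  \<open>g\<close> has degree 0 and commutes with taking components, and \<open>f x\<close> is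
  already homogeneous of the right degree for homogeneous \<open>x\<close>.\<close>

lemma graded_lift:
  assumes P: "graded_mod R P" "fg_projective R P" and M: "graded_mod R M" and N: "graded_mod R N"
    and g: "g \<in> graded_homs R M N 0" and f: "f \<in> graded_homs R P N d"
    and fg: "f ` carrier P \<subseteq> g ` carrier M"
  obtains h where "h \<in> graded_homs R P M d" "\<And>x. x \<in> carrier P \<Longrightarrow> g (h x) = f x"
proof -
  interpret P: graded_mod R P by fact
  interpret M: graded_mod R M by fact
  interpret N: graded_mod R N by fact
  note [simp] = graded_homs_closed[OF g] graded_homs_closed[OF f]
  obtain h0 where h0: "h0 \<in> module_hom R P M" "\<And>x. x \<in> carrier P \<Longrightarrow> g (h0 x) = f x"
    using fg_projective_lift[OF P.left_module P(2) M.left_module N.left_module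
        graded_homs_module_hom[OF g] graded_homs_module_hom[OF f] fg] by blast
  obtain h where h: "h \<in> graded_homs R P M d"
    "\<And>j x. x \<in> part P j \<Longrightarrow> h x = component M (j + d) (h0 x)"
    using degree_shift_hom[OF P(1) M h0(1), of d thesis] by blast
  have gcomp: "g (component M k y) = component N k (g y)" if "y \<in> carrier M" for k y
    using that
  proof (induction y rule: M.graded_induct)
    case (homogeneous j x)
    have "g \<zero>\<^bsub>M\<^esub> = \<zero>\<^bsub>N\<^esub>"
      using module_hom_zero[OF M.M.abelian_group_axioms N.M.abelian_group_axioms
          graded_homs_module_hom[OF g]] .
    then show ?case using homogeneous graded_homs_part[OF g homogeneous]
      by (simp add: M.component_homogeneous N.component_homogeneous)
  next
    case (add x y)
    then show ?case
      by (simp add: M.component_add N.component_add graded_homs_add[OF g])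
  qed
  have "g (h x) = f x" if "x \<in> carrier P" for x
    using that
  proof (induction x rule: P.graded_induct)
    case (homogeneous j x)
    then have xc: "x \<in> carrier P" using P.part_carrier by blast
    have "g (h x) = component N (j + d) (f x)"
      using h(2)[OF homogeneous] gcomp[OF module_hom_in[OF h0(1) xc]] h0(2)[OF xc] by simp
    then show ?case using graded_homs_part[OF f homogeneous] by (simp add: N.component_homogeneous)
  next
    case (add x y)
    then show ?case
      using graded_homs_closed[OF h(1)]
      by (simp add: graded_homs_add[OF g] graded_homs_add[OF f] graded_homs_add[OF h(1)])
  qed
  with h(1) show thesis using that by blast
qed

end


section \<open>Linear coordinates on cohomology\<close>

lemma complex_field_simps [simp]:
  "carrier complex_field = UNIV" "mult complex_field = (*)" "one complex_field = 1"
  "zero complex_field = 0" "add complex_field = (+)"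
  by (simp_all add: complex_field_def)

lemma regular_simps [simp]:
  "carrier (regular R) = carrier R" "mult (regular R) = mult R" "one (regular R) = one R"
  "zero (regular R) = zero R" "add (regular R) = add R" "smult (regular R) = mult R"
  by (simp_all add: regular_def)

lemma ring_complex_field: "ring complex_field"
proof (rule ringI)
  show "abelian_group complex_field"
  proof (rule abelian_groupI)
    show "\<exists>y\<in>carrier complex_field. y \<oplus>\<^bsub>complex_field\<^esub> x = \<zero>\<^bsub>complex_field\<^esub>" for x
      by (auto intro: exI[of _ "- x"])
  qed auto
  show "Group.monoid complex_field" by (rule monoidI) auto
qed (auto simp: algebra_simps)

text \<open>An injective linear functional identifies \<open>V\<close> with the subspace
  \<open>S\<close> of the complex numbers: \<open>UNIV\<close> in dimension one, \<open>{0}\<close>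
  in dimension zero. Closure under the operations is included because \<open>V\<close> is a bare
  record.\<close>

definition coordinatized :: "(complex, 'x) module \<Rightarrow> complex set \<Rightarrow> bool" where
  "coordinatized V S \<longleftrightarrow>
     (\<forall>x\<in>carrier V. \<forall>y\<in>carrier V. x \<oplus>\<^bsub>V\<^esub> y \<in> carrier V) \<and>
     (\<forall>c. \<forall>x\<in>carrier V. c \<odot>\<^bsub>V\<^esub> x \<in> carrier V) \<and> \<zero>\<^bsub>V\<^esub> \<in> carrier V \<and>
     (\<exists>F\<in>module_hom complex_field V (regular complex_field).
        inj_on F (carrier V) \<and> F ` carrier V = S)"

text \<open>The functional on \<open>V\<close> is followed by the inverse of the functional on
  \<open>U\<close>; equal images make this a linear bijection.\<close>

lemma coordinatized_iso:
  assumes V: "coordinatized V S" and U: "coordinatized U S"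
  shows "\<exists>f\<in>module_hom complex_field V U. bij_betw f (carrier V) (carrier U)"
proof -
  obtain F where F: "F \<in> module_hom complex_field V (regular complex_field)"
    "inj_on F (carrier V)" "F ` carrier V = S" using V unfolding coordinatized_def by blast
  obtain G where G: "G \<in> module_hom complex_field U (regular complex_field)"
    "inj_on G (carrier U)" "G ` carrier U = S" using U unfolding coordinatized_def by blast
  have Ua: "x \<oplus>\<^bsub>U\<^esub> y \<in> carrier U" if "x \<in> carrier U" "y \<in> carrier U" for x y
    using U that unfolding coordinatized_def by blast
  have Us: "c \<odot>\<^bsub>U\<^esub> x \<in> carrier U" if "x \<in> carrier U" for c x
    using U that unfolding coordinatized_def by blast
  have Va: "x \<oplus>\<^bsub>V\<^esub> y \<in> carrier V" if "x \<in> carrier V" "y \<in> carrier V" for x y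
    using V that unfolding coordinatized_def by blast
  have Vs: "c \<odot>\<^bsub>V\<^esub> x \<in> carrier V" if "x \<in> carrier V" for c x
    using V that unfolding coordinatized_def by blast
  define f where "f = (\<lambda>x. inv_into (carrier U) G (F x))"
  have f: "f x \<in> carrier U" "G (f x) = F x" if "x \<in> carrier V" for x
    unfolding f_def using that F(3) G(3) by (auto intro: inv_into_into f_inv_into_f)
  have fI: "f x = u" if "x \<in> carrier V" "u \<in> carrier U" "G u = F x" for x u
    by (rule inj_onD[OF G(2)]) (use f[OF that(1)] that in auto)
  have "f \<in> module_hom complex_field V U"
  proof (rule module_homI)
    fix x y assume xy: "x \<in> carrier V" "y \<in> carrier V"
    show "f (x \<oplus>\<^bsub>V\<^esub> y) = f x \<oplus>\<^bsub>U\<^esub> f y"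
      using xy f Ua Va LinearCombinations.module_hom_add[OF F(1)]
        LinearCombinations.module_hom_add[OF G(1)] by (intro fI) auto
  next
    fix c x assume x: "x \<in> carrier V"
    show "f (c \<odot>\<^bsub>V\<^esub> x) = c \<odot>\<^bsub>U\<^esub> f x"
      using x f Us Vs LinearCombinations.module_hom_smult[OF F(1)]
        LinearCombinations.module_hom_smult[OF G(1)] by (intro fI) auto
  qed (use f in auto)
  moreover have "bij_betw f (carrier V) (carrier U)"
  proof (rule bij_betwI')
    show "(f x = f y) = (x = y)" if "x \<in> carrier V" "y \<in> carrier V" for x y
      using that f F(2) by (metis inj_onD)
    show "\<exists>x\<in>carrier V. u = f x" if "u \<in> carrier U" for u
    proof -
      have "G u \<in> F ` carrier V" using that F(3) G(3) by blast
      then obtain x where "x \<in> carrier V" "G u = F x" by blast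
      then show ?thesis using fI[of x u] that by auto
    qed
  qed (use f in auto)
  ultimately show ?thesis by blast
qed

lemma coordinatized_zero:
  assumes "coordinatized V {0}"
  shows "carrier V = {\<zero>\<^bsub>V\<^esub>}"
proof -
  obtain F where F: "inj_on F (carrier V)" "F ` carrier V = {0 :: complex}"
    using assms unfolding coordinatized_def by blast
  have "F x = 0" if "x \<in> carrier V" for x using F(2) that by blast
  then have "x = y" if "x \<in> carrier V" "y \<in> carrier V" for x y
    using that by (intro inj_onD[OF F(1)]) simp_all
  moreover have "\<zero>\<^bsub>V\<^esub> \<in> carrier V" using assms unfolding coordinatized_def by simp
  ultimately show ?thesis by blast
qed

text \<open>The cosets of the kernel are the fibres of \<open>\<phi>\<close>, so
  \<open>\<phi>\<close> itself is a coordinate on the quotient and coset operations become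
  arithmetic of complex values.\<close>

lemma quotient_coordinatized:
  assumes V: "left_module complex_field V"
    and add: "\<And>x y. x \<in> carrier V \<Longrightarrow> y \<in> carrier V \<Longrightarrow> \<phi> (x \<oplus>\<^bsub>V\<^esub> y) = \<phi> x + \<phi> y"
    and sm: "\<And>c x. x \<in> carrier V \<Longrightarrow> \<phi> (c \<odot>\<^bsub>V\<^esub> x) = c * \<phi> x"
    and I: "I = {x \<in> carrier V. \<phi> x = 0}"
  shows "coordinatized (quotient V I) (\<phi> ` carrier V)"
proof -
  interpret left_mod complex_field V by unfold_locales fact
  define fib where "fib a = {x \<in> carrier V. \<phi> x = a}" for a
  have \<phi>0: "\<phi> \<zero>\<^bsub>V\<^esub> = 0" using add[of "\<zero>\<^bsub>V\<^esub>" "\<zero>\<^bsub>V\<^esub>"] by simp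
  have \<phi>neg: "\<phi> (\<ominus>\<^bsub>V\<^esub> x) = - \<phi> x" if "x \<in> carrier V" for x
    using add[of "\<ominus>\<^bsub>V\<^esub> x" x] that \<phi>0 by (simp add: M.l_neg eq_neg_iff_add_eq_0)
  have coset: "I +>\<^bsub>V\<^esub> x = fib (\<phi> x)" if x: "x \<in> carrier V" for x
  proof -
    have "y \<in> I +>\<^bsub>V\<^esub> x" if y: "y \<in> carrier V" "\<phi> y = \<phi> x" for y
    proof -
      have "y \<ominus>\<^bsub>V\<^esub> x \<in> I" using x y by (simp add: I a_minus_def add \<phi>neg)
      moreover have "y = (y \<ominus>\<^bsub>V\<^esub> x) \<oplus>\<^bsub>V\<^esub> x"
        using x y by (simp add: a_minus_def M.a_assoc M.l_neg)
      ultimately show ?thesis unfolding a_r_coset_def' by blast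
    qed
    then show ?thesis using x by (auto simp: fib_def a_r_coset_def' I add)
  qed
  have carr: "carrier (quotient V I) = (\<lambda>x. fib (\<phi> x)) ` carrier V"
    using coset by (auto simp: quotient_def FactRing_def A_RCOSETS_def')
  have z: "\<zero>\<^bsub>quotient V I\<^esub> = fib 0" by (simp add: quotient_def FactRing_def fib_def I)
  have qadd: "fib (\<phi> x) \<oplus>\<^bsub>quotient V I\<^esub> fib (\<phi> y) = fib (\<phi> (x \<oplus>\<^bsub>V\<^esub> y))"
    if xy: "x \<in> carrier V" "y \<in> carrier V" for x y
  proof -
    have "w \<in> set_add V (fib (\<phi> x)) (fib (\<phi> y))" if w: "w \<in> fib (\<phi> (x \<oplus>\<^bsub>V\<^esub> y))" for w
    proof -
      have "w \<ominus>\<^bsub>V\<^esub> y \<in> fib (\<phi> x)" using w xy by (simp add: fib_def a_minus_def add \<phi>neg)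
      moreover have "y \<in> fib (\<phi> y)" using xy by (simp add: fib_def)
      moreover have "w = (w \<ominus>\<^bsub>V\<^esub> y) \<oplus>\<^bsub>V\<^esub> y"
        using w xy by (simp add: fib_def a_minus_def M.a_assoc M.l_neg)
      ultimately show ?thesis unfolding set_add_def' by blast
    qed
    then show ?thesis using xy
      by (auto simp: quotient_def FactRing_def set_add_def' fib_def add)
  qed
  have qsm: "c \<odot>\<^bsub>quotient V I\<^esub> fib (\<phi> x) = fib (\<phi> (c \<odot>\<^bsub>V\<^esub> x))" if x: "x \<in> carrier V" for c x
  proof -
    have "c \<odot>\<^bsub>quotient V I\<^esub> fib (\<phi> x) = (\<Union>y\<in>fib (\<phi> x). I +>\<^bsub>V\<^esub> (c \<odot>\<^bsub>V\<^esub> y))"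
      by (simp add: quotient_def)
    also have "\<dots> = (\<Union>y\<in>fib (\<phi> x). fib (\<phi> (c \<odot>\<^bsub>V\<^esub> x)))"
      using x by (intro SUP_cong refl) (auto simp: fib_def[of "\<phi> x"] coset sm)
    also have "\<dots> = fib (\<phi> (c \<odot>\<^bsub>V\<^esub> x))" using x by (auto simp: fib_def)
    finally show ?thesis .
  qed
  \<comment> \<open>All members of a coset have the same value under \<open>\<phi>\<close>, so the
    choice of a representative is immaterial.\<close>
  define F where "F S = \<phi> (SOME x. x \<in> S)" for S
  have F: "F (fib (\<phi> x)) = \<phi> x" if "x \<in> carrier V" for x
  proof -
    have "(SOME y. y \<in> fib (\<phi> x)) \<in> fib (\<phi> x)"
      using that by (intro someI[of "\<lambda>y. y \<in> fib (\<phi> x)" x]) (simp add: fib_def)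
    then show ?thesis by (simp add: F_def fib_def)
  qed
  have "F \<in> module_hom complex_field (quotient V I) (regular complex_field)"
    by (rule module_homI) (auto simp: carr qadd qsm F, auto simp: add sm)
  moreover have "inj_on F (carrier (quotient V I))"
    by (auto simp: carr inj_on_def F)
  moreover have "F ` carrier (quotient V I) = \<phi> ` carrier V"
    unfolding carr image_image using F by (intro image_cong) auto
  moreover have "fib 0 \<in> carrier (quotient V I)"
    unfolding carr using \<phi>0 by (intro image_eqI[of _ _ "\<zero>\<^bsub>V\<^esub>"]) auto
  ultimately show ?thesis
    unfolding coordinatized_def z
    by (auto simp: qadd qsm) (auto simp: carr qadd qsm)
qed

lemma restrict_scalars_simps [simp]:
  "carrier (restrict_scalars R N) = carrier N" "zero (restrict_scalars R N) = zero N"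
  "add (restrict_scalars R N) = add N"
  "smult (restrict_scalars R N) = (\<lambda>c x. (c \<odot>\<^bsub>R\<^esub> \<one>\<^bsub>R\<^esub>) \<odot>\<^bsub>N\<^esub> x)"
  by (simp_all add: restrict_scalars_def)

lemma pointwise_simps [simp]:
  "carrier (pointwise D H N) = H" "zero (pointwise D H N) = (\<lambda>x\<in>D. \<zero>\<^bsub>N\<^esub>)"
  "add (pointwise D H N) f g = (\<lambda>x\<in>D. f x \<oplus>\<^bsub>N\<^esub> g x)"
  "smult (pointwise D H N) r f = (\<lambda>x\<in>D. r \<odot>\<^bsub>N\<^esub> f x)"
  by (simp_all add: pointwise_def)

text \<open>Such a functional embeds the degree \<open>d\<close> part of the \<open>n\<close>-th
  cohomology into the complex numbers. Its values outside the cocycles are left open, so it can be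
  given by a formula on arbitrary functions.\<close>

definition cohomology_functional where
  "cohomology_functional R P D N n d \<psi> \<longleftrightarrow>
     (\<forall>f\<in>cocycles R P D N n d. \<forall>g\<in>cocycles R P D N n d.
        \<psi> (\<lambda>x\<in>carrier (P n). f x \<oplus>\<^bsub>N\<^esub> g x) = \<psi> f + \<psi> g) \<and>
     (\<forall>c. \<forall>f\<in>cocycles R P D N n d.
        \<psi> (\<lambda>x\<in>carrier (P n). (c \<odot>\<^bsub>R\<^esub> \<one>\<^bsub>R\<^esub>) \<odot>\<^bsub>N\<^esub> f x) = c * \<psi> f) \<and>
     coboundaries R P D N n d = {f \<in> cocycles R P D N n d. \<psi> f = (0 :: complex)}"


section \<open>Complex vector spaces of graded homomorphisms\<close>

context graded_alg
begin

lemma hom_zero: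
  assumes "graded_mod R M" "graded_mod R N"
  shows "(\<lambda>x\<in>carrier M. \<zero>\<^bsub>N\<^esub>) \<in> graded_homs R M N d"
proof -
  interpret M: graded_mod R M by fact
  interpret N: graded_mod R N by fact
  show ?thesis by (intro graded_homs_restrictI assms) (auto simp: N.part_zero)
qed

lemma hom_add:
  assumes "graded_mod R M" "graded_mod R N" "f \<in> graded_homs R M N d" "g \<in> graded_homs R M N d"
  shows "(\<lambda>x\<in>carrier M. f x \<oplus>\<^bsub>N\<^esub> g x) \<in> graded_homs R M N d"
proof -
  interpret M: graded_mod R M by fact
  interpret N: graded_mod R N by fact
  note c = graded_homs_closed[OF assms(3)] graded_homs_closed[OF assms(4)]
  show ?thesis
    by (intro graded_homs_restrictI assms(1))
      (auto simp: c graded_homs_add[OF assms(3)] graded_homs_add[OF assms(4)] N.M.a_ac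
        graded_homs_smult[OF assms(3)] graded_homs_smult[OF assms(4)] N.smult_r_distr
        intro: N.part_add graded_homs_part[OF assms(3)] graded_homs_part[OF assms(4)])
qed

lemma hom_scalar:
  assumes "graded_mod R M" "graded_mod R N" "f \<in> graded_homs R M N d"
  shows "(\<lambda>x\<in>carrier M. (c \<odot>\<^bsub>R\<^esub> \<one>\<^bsub>R\<^esub>) \<odot>\<^bsub>N\<^esub> f x) \<in> graded_homs R M N d"
proof -
  interpret M: graded_mod R M by fact
  interpret N: graded_mod R N by fact
  let ?c = "c \<odot>\<^bsub>R\<^esub> \<one>\<^bsub>R\<^esub>"
  note [simp] = graded_homs_closed[OF assms(3)]
  show ?thesis
  proof (intro graded_homs_restrictI assms(1))
  show "?c \<odot>\<^bsub>N\<^esub> f x \<in> part N (j + d)" if "x \<in> part M j" for x j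
    using N.part_smult[OF scalar_part graded_homs_part[OF assms(3) that]] by simp
  show "?c \<odot>\<^bsub>N\<^esub> f (r \<odot>\<^bsub>M\<^esub> x) = r \<odot>\<^bsub>N\<^esub> (?c \<odot>\<^bsub>N\<^esub> f x)" if "r \<in> carrier R" "x \<in> carrier M" for r x
  proof -
    have "?c \<odot>\<^bsub>N\<^esub> f (r \<odot>\<^bsub>M\<^esub> x) = (?c \<otimes>\<^bsub>R\<^esub> r) \<odot>\<^bsub>N\<^esub> f x"
      using that by (simp add: graded_homs_smult[OF assms(3)] N.smult_assoc)
    also have "\<dots> = r \<odot>\<^bsub>N\<^esub> (?c \<odot>\<^bsub>N\<^esub> f x)"
      using that by (simp add: scalar_central N.smult_assoc)
    finally show ?thesis .
  qed
  qed (auto simp: graded_homs_add[OF assms(3)] N.smult_r_distr)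
qed

text \<open>This turns negation of homomorphisms into scalar multiplication, from which differences
  and additive inverses in spaces of homomorphisms are obtained.\<close>

lemma minus_one_smult:
  assumes "graded_mod R N" "x \<in> carrier N"
  shows "(- 1 \<odot>\<^bsub>R\<^esub> \<one>\<^bsub>R\<^esub>) \<odot>\<^bsub>N\<^esub> x = \<ominus>\<^bsub>N\<^esub> x"
proof -
  interpret N: graded_mod R N by fact
  have "0 \<odot>\<^bsub>R\<^esub> \<one>\<^bsub>R\<^esub> = \<zero>\<^bsub>R\<^esub>"
    using scalar_add[of 0 0] by (metis Reg.R.add.l_cancel_one' add_0 scalar_carrier)
  then have "(- 1 \<odot>\<^bsub>R\<^esub> \<one>\<^bsub>R\<^esub>) \<oplus>\<^bsub>R\<^esub> \<one>\<^bsub>R\<^esub> = \<zero>\<^bsub>R\<^esub>"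
    using scalar_add[of "-1" 1] scalar_one by simp
  then have "(- 1 \<odot>\<^bsub>R\<^esub> \<one>\<^bsub>R\<^esub>) \<odot>\<^bsub>N\<^esub> x \<oplus>\<^bsub>N\<^esub> x = \<zero>\<^bsub>N\<^esub>"
    using N.smult_l_distr[of "- 1 \<odot>\<^bsub>R\<^esub> \<one>\<^bsub>R\<^esub>" "\<one>\<^bsub>R\<^esub>" x] assms(2) by simp
  then show ?thesis using assms(2) by (intro N.M.minus_equality[symmetric]) auto
qed

lemma hom_minus:
  assumes "graded_mod R M" "graded_mod R N" "f \<in> graded_homs R M N d" "g \<in> graded_homs R M N d"
  shows "(\<lambda>x\<in>carrier M. f x \<ominus>\<^bsub>N\<^esub> g x) \<in> graded_homs R M N d"
proof -
  have "(\<lambda>x\<in>carrier M. f x \<ominus>\<^bsub>N\<^esub> g x) = (\<lambda>x\<in>carrier M. f x \<oplus>\<^bsub>N\<^esub>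
      (\<lambda>x\<in>carrier M. (- 1 \<odot>\<^bsub>R\<^esub> \<one>\<^bsub>R\<^esub>) \<odot>\<^bsub>N\<^esub> g x) x)"
    by (auto simp: a_minus_def minus_one_smult[OF assms(2)] graded_homs_closed[OF assms(4)])
  then show ?thesis using hom_add[OF assms(1-3) hom_scalar[OF assms(1,2,4), of "-1"]] by simp
qed

text \<open>Stated for any subspace \<open>H\<close> so that it applies to the cocycles.\<close>

lemma left_module_homs:
  assumes M: "graded_mod R M" and N: "graded_mod R N" and H: "H \<subseteq> graded_homs R M N d"
    and zero: "(\<lambda>x\<in>carrier M. \<zero>\<^bsub>N\<^esub>) \<in> H"
    and add: "\<And>f g. f \<in> H \<Longrightarrow> g \<in> H \<Longrightarrow> (\<lambda>x\<in>carrier M. f x \<oplus>\<^bsub>N\<^esub> g x) \<in> H"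
    and scalar: "\<And>c f. f \<in> H \<Longrightarrow> (\<lambda>x\<in>carrier M. (c \<odot>\<^bsub>R\<^esub> \<one>\<^bsub>R\<^esub>) \<odot>\<^bsub>N\<^esub> f x) \<in> H"
  shows "left_module complex_field (pointwise (carrier M) H (restrict_scalars R N))"
proof -
  interpret M: graded_mod R M by fact
  interpret N: graded_mod R N by fact
  have cl: "f x \<in> carrier N" if "f \<in> H" "x \<in> carrier M" for f x
    by (rule graded_homs_closed[OF subsetD[OF H that(1)] that(2)])
  have ext: "(\<lambda>x\<in>carrier M. f x) = f" if "f \<in> H" for f
    by (rule extensional_restrict[OF graded_homs_extensional[OF subsetD[OF H that]]])
  let ?V = "pointwise (carrier M) H (restrict_scalars R N)"
  have eqI: "f = (\<lambda>x\<in>carrier M. g x)" if "f \<in> H" "\<And>x. x \<in> carrier M \<Longrightarrow> f x = g x" for f g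
    using ext[OF that(1)] restrict_ext[of "carrier M" f g] that(2) by simp
  show ?thesis
  proof (rule left_moduleI[OF ring_complex_field])
    show "abelian_group ?V"
    proof (rule abelian_groupI)
      fix f g h assume "f \<in> carrier ?V" "g \<in> carrier ?V" "h \<in> carrier ?V"
      then have f: "f \<in> H" and g: "g \<in> H" and h: "h \<in> H" by simp_all
      show "f \<oplus>\<^bsub>?V\<^esub> g \<in> carrier ?V" using add[OF f g] by simp
      show "f \<oplus>\<^bsub>?V\<^esub> g \<oplus>\<^bsub>?V\<^esub> h = f \<oplus>\<^bsub>?V\<^esub> (g \<oplus>\<^bsub>?V\<^esub> h)"
        using cl[OF f] cl[OF g] cl[OF h] by (auto simp: N.M.a_assoc intro!: restrict_ext)
      show "f \<oplus>\<^bsub>?V\<^esub> g = g \<oplus>\<^bsub>?V\<^esub> f"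
        using cl[OF f] cl[OF g] by (auto simp: N.M.a_comm intro!: restrict_ext)
      show "\<zero>\<^bsub>?V\<^esub> \<oplus>\<^bsub>?V\<^esub> f = f"
        using cl[OF f] by (auto intro!: eqI[OF f, symmetric])
      have "(\<lambda>x\<in>carrier M. (- 1 \<odot>\<^bsub>R\<^esub> \<one>\<^bsub>R\<^esub>) \<odot>\<^bsub>N\<^esub> f x) \<oplus>\<^bsub>?V\<^esub> f = \<zero>\<^bsub>?V\<^esub>"
        using cl[OF f] by (auto simp: minus_one_smult[OF N] N.M.l_neg intro!: restrict_ext)
      then show "\<exists>g\<in>carrier ?V. g \<oplus>\<^bsub>?V\<^esub> f = \<zero>\<^bsub>?V\<^esub>"
        using scalar[OF f, of "-1"] by (metis pointwise_simps(1))
    qed (simp add: zero)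
  next
    fix c k f g assume "f \<in> carrier ?V" "g \<in> carrier ?V"
    then have f: "f \<in> H" and g: "g \<in> H" by simp_all
    show "c \<odot>\<^bsub>?V\<^esub> f \<in> carrier ?V" using scalar[OF f] by simp
    show "(c \<oplus>\<^bsub>complex_field\<^esub> k) \<odot>\<^bsub>?V\<^esub> f = c \<odot>\<^bsub>?V\<^esub> f \<oplus>\<^bsub>?V\<^esub> k \<odot>\<^bsub>?V\<^esub> f"
      using cl[OF f] by (auto simp: scalar_add N.smult_l_distr intro!: restrict_ext)
    show "c \<odot>\<^bsub>?V\<^esub> (f \<oplus>\<^bsub>?V\<^esub> g) = c \<odot>\<^bsub>?V\<^esub> f \<oplus>\<^bsub>?V\<^esub> c \<odot>\<^bsub>?V\<^esub> g"
      using cl[OF f] cl[OF g] by (auto simp: N.smult_r_distr intro!: restrict_ext)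
    show "(c \<otimes>\<^bsub>complex_field\<^esub> k) \<odot>\<^bsub>?V\<^esub> f = c \<odot>\<^bsub>?V\<^esub> (k \<odot>\<^bsub>?V\<^esub> f)"
      using cl[OF f] by (auto simp: scalar_mult N.smult_assoc intro!: restrict_ext)
    show "\<one>\<^bsub>complex_field\<^esub> \<odot>\<^bsub>?V\<^esub> f = f"
      using cl[OF f] by (auto simp: scalar_one intro!: eqI[OF f, symmetric])
  qed
qed

end

section \<open>Graded projective resolutions\<close>

locale graded_resolution = graded_alg R for R :: "(complex, 'r) graded_module" +
  fixes M :: "('r, 'm) graded_module" and P :: "nat \<Rightarrow> ('r, 'p) graded_module"
    and D :: "nat \<Rightarrow> 'p \<Rightarrow> 'p" and e :: "'p \<Rightarrow> 'm"
  assumes M: "graded_mod R M"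
    and resolution: "graded_projective_resolution R M P D e"
begin

lemma P: "graded_mod R (P n)"
  using resolution by (intro graded_mod.intro) (simp add: graded_projective_resolution_def)

lemma projective: "fg_projective R (P n)"
  using resolution by (simp add: graded_projective_resolution_def)

lemma D: "D n \<in> graded_homs R (P (Suc n)) (P n) 0"
  using resolution by (simp add: graded_projective_resolution_def)

lemma e: "e \<in> graded_homs R (P 0) M 0"
  using resolution by (simp add: graded_projective_resolution_def)

lemma e_surj: "e ` carrier (P 0) = carrier M"
  using resolution by (simp add: graded_projective_resolution_def)

lemma D_closed [simp]: "x \<in> carrier (P (Suc n)) \<Longrightarrow> D n x \<in> carrier (P n)"
  by (rule graded_homs_closed[OF D])

lemma e_kernel: "x \<in> carrier (P 0) \<Longrightarrow> e x = \<zero>\<^bsub>M\<^esub> \<longleftrightarrow> x \<in> D 0 ` carrier (P 1)"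
  using resolution by (auto simp: graded_projective_resolution_def)

lemma D_kernel: "x \<in> carrier (P (Suc n)) \<Longrightarrow>
    D n x = \<zero>\<^bsub>P n\<^esub> \<longleftrightarrow> x \<in> D (Suc n) ` carrier (P (Suc (Suc n)))"
  using resolution unfolding graded_projective_resolution_def by blast

lemma e_D [simp]: "x \<in> carrier (P (Suc 0)) \<Longrightarrow> e (D 0 x) = \<zero>\<^bsub>M\<^esub>"
  by (subst e_kernel) auto

lemma D_D [simp]: "x \<in> carrier (P (Suc (Suc n))) \<Longrightarrow> D n (D (Suc n) x) = \<zero>\<^bsub>P n\<^esub>"
  by (subst D_kernel) auto

end


section \<open>Comparison of projective resolutions\<close>

text \<open>The map is lifted degree by degree over the identity of \<open>M\<close>. The invariant
  \<open>?good\<close> also records that \<open>b (D n x)\<close> is a boundary in the target, since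
  this is the inclusion of images that the next lift requires.\<close>

lemma comparison_map:
  assumes "graded_resolution R M P D e" "graded_resolution R M Q D' e'"
  obtains \<beta> where "\<And>n. \<beta> n \<in> graded_homs R (P n) (Q n) 0"
    "\<And>x. x \<in> carrier (P 0) \<Longrightarrow> e' (\<beta> 0 x) = e x"
    "\<And>n x. x \<in> carrier (P (Suc n)) \<Longrightarrow> D' n (\<beta> (Suc n) x) = \<beta> n (D n x)"
proof -
  interpret P: graded_resolution R M P D e by fact
  interpret Q: graded_resolution R M Q D' e' by fact
  let ?good = "\<lambda>n b. b \<in> graded_homs R (P n) (Q n) 0 \<and>
    (n = 0 \<longrightarrow> (\<forall>x\<in>carrier (P 0). e' (b x) = e x)) \<and>
    (\<forall>x\<in>carrier (P (Suc n)). b (D n x) \<in> D' n ` carrier (Q (Suc n)))"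
  let ?step = "\<lambda>n b c. \<forall>x\<in>carrier (P (Suc n)). D' n (c x) = b (D n x)"
  have "\<exists>\<beta>. \<forall>n. ?good n (\<beta> n) \<and> ?step n (\<beta> n) (\<beta> (Suc n))"
  proof (rule dependent_nat_choice)
    have "e ` carrier (P 0) \<subseteq> e' ` carrier (Q 0)" by (simp add: P.e_surj Q.e_surj)
    then obtain b where b: "b \<in> graded_homs R (P 0) (Q 0) 0"
      "\<And>x. x \<in> carrier (P 0) \<Longrightarrow> e' (b x) = e x"
      using P.graded_lift[OF P.P P.projective Q.P P.M Q.e P.e] by blast
    have "b (D 0 x) \<in> D' 0 ` carrier (Q (Suc 0))" if x: "x \<in> carrier (P (Suc 0))" for x
    proof -
      have "e' (b (D 0 x)) = \<zero>\<^bsub>M\<^esub>" using b(2) x by simp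
      then show ?thesis
        using Q.e_kernel[OF graded_homs_closed[OF b(1) P.D_closed[OF x]]] by simp
    qed
    then show "\<exists>b. ?good 0 b" using b by blast
  next
    fix b n assume good: "?good n b"
    then have b: "b \<in> graded_homs R (P n) (Q n) 0"
      "\<And>x. x \<in> carrier (P (Suc n)) \<Longrightarrow> b (D n x) \<in> D' n ` carrier (Q (Suc n))" by blast+
    let ?f = "compose (carrier (P (Suc n))) b (D n)"
    have f: "?f \<in> graded_homs R (P (Suc n)) (Q n) 0"
      using graded_homs_compose[OF P.P P.D b(1)] by simp
    have "?f ` carrier (P (Suc n)) \<subseteq> D' n ` carrier (Q (Suc n))"
      using b(2) by (auto simp: compose_eq)
    then obtain c where c: "c \<in> graded_homs R (P (Suc n)) (Q (Suc n)) 0"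
      "\<And>x. x \<in> carrier (P (Suc n)) \<Longrightarrow> D' n (c x) = ?f x"
      using P.graded_lift[OF P.P P.projective Q.P Q.P Q.D f] by blast
    \<comment> \<open>\<open>D' n\<close> sends this element to \<open>b\<close> of
      \<open>D n (D (Suc n) x)\<close>, which is zero; exactness makes it a boundary.\<close>
    have "c (D (Suc n) x) \<in> D' (Suc n) ` carrier (Q (Suc (Suc n)))"
      if x: "x \<in> carrier (P (Suc (Suc n)))" for x
    proof -
      interpret Pn: graded_mod R "P n" by (rule P.P)
      interpret Qn: graded_mod R "Q n" by (rule Q.P)
      have "D' n (c (D (Suc n) x)) = b \<zero>\<^bsub>P n\<^esub>" using c(2) x by (simp add: compose_eq)
      also have "\<dots> = \<zero>\<^bsub>Q n\<^esub>"
        by (rule module_hom_zero[OF Pn.M.abelian_group_axioms Qn.M.abelian_group_axioms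
              graded_homs_module_hom[OF b(1)]])
      finally show ?thesis
        using Q.D_kernel[OF graded_homs_closed[OF c(1) P.D_closed[OF x]]] by simp
    qed
    then show "\<exists>c. ?good (Suc n) c \<and> ?step n b c" using c by (auto simp: compose_eq)
  qed
  then obtain \<beta> where "\<forall>n. ?good n (\<beta> n) \<and> ?step n (\<beta> n) (\<beta> (Suc n))" by (elim exE)
  then show thesis by (intro that[of \<beta>]) blast+
qed

context graded_resolution
begin

text \<open>A chain homotopy from \<open>\<gamma>\<close> to the identity, kept in existential form
  at each \<open>n\<close>: \<open>t\<close> is the summand contributed by the previous homotopy map
  (zero for \<open>n = 0\<close>), and the rest of \<open>\<gamma> n x - x\<close> lies in the image
  of \<open>D n\<close>, along which the next homotopy map is lifted.\<close>

lemma homotopic_to_identity: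
  assumes \<gamma>: "\<And>n. \<gamma> n \<in> graded_homs R (P n) (P n) 0"
    and \<gamma>e: "\<And>x. x \<in> carrier (P 0) \<Longrightarrow> e (\<gamma> 0 x) = e x"
    and \<gamma>D: "\<And>n x. x \<in> carrier (P (Suc n)) \<Longrightarrow> D n (\<gamma> (Suc n) x) = \<gamma> n (D n x)"
  shows "\<exists>t\<in>graded_homs R (P n) (P n) 0.
    (case n of 0 \<Rightarrow> \<forall>x\<in>carrier (P 0). t x = \<zero>\<^bsub>P 0\<^esub>
     | Suc m \<Rightarrow> \<exists>h\<in>graded_homs R (P m) (P n) 0. \<forall>x\<in>carrier (P n). t x = h (D m x)) \<and>
    (\<forall>x\<in>carrier (P n). (\<gamma> n x \<ominus>\<^bsub>P n\<^esub> x) \<ominus>\<^bsub>P n\<^esub> t x \<in> D n ` carrier (P (Suc n)))"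
proof (induction n)
  case 0
  interpret P0: graded_mod R "P 0" by (rule P)
  interpret M: graded_mod R M by (rule M)
  have "(\<gamma> 0 x \<ominus>\<^bsub>P 0\<^esub> x) \<ominus>\<^bsub>P 0\<^esub> \<zero>\<^bsub>P 0\<^esub> \<in> D 0 ` carrier (P (Suc 0))" if x: "x \<in> carrier (P 0)" for x
  proof -
    note c = x graded_homs_closed[OF \<gamma> x] graded_homs_closed[OF e x]
    have "e (\<gamma> 0 x \<ominus>\<^bsub>P 0\<^esub> x) = \<zero>\<^bsub>M\<^esub>"
      using c \<gamma>e[OF x] module_hom_minus[OF P0.M.abelian_group_axioms M.M.abelian_group_axioms
          graded_homs_module_hom[OF e], of "\<gamma> 0 x" x]
      by (simp add: a_minus_def M.M.r_neg)
    then have "\<gamma> 0 x \<ominus>\<^bsub>P 0\<^esub> x \<in> D 0 ` carrier (P (Suc 0))"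
      using e_kernel[of "\<gamma> 0 x \<ominus>\<^bsub>P 0\<^esub> x"] c by simp
    moreover have "(\<gamma> 0 x \<ominus>\<^bsub>P 0\<^esub> x) \<ominus>\<^bsub>P 0\<^esub> \<zero>\<^bsub>P 0\<^esub> = \<gamma> 0 x \<ominus>\<^bsub>P 0\<^esub> x"
    proof -
      have "\<ominus>\<^bsub>P 0\<^esub> \<zero>\<^bsub>P 0\<^esub> = \<zero>\<^bsub>P 0\<^esub>" by (rule P0.M.minus_equality) auto
      then show ?thesis using c by (simp add: a_minus_def[of _ _ "\<zero>\<^bsub>P 0\<^esub>"])
    qed
    ultimately show ?thesis by simp
  qed
  then show ?case
    by (intro bexI[of _ "\<lambda>x\<in>carrier (P 0). \<zero>\<^bsub>P 0\<^esub>"] hom_zero P) auto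
next
  case (Suc n)
  interpret Pn: graded_mod R "P n" by (rule P)
  interpret PS: graded_mod R "P (Suc n)" by (rule P)
  obtain t where t: "t \<in> graded_homs R (P n) (P n) 0"
    and tn: "case n of 0 \<Rightarrow> \<forall>x\<in>carrier (P 0). t x = \<zero>\<^bsub>P 0\<^esub>
     | Suc m \<Rightarrow> \<exists>h\<in>graded_homs R (P m) (P n) 0. \<forall>x\<in>carrier (P n). t x = h (D m x)"
    and tD: "\<And>x. x \<in> carrier (P n) \<Longrightarrow>
      (\<gamma> n x \<ominus>\<^bsub>P n\<^esub> x) \<ominus>\<^bsub>P n\<^esub> t x \<in> D n ` carrier (P (Suc n))"
    using Suc.IH by blast
  have id: "(\<lambda>x\<in>carrier (P n). x) \<in> graded_homs R (P n) (P n) 0"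
    by (intro graded_homs_restrictI P) auto
  define u where "u = (\<lambda>x\<in>carrier (P n). (\<gamma> n x \<ominus>\<^bsub>P n\<^esub> x) \<ominus>\<^bsub>P n\<^esub> t x)"
  have "u = (\<lambda>x\<in>carrier (P n). (\<lambda>x\<in>carrier (P n). \<gamma> n x \<ominus>\<^bsub>P n\<^esub> (\<lambda>x\<in>carrier (P n). x) x) x
      \<ominus>\<^bsub>P n\<^esub> t x)"
    by (auto simp: u_def intro!: restrict_ext)
  then have u: "u \<in> graded_homs R (P n) (P n) 0"
    using hom_minus[OF P P hom_minus[OF P P \<gamma> id] t] by simp
  have "u ` carrier (P n) \<subseteq> D n ` carrier (P (Suc n))" using tD by (auto simp: u_def)
  then obtain h where h: "h \<in> graded_homs R (P n) (P (Suc n)) 0"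
    and Dh: "\<And>x. x \<in> carrier (P n) \<Longrightarrow> D n (h x) = u x"
    using graded_lift[OF P projective P P D u] by blast
  define s where "s = compose (carrier (P (Suc n))) h (D n)"
  have s: "s \<in> graded_homs R (P (Suc n)) (P (Suc n)) 0"
    unfolding s_def using graded_homs_compose[OF P D h] by simp
  \<comment> \<open>The summand \<open>t\<close> factors through the previous differential, so it
    kills boundaries.\<close>
  have tDx: "t (D n x) = \<zero>\<^bsub>P n\<^esub>" if x: "x \<in> carrier (P (Suc n))" for x
  proof (cases n)
    case 0
    then show ?thesis using tn x D_closed[OF x] by simp
  next
    case (Suc m)
    interpret Pm: graded_mod R "P m" by (rule P)
    obtain k where k: "k \<in> graded_homs R (P m) (P n) 0" "\<forall>x\<in>carrier (P n). t x = k (D m x)"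
      using tn Suc by auto
    have "t (D n x) = k (D m (D n x))" using k(2) D_closed[OF x] by blast
    also have "D m (D n x) = \<zero>\<^bsub>P m\<^esub>" using x Suc by simp
    also have "k \<zero>\<^bsub>P m\<^esub> = \<zero>\<^bsub>P n\<^esub>"
      by (rule module_hom_zero[OF Pm.M.abelian_group_axioms Pn.M.abelian_group_axioms
            graded_homs_module_hom[OF k(1)]])
    finally show ?thesis .
  qed
  \<comment> \<open>Since \<open>D n (s x) = u (D n x) = \<gamma> n (D n x) - D n x\<close>, which
    is also the image of \<open>\<gamma> (Suc n) x - x\<close>, the difference is a cycle and hence
    a boundary.\<close>
  have "(\<gamma> (Suc n) x \<ominus>\<^bsub>P (Suc n)\<^esub> x) \<ominus>\<^bsub>P (Suc n)\<^esub> s x \<in> D (Suc n) ` carrier (P (Suc (Suc n)))"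
    if x: "x \<in> carrier (P (Suc n))" for x
  proof -
    note c = x graded_homs_closed[OF \<gamma> x] graded_homs_closed[OF s x]
    note Dm = module_hom_minus[OF PS.M.abelian_group_axioms Pn.M.abelian_group_axioms
        graded_homs_module_hom[OF D]]
    have c2: "D n x \<in> carrier (P n)" "\<gamma> n (D n x) \<in> carrier (P n)"
      using x graded_homs_closed[OF \<gamma>] by auto
    have sx: "D n (s x) = \<gamma> n (D n x) \<ominus>\<^bsub>P n\<^esub> D n x"
      using x c2 Dh tDx by (simp add: s_def compose_eq u_def a_minus_def)
    have "D n ((\<gamma> (Suc n) x \<ominus>\<^bsub>P (Suc n)\<^esub> x) \<ominus>\<^bsub>P (Suc n)\<^esub> s x)
        = (\<gamma> n (D n x) \<ominus>\<^bsub>P n\<^esub> D n x) \<ominus>\<^bsub>P n\<^esub> (\<gamma> n (D n x) \<ominus>\<^bsub>P n\<^esub> D n x)"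
      using c \<gamma>D[OF x] sx by (simp add: Dm)
    also have "\<dots> = \<zero>\<^bsub>P n\<^esub>" using c2 by (simp add: a_minus_def Pn.M.r_neg)
    finally show ?thesis using D_kernel[of "(\<gamma> (Suc n) x \<ominus>\<^bsub>P (Suc n)\<^esub> x) \<ominus>\<^bsub>P (Suc n)\<^esub> s x" n] c
      by simp
  qed
  moreover have "\<exists>h\<in>graded_homs R (P n) (P (Suc n)) 0. \<forall>x\<in>carrier (P (Suc n)). s x = h (D n x)"
    using h by (auto simp: s_def compose_eq)
  ultimately show ?case using s by (intro bexI[of _ s]) auto
qed

lemma cocycle_homs: "f \<in> cocycles R P D N n d \<Longrightarrow> f \<in> graded_homs R (P n) N d"
  by (simp add: cocycles_def)

lemma cocycle_D: "f \<in> cocycles R P D N n d \<Longrightarrow> x \<in> carrier (P (Suc n)) \<Longrightarrow> f (D n x) = \<zero>\<^bsub>N\<^esub>"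
  by (simp add: cocycles_def)

lemma coboundary_cocycle:
  assumes N: "graded_mod R N"
  shows "coboundaries R P D N n d \<subseteq> cocycles R P D N n d"
proof
  fix f assume f: "f \<in> coboundaries R P D N n d"
  interpret N: graded_mod R N by fact
  show "f \<in> cocycles R P D N n d"
  proof (cases n)
    case 0
    then have "f = (\<lambda>x\<in>carrier (P 0). \<zero>\<^bsub>N\<^esub>)"
      using f by (simp add: coboundaries_def hom_space_def)
    then show ?thesis using 0 hom_zero[OF P N] by (simp add: cocycles_def)
  next
    case (Suc m)
    interpret Pm: graded_mod R "P m" by (rule P)
    obtain g where g: "g \<in> graded_homs R (P m) N d" "f = compose (carrier (P n)) g (D m)"
      using f Suc by (auto simp: coboundaries_def)
    have "g \<zero>\<^bsub>P m\<^esub> = \<zero>\<^bsub>N\<^esub>"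
      by (rule module_hom_zero[OF Pm.M.abelian_group_axioms N.M.abelian_group_axioms
            graded_homs_module_hom[OF g(1)]])
    then show ?thesis using graded_homs_compose[OF P D g(1)] g(2) Suc
      by (simp add: cocycles_def compose_eq)
  qed
qed

lemma coboundary_minus:
  assumes N: "graded_mod R N" and f: "f \<in> coboundaries R P D N n d"
    and g: "g \<in> coboundaries R P D N n d"
  shows "(\<lambda>x\<in>carrier (P n). f x \<ominus>\<^bsub>N\<^esub> g x) \<in> coboundaries R P D N n d"
proof (cases n)
  case 0
  interpret N: graded_mod R N by fact
  show ?thesis using f g 0
    by (auto simp: coboundaries_def hom_space_def a_minus_def intro!: restrict_ext)
next
  case (Suc m)
  obtain f' where f': "f' \<in> graded_homs R (P m) N d" "f = compose (carrier (P n)) f' (D m)"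
    using f Suc by (auto simp: coboundaries_def)
  obtain g' where g': "g' \<in> graded_homs R (P m) N d" "g = compose (carrier (P n)) g' (D m)"
    using g Suc by (auto simp: coboundaries_def)
  have "(\<lambda>x\<in>carrier (P n). f x \<ominus>\<^bsub>N\<^esub> g x)
      = compose (carrier (P n)) (\<lambda>x\<in>carrier (P m). f' x \<ominus>\<^bsub>N\<^esub> g' x) (D m)"
    using Suc by (auto simp: f'(2) g'(2) compose_def intro!: restrict_ext)
  then show ?thesis using hom_minus[OF P N f'(1) g'(1)] Suc by (auto simp: coboundaries_def)
qed

text \<open>A cocycle kills the image of \<open>D n\<close>, so on \<open>\<gamma> n x - x\<close>
  it sees only the summand \<open>t x\<close>; and \<open>f\<close> after \<open>t\<close> is a
  coboundary because \<open>t\<close> is zero or factors through the previous differential.\<close>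

lemma cocycle_homotopy:
  assumes N: "graded_mod R N"
    and \<gamma>: "\<And>n. \<gamma> n \<in> graded_homs R (P n) (P n) 0"
    and \<gamma>e: "\<And>x. x \<in> carrier (P 0) \<Longrightarrow> e (\<gamma> 0 x) = e x"
    and \<gamma>D: "\<And>n x. x \<in> carrier (P (Suc n)) \<Longrightarrow> D n (\<gamma> (Suc n) x) = \<gamma> n (D n x)"
    and f: "f \<in> cocycles R P D N n d"
  shows "\<exists>b\<in>coboundaries R P D N n d. \<forall>x\<in>carrier (P n). f (\<gamma> n x) = f x \<oplus>\<^bsub>N\<^esub> b x"
proof -
  interpret N: graded_mod R N by fact
  interpret Pn: graded_mod R "P n" by (rule P)
  obtain t where t: "t \<in> graded_homs R (P n) (P n) 0"
    and tn: "case n of 0 \<Rightarrow> \<forall>x\<in>carrier (P 0). t x = \<zero>\<^bsub>P 0\<^esub>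
     | Suc m \<Rightarrow> \<exists>h\<in>graded_homs R (P m) (P n) 0. \<forall>x\<in>carrier (P n). t x = h (D m x)"
    and tD: "\<And>x. x \<in> carrier (P n) \<Longrightarrow>
      (\<gamma> n x \<ominus>\<^bsub>P n\<^esub> x) \<ominus>\<^bsub>P n\<^esub> t x \<in> D n ` carrier (P (Suc n))"
    using homotopic_to_identity[OF \<gamma> \<gamma>e \<gamma>D, of n] by blast
  note f' = cocycle_homs[OF f]
  note fm = module_hom_minus[OF Pn.M.abelian_group_axioms N.M.abelian_group_axioms
        graded_homs_module_hom[OF f']]
  let ?b = "compose (carrier (P n)) f t"
  have "f (\<gamma> n x) = f x \<oplus>\<^bsub>N\<^esub> f (t x)" if x: "x \<in> carrier (P n)" for x
  proof -
    note c = x graded_homs_closed[OF \<gamma> x] graded_homs_closed[OF t x]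
    note fc = c[THEN graded_homs_closed[OF f']]
    obtain y where "y \<in> carrier (P (Suc n))" "(\<gamma> n x \<ominus>\<^bsub>P n\<^esub> x) \<ominus>\<^bsub>P n\<^esub> t x = D n y"
      using tD[OF x] by blast
    then have "f ((\<gamma> n x \<ominus>\<^bsub>P n\<^esub> x) \<ominus>\<^bsub>P n\<^esub> t x) = \<zero>\<^bsub>N\<^esub>" using cocycle_D[OF f] by simp
    then have "(f (\<gamma> n x) \<ominus>\<^bsub>N\<^esub> f x) \<ominus>\<^bsub>N\<^esub> f (t x) = \<zero>\<^bsub>N\<^esub>" using c by (simp add: fm)
    then have "f (\<gamma> n x) \<ominus>\<^bsub>N\<^esub> f x = f (t x)" using fc by simp
    then have "f (t x) \<oplus>\<^bsub>N\<^esub> f x = f (\<gamma> n x)"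
      using fc by (metis N.M.a_assoc N.M.a_inv_closed N.M.l_neg N.M.r_zero a_minus_def)
    then show ?thesis using fc N.M.a_comm by metis
  qed
  moreover have "?b \<in> coboundaries R P D N n d"
  proof (cases n)
    case 0
    have "f \<zero>\<^bsub>P n\<^esub> = \<zero>\<^bsub>N\<^esub>"
      by (rule module_hom_zero[OF Pn.M.abelian_group_axioms N.M.abelian_group_axioms
            graded_homs_module_hom[OF f']])
    then show ?thesis using 0 tn
      by (auto simp: coboundaries_def hom_space_def compose_def intro!: restrict_ext)
  next
    case (Suc m)
    then obtain h where h: "h \<in> graded_homs R (P m) (P n) 0" "\<forall>x\<in>carrier (P n). t x = h (D m x)"
      using tn by auto
    have "?b = compose (carrier (P n)) (compose (carrier (P m)) f h) (D m)"
      using h(2) Suc by (auto simp: compose_def intro!: restrict_ext)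
    then show ?thesis using graded_homs_compose[OF P h(1) f'] Suc by (auto simp: coboundaries_def)
  qed
  ultimately show ?thesis by (intro bexI[of _ ?b]) (auto simp: compose_eq)
qed

lemma cohomology_coordinatized:
  assumes N: "graded_mod R N" and \<psi>: "cohomology_functional R P D N n d \<psi>"
  shows "coordinatized (cohomology R P D N n d) (\<psi> ` cocycles R P D N n d)"
proof -
  interpret N: graded_mod R N by fact
  let ?Z = "cocycles R P D N n d"
  let ?V = "pointwise (carrier (P n)) ?Z (restrict_scalars R N)"
  have "left_module complex_field ?V"
  proof (rule left_module_homs[OF P N])
    show "?Z \<subseteq> graded_homs R (P n) N d" by (auto simp: cocycles_def)
    show "(\<lambda>x\<in>carrier (P n). \<zero>\<^bsub>N\<^esub>) \<in> ?Z" using hom_zero[OF P N] by (simp add: cocycles_def)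
    show "(\<lambda>x\<in>carrier (P n). f x \<oplus>\<^bsub>N\<^esub> g x) \<in> ?Z" if "f \<in> ?Z" "g \<in> ?Z" for f g
      using hom_add[OF P N] that by (simp add: cocycles_def)
    show "(\<lambda>x\<in>carrier (P n). (c \<odot>\<^bsub>R\<^esub> \<one>\<^bsub>R\<^esub>) \<odot>\<^bsub>N\<^esub> f x) \<in> ?Z" if "f \<in> ?Z" for c f
      using hom_scalar[OF P N] that by (simp add: cocycles_def)
  qed
  then have "coordinatized (quotient ?V (coboundaries R P D N n d)) (\<psi> ` carrier ?V)"
    using \<psi> by (intro quotient_coordinatized) (auto simp: cohomology_functional_def)
  moreover have "(hom_space R (P n) N d)\<lparr>carrier := ?Z\<rparr> = ?V"
    by (simp add: hom_space_def pointwise_def)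
  ultimately show ?thesis by (simp add: cohomology_def)
qed

end

section \<open>Independence of the resolution\<close>

lemma cocycle_compose:
  assumes P: "graded_resolution R M P D e" and Q: "graded_resolution R M Q D' e'"
    and \<beta>: "\<And>n. \<beta> n \<in> graded_homs R (P n) (Q n) 0"
    and \<beta>D: "\<And>n x. x \<in> carrier (P (Suc n)) \<Longrightarrow> D' n (\<beta> (Suc n) x) = \<beta> n (D n x)"
    and f: "f \<in> cocycles R Q D' N n d"
  shows "compose (carrier (P n)) f (\<beta> n) \<in> cocycles R P D N n d"
proof -
  interpret P: graded_resolution R M P D e by fact
  interpret Q: graded_resolution R M Q D' e' by fact
  have "f (\<beta> n (D n x)) = \<zero>\<^bsub>N\<^esub>" if x: "x \<in> carrier (P (Suc n))" for x
    using Q.cocycle_D[OF f graded_homs_closed[OF \<beta> x]] \<beta>D[OF x] by simp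
  then show ?thesis
    using graded_homs_compose[OF P.P \<beta> Q.cocycle_homs[OF f]]
    by (simp add: cocycles_def compose_eq)
qed

lemma coboundary_compose:
  assumes P: "graded_resolution R M P D e" and Q: "graded_resolution R M Q D' e'"
    and \<beta>: "\<And>n. \<beta> n \<in> graded_homs R (P n) (Q n) 0"
    and \<beta>D: "\<And>n x. x \<in> carrier (P (Suc n)) \<Longrightarrow> D' n (\<beta> (Suc n) x) = \<beta> n (D n x)"
    and f: "f \<in> coboundaries R Q D' N n d"
  shows "compose (carrier (P n)) f (\<beta> n) \<in> coboundaries R P D N n d"
proof (cases n)
  case 0
  then show ?thesis using f graded_homs_closed[OF \<beta>]
    by (auto simp: coboundaries_def hom_space_def compose_def intro!: restrict_ext)
next
  case (Suc m)
  interpret P: graded_resolution R M P D e by fact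
  interpret Q: graded_resolution R M Q D' e' by fact
  obtain g where g: "g \<in> graded_homs R (Q m) N d" "f = compose (carrier (Q n)) g (D' m)"
    using f Suc by (auto simp: coboundaries_def)
  have "compose (carrier (P n)) f (\<beta> n) = compose (carrier (P n)) (compose (carrier (P m)) g (\<beta> m)) (D m)"
    using g(2) Suc \<beta>D graded_homs_closed[OF \<beta>] by (auto simp: compose_def intro!: restrict_ext)
  then show ?thesis using graded_homs_compose[OF P.P \<beta> g(1)] Suc by (auto simp: coboundaries_def)
qed

text \<open>\<open>\<psi>'\<close> is the pullback of \<open>\<psi>\<close> along
  \<open>\<beta>\<close>. Either composite of the two comparison maps changes a cocycle by a
  coboundary only. The composite on \<open>P\<close> shows that the kernel of \<open>\<psi>'\<close>
  is right, the composite on \<open>Q\<close> that the same values are taken.\<close>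

theorem cohomology_functional_transfer:
  assumes P: "graded_resolution R M P D e" and Q: "graded_resolution R M Q D' e'"
    and N: "graded_mod R N" and \<psi>: "cohomology_functional R Q D' N n d \<psi>"
  obtains \<psi>' where "cohomology_functional R P D N n d \<psi>'"
    "\<psi>' ` cocycles R P D N n d = \<psi> ` cocycles R Q D' N n d"
proof -
  interpret P: graded_resolution R M P D e by fact
  interpret Q: graded_resolution R M Q D' e' by fact
  interpret N: graded_mod R N by fact
  obtain \<alpha> where \<alpha>: "\<And>n. \<alpha> n \<in> graded_homs R (P n) (Q n) 0"
    "\<And>x. x \<in> carrier (P 0) \<Longrightarrow> e' (\<alpha> 0 x) = e x"
    "\<And>n x. x \<in> carrier (P (Suc n)) \<Longrightarrow> D' n (\<alpha> (Suc n) x) = \<alpha> n (D n x)"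
    using comparison_map[OF P Q] by blast
  obtain \<beta> where \<beta>: "\<And>n. \<beta> n \<in> graded_homs R (Q n) (P n) 0"
    "\<And>x. x \<in> carrier (Q 0) \<Longrightarrow> e (\<beta> 0 x) = e' x"
    "\<And>n x. x \<in> carrier (Q (Suc n)) \<Longrightarrow> D n (\<beta> (Suc n) x) = \<beta> n (D' n x)"
    using comparison_map[OF Q P] by blast
  note \<alpha>c [simp] = graded_homs_closed[OF \<alpha>(1)] and \<beta>c [simp] = graded_homs_closed[OF \<beta>(1)]
  have \<beta>\<alpha>: "\<exists>b\<in>coboundaries R P D N n d. \<forall>x\<in>carrier (P n). f (\<beta> n (\<alpha> n x)) = f x \<oplus>\<^bsub>N\<^esub> b x"
    if f: "f \<in> cocycles R P D N n d" for f
  proof -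
    have "compose (carrier (P n)) (\<beta> n) (\<alpha> n) \<in> graded_homs R (P n) (P n) 0" for n
      using graded_homs_compose[OF P.P \<alpha>(1) \<beta>(1)] by simp
    from P.cocycle_homotopy[OF N this _ _ f] show ?thesis
      by (simp add: compose_eq \<alpha>(2,3) \<beta>(2,3))
  qed
  have \<alpha>\<beta>: "\<exists>b\<in>coboundaries R Q D' N n d. \<forall>x\<in>carrier (Q n). f (\<alpha> n (\<beta> n x)) = f x \<oplus>\<^bsub>N\<^esub> b x"
    if f: "f \<in> cocycles R Q D' N n d" for f
  proof -
    have "compose (carrier (Q n)) (\<alpha> n) (\<beta> n) \<in> graded_homs R (Q n) (Q n) 0" for n
      using graded_homs_compose[OF Q.P \<beta>(1) \<alpha>(1)] by simp
    from Q.cocycle_homotopy[OF N this _ _ f] show ?thesis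
      by (simp add: compose_eq \<alpha>(2,3) \<beta>(2,3))
  qed
  let ?p = "\<lambda>f. compose (carrier (Q n)) f (\<beta> n)"
  have p: "?p f \<in> cocycles R Q D' N n d" if "f \<in> cocycles R P D N n d" for f
    by (rule cocycle_compose[OF Q P \<beta>(1,3) that])
  have \<psi>add: "\<psi> (\<lambda>x\<in>carrier (Q n). f x \<oplus>\<^bsub>N\<^esub> g x) = \<psi> f + \<psi> g"
    if "f \<in> cocycles R Q D' N n d" "g \<in> cocycles R Q D' N n d" for f g
    using \<psi> that by (simp add: cohomology_functional_def)
  have \<psi>sc: "\<psi> (\<lambda>x\<in>carrier (Q n). (c \<odot>\<^bsub>R\<^esub> \<one>\<^bsub>R\<^esub>) \<odot>\<^bsub>N\<^esub> f x) = c * \<psi> f"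
    if "f \<in> cocycles R Q D' N n d" for c f
    using \<psi> that by (simp add: cohomology_functional_def)
  have \<psi>0: "f \<in> coboundaries R Q D' N n d \<longleftrightarrow> f \<in> cocycles R Q D' N n d \<and> \<psi> f = 0" for f
    using \<psi> by (auto simp: cohomology_functional_def)
  have "cohomology_functional R P D N n d (\<lambda>f. \<psi> (?p f))"
    unfolding cohomology_functional_def
  proof (intro conjI ballI allI)
    fix f g assume f: "f \<in> cocycles R P D N n d" and g: "g \<in> cocycles R P D N n d"
    have "?p (\<lambda>x\<in>carrier (P n). f x \<oplus>\<^bsub>N\<^esub> g x) = (\<lambda>x\<in>carrier (Q n). ?p f x \<oplus>\<^bsub>N\<^esub> ?p g x)"
      by (auto simp: compose_def intro!: restrict_ext)
    then show "\<psi> (?p (\<lambda>x\<in>carrier (P n). f x \<oplus>\<^bsub>N\<^esub> g x)) = \<psi> (?p f) + \<psi> (?p g)"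
      using \<psi>add[OF p[OF f] p[OF g]] by simp
  next
    fix c f assume f: "f \<in> cocycles R P D N n d"
    have "?p (\<lambda>x\<in>carrier (P n). (c \<odot>\<^bsub>R\<^esub> \<one>\<^bsub>R\<^esub>) \<odot>\<^bsub>N\<^esub> f x)
        = (\<lambda>x\<in>carrier (Q n). (c \<odot>\<^bsub>R\<^esub> \<one>\<^bsub>R\<^esub>) \<odot>\<^bsub>N\<^esub> ?p f x)"
      by (auto simp: compose_def intro!: restrict_ext)
    then show "\<psi> (?p (\<lambda>x\<in>carrier (P n). (c \<odot>\<^bsub>R\<^esub> \<one>\<^bsub>R\<^esub>) \<odot>\<^bsub>N\<^esub> f x)) = c * \<psi> (?p f)"
      using \<psi>sc[OF p[OF f]] by simp
  next
    show "coboundaries R P D N n d = {f \<in> cocycles R P D N n d. \<psi> (?p f) = 0}"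
    proof (intro equalityI subsetI CollectI conjI)
      fix f assume f: "f \<in> coboundaries R P D N n d"
      then show "f \<in> cocycles R P D N n d" using P.coboundary_cocycle[OF N] by blast
      show "\<psi> (?p f) = 0" using coboundary_compose[OF Q P \<beta>(1,3) f] \<psi>0 by blast
    next
      fix f assume "f \<in> {f \<in> cocycles R P D N n d. \<psi> (?p f) = 0}"
      then have f: "f \<in> cocycles R P D N n d" and "?p f \<in> coboundaries R Q D' N n d"
        using \<psi>0 p by auto
      then have c: "compose (carrier (P n)) (?p f) (\<alpha> n) \<in> coboundaries R P D N n d"
        using coboundary_compose[OF P Q \<alpha>(1,3)] by blast
      obtain b where b: "b \<in> coboundaries R P D N n d"
        "\<And>x. x \<in> carrier (P n) \<Longrightarrow> f (\<beta> n (\<alpha> n x)) = f x \<oplus>\<^bsub>N\<^esub> b x"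
        using \<beta>\<alpha>[OF f] by blast
      have fc: "f x \<in> carrier N" if "x \<in> carrier (P n)" for x
        using graded_homs_closed[OF P.cocycle_homs[OF f] that] .
      have bc: "b x \<in> carrier N" if "x \<in> carrier (P n)" for x
        using b(1) P.coboundary_cocycle[OF N] graded_homs_closed[OF P.cocycle_homs that] by blast
      \<comment> \<open>Carried to \<open>Q\<close> and back, \<open>f\<close> becomes a coboundary
        that differs from \<open>f\<close> by the coboundary \<open>b\<close>.\<close>
      have "f = (\<lambda>x\<in>carrier (P n). f x)"
        using extensional_restrict[OF graded_homs_extensional[OF P.cocycle_homs[OF f]]] by simp
      also have "\<dots> = (\<lambda>x\<in>carrier (P n). compose (carrier (P n)) (?p f) (\<alpha> n) x \<ominus>\<^bsub>N\<^esub> b x)"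
        using fc bc b(2)
        by (auto simp: compose_eq a_minus_def N.M.a_assoc N.M.r_neg intro!: restrict_ext)
      also have "\<dots> \<in> coboundaries R P D N n d" by (rule P.coboundary_minus[OF N c b(1)])
      finally show "f \<in> coboundaries R P D N n d" .
    qed
  qed
  moreover have "(\<lambda>f. \<psi> (?p f)) ` cocycles R P D N n d = \<psi> ` cocycles R Q D' N n d"
  proof (intro equalityI subsetI)
    fix y assume "y \<in> \<psi> ` cocycles R Q D' N n d"
    then obtain g where g: "g \<in> cocycles R Q D' N n d" "y = \<psi> g" by blast
    let ?f = "compose (carrier (P n)) g (\<alpha> n)"
    obtain b where b: "b \<in> coboundaries R Q D' N n d"
      "\<And>x. x \<in> carrier (Q n) \<Longrightarrow> g (\<alpha> n (\<beta> n x)) = g x \<oplus>\<^bsub>N\<^esub> b x"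
      using \<alpha>\<beta>[OF g(1)] by blast
    have "?p ?f = (\<lambda>x\<in>carrier (Q n). g x \<oplus>\<^bsub>N\<^esub> b x)"
      using b(2) by (auto simp: compose_def intro!: restrict_ext)
    then have "\<psi> (?p ?f) = y" using \<psi>add[OF g(1), of b] b(1) \<psi>0 g(2) by simp
    then show "y \<in> (\<lambda>f. \<psi> (?p f)) ` cocycles R P D N n d"
      using cocycle_compose[OF P Q \<alpha>(1,3) g(1)] by blast
  qed (use p in auto)
  ultimately show thesis using that by blast
qed

text \<open>\<open>chosen_resolution\<close> selects by \<open>SOME\<close>, which yields a
  resolution only if one exists on the type \<open>nat \<Rightarrow> 'r\<close>; the given
  \<open>P\<close> is that witness. The functional is then moved to the selected resolution.\<close>

corollary Ext_coordinatized:
  fixes R :: "(complex, 'r) graded_module" and P :: "nat \<Rightarrow> ('r, nat \<Rightarrow> 'r) graded_module"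
  assumes P: "graded_resolution R M P D e" and N: "graded_mod R N"
    and \<psi>: "cohomology_functional R P D N n d \<psi>"
  shows "coordinatized (Ext R M N n d) (\<psi> ` cocycles R P D N n d)"
proof -
  interpret P: graded_resolution R M P D e by fact
  let ?P = "fst (chosen_resolution R M)" and ?D = "snd (chosen_resolution R M)"
  have "\<exists>e. graded_projective_resolution R M ?P ?D e"
    unfolding chosen_resolution_def
    by (rule someI[where x = "(P, D)" and
          P = "\<lambda>Q. \<exists>e. graded_projective_resolution R M (fst Q) (snd Q) e"]) (use P.resolution in auto)
  then obtain e' where "graded_projective_resolution R M ?P ?D e'" by blast
  then have Q: "graded_resolution R M ?P ?D e'"
    using P.M P.graded_alg_axioms by (intro graded_resolution.intro graded_resolution_axioms.intro)
  interpret Q: graded_resolution R M ?P ?D e' by fact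
  obtain \<psi>' where "cohomology_functional R ?P ?D N n d \<psi>'"
    "\<psi>' ` cocycles R ?P ?D N n d = \<psi> ` cocycles R P D N n d"
    using cohomology_functional_transfer[OF Q P N \<psi>] by blast
  then show ?thesis using Q.cohomology_coordinatized[OF N] unfolding Ext_def by metis
qed


section \<open>Resolutions by principal left ideals\<close>

text \<open>The left ideal generated by an idempotent, with degrees raised by \<open>n\<close>.  Its elements are
  stored as constant functions because \<^const>\<open>chosen_resolution\<close> looks for resolutions on the type
  \<^typ>\<open>nat \<Rightarrow> 'r\<close>.\<close>

definition principal_module ::
    "(complex, 'r) graded_module \<Rightarrow> 'r \<Rightarrow> int \<Rightarrow> ('r, nat \<Rightarrow> 'r) graded_module" where
  "principal_module R \<epsilon> n = \<lparr>
     carrier = {\<lambda>_. x | x. x \<in> carrier R \<and> x \<otimes>\<^bsub>R\<^esub> \<epsilon> = x}, mult = undefined, one = undefined,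
     zero = (\<lambda>_. \<zero>\<^bsub>R\<^esub>), add = (\<lambda>f g i. f i \<oplus>\<^bsub>R\<^esub> g i), smult = (\<lambda>r f i. r \<otimes>\<^bsub>R\<^esub> f i),
     part = (\<lambda>d. {\<lambda>_. x | x. x \<in> part R (d - n) \<and> x \<otimes>\<^bsub>R\<^esub> \<epsilon> = x})\<rparr>"

lemma principal_module_simps [simp]:
  "carrier (principal_module R \<epsilon> n) = {\<lambda>_. x | x. x \<in> carrier R \<and> x \<otimes>\<^bsub>R\<^esub> \<epsilon> = x}"
  "zero (principal_module R \<epsilon> n) = (\<lambda>_. \<zero>\<^bsub>R\<^esub>)"
  "add (principal_module R \<epsilon> n) f g = (\<lambda>i. f i \<oplus>\<^bsub>R\<^esub> g i)"
  "smult (principal_module R \<epsilon> n) r f = (\<lambda>i. r \<otimes>\<^bsub>R\<^esub> f i)"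
  "part (principal_module R \<epsilon> n) d = {\<lambda>_. x | x. x \<in> part R (d - n) \<and> x \<otimes>\<^bsub>R\<^esub> \<epsilon> = x}"
  by (simp_all add: principal_module_def)

context graded_alg
begin

lemma part_carrier: "x \<in> part R d \<Longrightarrow> x \<in> carrier R"
  using Reg.part_carrier[of x d] by simp

lemma part_mult: "x \<in> part R i \<Longrightarrow> y \<in> part R j \<Longrightarrow> x \<otimes>\<^bsub>R\<^esub> y \<in> part R (i + j)"
  using Reg.part_smult[of x i y j] by simp

lemma part_additive_subgroup: "additive_subgroup (part R d) R"
  using Reg.part_subgroup[of d] by (simp add: additive_subgroup_def subgroup_def m_inv_def)

text \<open>The grading of the regular module speaks of left multiplication; the claim for right
  multiplication by an element of degree 0 is checked on homogeneous elements. It shows that the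
  left ideal \<open>R \<epsilon>\<close> contains the components of its elements.\<close>

lemma component_mult_right:
  assumes "\<epsilon> \<in> part R 0" "x \<in> carrier R"
  shows "component (graded_regular R) d (x \<otimes>\<^bsub>R\<^esub> \<epsilon>) = component (graded_regular R) d x \<otimes>\<^bsub>R\<^esub> \<epsilon>"
proof -
  have \<epsilon>: "\<epsilon> \<in> carrier R" by (rule part_carrier[OF assms(1)])
  have "x \<in> carrier (graded_regular R)" using assms(2) by simp
  then show ?thesis
  proof (induction x rule: Reg.graded_induct)
    case (homogeneous j x)
    then have "x \<in> part R j" by simp
    then have "x \<otimes>\<^bsub>R\<^esub> \<epsilon> \<in> part (graded_regular R) j" using part_mult[OF _ assms(1), of x j] by simp
    then show ?case using homogeneous \<epsilon> by (simp add: Reg.component_homogeneous)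
  next
    case (add x y)
    then have xy: "x \<in> carrier R" "y \<in> carrier R" by simp_all
    have c: "component (graded_regular R) d z \<in> carrier R" if "z \<in> carrier R" for z
      using Reg.component_closed[of z d] that by simp
    have "component (graded_regular R) d ((x \<oplus>\<^bsub>R\<^esub> y) \<otimes>\<^bsub>R\<^esub> \<epsilon>)
        = component (graded_regular R) d (x \<otimes>\<^bsub>R\<^esub> \<epsilon>) \<oplus>\<^bsub>R\<^esub> component (graded_regular R) d (y \<otimes>\<^bsub>R\<^esub> \<epsilon>)"
      using Reg.component_add[of "x \<otimes>\<^bsub>R\<^esub> \<epsilon>" "y \<otimes>\<^bsub>R\<^esub> \<epsilon>" d] xy \<epsilon> by (simp add: Reg.R.l_distr)
    also have "\<dots> = (component (graded_regular R) d x \<oplus>\<^bsub>R\<^esub> component (graded_regular R) d y) \<otimes>\<^bsub>R\<^esub> \<epsilon>"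
      using add.IH xy c \<epsilon> by (simp add: Reg.R.l_distr)
    finally show ?case using Reg.component_add[of x y d] xy by simp
  qed
qed

lemma left_module_principal:
  assumes "\<epsilon> \<in> carrier R"
  shows "left_module R (principal_module R \<epsilon> n)"
proof (rule left_moduleI[OF Reg.R.ring_axioms])
  show "abelian_group (principal_module R \<epsilon> n)"
  proof (rule abelian_groupI)
    fix f assume "f \<in> carrier (principal_module R \<epsilon> n)"
    then obtain x where x: "x \<in> carrier R" "x \<otimes>\<^bsub>R\<^esub> \<epsilon> = x" "f = (\<lambda>_. x)" by auto
    then show "\<exists>g\<in>carrier (principal_module R \<epsilon> n).
        g \<oplus>\<^bsub>principal_module R \<epsilon> n\<^esub> f = \<zero>\<^bsub>principal_module R \<epsilon> n\<^esub>"
      using assms by (intro bexI[of _ "\<lambda>_. \<ominus>\<^bsub>R\<^esub> x"]) (auto simp: Reg.R.l_neg Reg.R.l_minus)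
  qed (use assms in \<open>auto simp: Reg.R.a_ac Reg.R.l_distr\<close>)
qed (use assms in \<open>auto simp: Reg.R.l_distr Reg.R.r_distr Reg.R.m_assoc\<close>)

lemma graded_principal:
  assumes \<epsilon>: "\<epsilon> \<in> part R 0" and idem: "\<epsilon> \<otimes>\<^bsub>R\<^esub> \<epsilon> = \<epsilon>"
  shows "graded_mod R (principal_module R \<epsilon> n)"
proof (rule graded_mod.intro)
  let ?P = "principal_module R \<epsilon> n" and ?c = "component (graded_regular R)"
  have \<epsilon>c [simp]: "\<epsilon> \<in> carrier R" by (rule part_carrier[OF \<epsilon>])
  interpret P: left_mod R ?P by unfold_locales (rule left_module_principal[OF \<epsilon>c])
  have cc: "?c d x \<in> carrier R" if "x \<in> carrier R" for d x
    using Reg.component_closed[of x d] that by simp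
  have cp: "?c d x \<in> part R d" if "x \<in> carrier R" for d x
    using Reg.component_part[of x d] that by simp
  have ce: "?c d x \<otimes>\<^bsub>R\<^esub> \<epsilon> = ?c d x" if "x \<in> carrier R" "x \<otimes>\<^bsub>R\<^esub> \<epsilon> = x" for d x
    using component_mult_right[OF \<epsilon> that(1), of d] that(2) by simp
  show "graded_left_module R ?P"
  \<comment> \<open>Elements are constant functions, so evaluation at 0 recovers the ring element;
    the degree \<open>d\<close> of the shifted module is the degree \<open>d - n\<close> of
    \<open>R\<close>.\<close>
  proof (rule graded_left_moduleI[where pr = "\<lambda>d f. \<lambda>_. ?c (d - n) (f 0)"])
    show "additive_subgroup (part ?P d) ?P" for d
    proof (intro additive_subgroup.intro P.M.add.subgroupI)
      show "part ?P d \<subseteq> carrier ?P" using part_carrier by auto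
      have "\<zero>\<^bsub>R\<^esub> \<in> part R (d - n)" using additive_subgroup.zero_closed[OF part_additive_subgroup] .
      then show "part ?P d \<noteq> {}" by auto
      fix f assume "f \<in> part ?P d"
      then obtain x where x: "x \<in> part R (d - n)" "x \<otimes>\<^bsub>R\<^esub> \<epsilon> = x" "f = (\<lambda>_. x)" by auto
      have "\<ominus>\<^bsub>?P\<^esub> f = (\<lambda>_. \<ominus>\<^bsub>R\<^esub> x)"
        using x part_carrier[OF x(1)]
        by (intro P.M.minus_equality) (auto simp: Reg.R.l_neg Reg.R.l_minus)
      then show "\<ominus>\<^bsub>?P\<^esub> f \<in> part ?P d"
        using x part_carrier[OF x(1)] additive_subgroup.a_inv_closed[OF part_additive_subgroup x(1)]
        by (auto simp: Reg.R.l_minus)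
    next
      fix f g assume "f \<in> part ?P d" "g \<in> part ?P d"
      then show "f \<oplus>\<^bsub>?P\<^esub> g \<in> part ?P d"
        using additive_subgroup.a_closed[OF part_additive_subgroup] part_carrier
        by (auto simp: Reg.R.l_distr)
    qed
  next
    fix i j r f assume r: "r \<in> part R i" and "f \<in> part ?P j"
    then obtain x where x: "x \<in> part R (j - n)" "x \<otimes>\<^bsub>R\<^esub> \<epsilon> = x" "f = (\<lambda>_. x)" by auto
    have "(r \<otimes>\<^bsub>R\<^esub> x) \<otimes>\<^bsub>R\<^esub> \<epsilon> = r \<otimes>\<^bsub>R\<^esub> x"
      using part_carrier[OF r] part_carrier[OF x(1)] x(2) by (simp add: Reg.R.m_assoc)
    moreover have "r \<otimes>\<^bsub>R\<^esub> x \<in> part R (i + j - n)" using part_mult[OF r x(1)] by (simp add: add_diff_eq)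
    ultimately show "r \<odot>\<^bsub>?P\<^esub> f \<in> part ?P (i + j)" using x(3) by auto
  next
    fix d f assume "f \<in> carrier ?P"
    then show "(\<lambda>_. ?c (d - n) (f 0)) \<in> part ?P d" using cp ce by auto
  next
    fix d f g assume "f \<in> carrier ?P" "g \<in> carrier ?P"
    then show "(\<lambda>_. ?c (d - n) ((f \<oplus>\<^bsub>?P\<^esub> g) 0)) = (\<lambda>_. ?c (d - n) (f 0)) \<oplus>\<^bsub>?P\<^esub> (\<lambda>_. ?c (d - n) (g 0))"
      using Reg.component_add[of "f 0" "g 0" "d - n"] by auto
  next
    fix d j f assume "f \<in> part ?P j"
    then show "(\<lambda>_. ?c (d - n) (f 0)) = (if d = j then f else \<zero>\<^bsub>?P\<^esub>)"
      using Reg.component_homogeneous[of "f 0" "j - n" "d - n"] by auto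
  next
    fix f assume "f \<in> carrier ?P"
    then obtain x where x: "x \<in> carrier R" "x \<otimes>\<^bsub>R\<^esub> \<epsilon> = x" "f = (\<lambda>_. x)" by auto
    let ?T = "{k. ?c k x \<noteq> \<zero>\<^bsub>R\<^esub>}" and ?S = "(\<lambda>k. k + n) ` {k. ?c k x \<noteq> \<zero>\<^bsub>R\<^esub>}"
    have T: "finite ?T" using Reg.component_finite[of x] x(1) by simp
    \<comment> \<open>Right multiplication by \<open>\<epsilon>\<close> is additive on all of
      \<open>R\<close> and fixes \<open>x\<close>, so it carries the decomposition of
      \<open>x\<close> in \<open>R\<close> over to the left ideal.\<close>
    let ?h = "\<lambda>y. (\<lambda>_. y \<otimes>\<^bsub>R\<^esub> \<epsilon>) :: nat \<Rightarrow> 'r"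
    have h: "?h \<in> carrier (graded_regular R) \<rightarrow> carrier ?P" by (auto simp: Reg.R.m_assoc idem)
    have "f = ?h (finsum (graded_regular R) (\<lambda>k. ?c k x) ?T)"
      using Reg.component_sum[of x] x by simp
    also have "\<dots> = finsum ?P (\<lambda>k. ?h (?c k x)) ?T"
      using cc[OF x(1)] h T
      by (intro additive_map_finsum[OF Reg.M.abelian_group_axioms P.M.abelian_group_axioms])
        (auto simp: Reg.R.l_distr)
    also have "\<dots> = finsum ?P (\<lambda>k. (\<lambda>_. ?c (k + n - n) (f 0))) ?T"
      using ce[OF x(1,2)] cc[OF x(1)] x by (intro P.M.finsum_cong') auto
    also have "\<dots> = finsum ?P (\<lambda>d. (\<lambda>_. ?c (d - n) (f 0))) ?S"
      using ce[OF x(1,2)] cc[OF x(1)] x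
      by (intro P.M.finsum_reindex[symmetric]) (auto simp: inj_on_def)
    finally have "f = finsum ?P (\<lambda>d. (\<lambda>_. ?c (d - n) (f 0))) ?S" .
    moreover have "\<forall>d. d \<notin> ?S \<longrightarrow> (\<lambda>_. ?c (d - n) (f 0)) = \<zero>\<^bsub>?P\<^esub>"
    proof (intro allI impI)
      fix d assume "d \<notin> ?S"
      then have "d - n \<notin> ?T" by (metis diff_add_cancel image_eqI)
      then show "(\<lambda>_. ?c (d - n) (f 0)) = \<zero>\<^bsub>?P\<^esub>" using x(3) by simp
    qed
    ultimately show "\<exists>S. finite S \<and> (\<forall>d. d \<notin> S \<longrightarrow> (\<lambda>_. ?c (d - n) (f 0)) = \<zero>\<^bsub>?P\<^esub>) \<and>
        f = (\<Oplus>\<^bsub>?P\<^esub>d\<in>S. (\<lambda>_. ?c (d - n) (f 0)))"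
      using T by blast
  qed (rule P.left_module)
qed

text \<open>The inclusion and right multiplication by \<open>\<epsilon>\<close> exhibit the left
  ideal as a summand of the free module of rank one.\<close>

lemma fg_projective_principal:
  assumes \<epsilon>: "\<epsilon> \<in> carrier R" and idem: "\<epsilon> \<otimes>\<^bsub>R\<^esub> \<epsilon> = \<epsilon>"
  shows "fg_projective R (principal_module R \<epsilon> n)"
  unfolding fg_projective_def
proof (intro exI[of _ 1] bexI ballI)
  let ?P = "principal_module R \<epsilon> n"
  show "(\<lambda>f. \<lambda>i\<in>{..<1::nat}. f 0) \<in> module_hom R ?P (free_module R 1)"
    by (rule module_homI) (auto intro!: restrict_ext)
  show "(\<lambda>g _. g 0 \<otimes>\<^bsub>R\<^esub> \<epsilon>) \<in> module_hom R (free_module R 1) ?P"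
  proof (rule module_homI)
    fix g assume "g \<in> carrier (free_module R 1)"
    then have "g 0 \<in> carrier R" by auto
    then show "(\<lambda>_. g 0 \<otimes>\<^bsub>R\<^esub> \<epsilon>) \<in> carrier ?P" using \<epsilon> idem by (auto simp: Reg.R.m_assoc)
  next
    fix g h assume "g \<in> carrier (free_module R 1)" "h \<in> carrier (free_module R 1)"
    then have "g 0 \<in> carrier R" "h 0 \<in> carrier R" by auto
    then show "(\<lambda>_. (g \<oplus>\<^bsub>free_module R 1\<^esub> h) 0 \<otimes>\<^bsub>R\<^esub> \<epsilon>) = (\<lambda>_. g 0 \<otimes>\<^bsub>R\<^esub> \<epsilon>) \<oplus>\<^bsub>?P\<^esub> (\<lambda>_. h 0 \<otimes>\<^bsub>R\<^esub> \<epsilon>)"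
      using \<epsilon> by (simp add: Reg.R.l_distr)
  next
    fix r g assume "r \<in> carrier R" "g \<in> carrier (free_module R 1)"
    then have "r \<in> carrier R" "g 0 \<in> carrier R" by auto
    then show "(\<lambda>_. (r \<odot>\<^bsub>free_module R 1\<^esub> g) 0 \<otimes>\<^bsub>R\<^esub> \<epsilon>) = r \<odot>\<^bsub>?P\<^esub> (\<lambda>_. g 0 \<otimes>\<^bsub>R\<^esub> \<epsilon>)"
      using \<epsilon> by (simp add: Reg.R.m_assoc)
  qed
  show "(\<lambda>_. (\<lambda>i\<in>{..<1::nat}. f 0) 0 \<otimes>\<^bsub>R\<^esub> \<epsilon>) = f" if "f \<in> carrier ?P" for f
    using that by auto
qed

end

text \<open>The terms are the left ideals \<open>R \<epsilon>\<close> with degrees raised by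
  \<open>n\<close>, the differentials are right multiplication by \<open>\<delta> n\<close>, and the
  augmentation is \<open>x \<mapsto> x m\<^sub>0\<close>. As \<open>\<delta> n\<close> has degree 1,
  the shifts make all differentials homogeneous of degree 0. The exactness assumptions allow any
  \<open>y\<close> in \<open>R\<close>; it can be moved into the left ideal because
  \<open>\<epsilon> (Suc n)\<close> fixes \<open>\<delta> n\<close> from the left.\<close>

locale principal_complex = graded_alg R for R :: "(complex, 'r) graded_module" +
  fixes M :: "('r, 'm) graded_module" and m\<^sub>0 :: 'm
    and \<epsilon> \<delta> :: "nat \<Rightarrow> 'r"
  assumes M: "graded_mod R M"
    and eps_part: "\<epsilon> n \<in> part R 0" and eps_idem: "\<epsilon> n \<otimes>\<^bsub>R\<^esub> \<epsilon> n = \<epsilon> n"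
    and delta_part: "\<delta> n \<in> part R 1"
    and eps_delta: "\<epsilon> (Suc n) \<otimes>\<^bsub>R\<^esub> \<delta> n = \<delta> n" and delta_eps: "\<delta> n \<otimes>\<^bsub>R\<^esub> \<epsilon> n = \<delta> n"
    and delta_delta: "\<delta> (Suc n) \<otimes>\<^bsub>R\<^esub> \<delta> n = \<zero>\<^bsub>R\<^esub>"
    and exact: "x \<in> carrier R \<Longrightarrow> x \<otimes>\<^bsub>R\<^esub> \<epsilon> (Suc n) = x \<Longrightarrow> x \<otimes>\<^bsub>R\<^esub> \<delta> n = \<zero>\<^bsub>R\<^esub> \<Longrightarrow>
      \<exists>y\<in>carrier R. x = y \<otimes>\<^bsub>R\<^esub> \<delta> (Suc n)"
    and m0_part: "m\<^sub>0 \<in> part M 0" and eps_m0: "\<epsilon> 0 \<odot>\<^bsub>M\<^esub> m\<^sub>0 = m\<^sub>0" and delta_m0: "\<delta> 0 \<odot>\<^bsub>M\<^esub> m\<^sub>0 = \<zero>\<^bsub>M\<^esub>"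
    and generated: "m \<in> carrier M \<Longrightarrow> \<exists>x\<in>carrier R. m = x \<odot>\<^bsub>M\<^esub> m\<^sub>0"
    and exact_augmentation: "x \<in> carrier R \<Longrightarrow> x \<otimes>\<^bsub>R\<^esub> \<epsilon> 0 = x \<Longrightarrow> x \<odot>\<^bsub>M\<^esub> m\<^sub>0 = \<zero>\<^bsub>M\<^esub> \<Longrightarrow>
      \<exists>y\<in>carrier R. x = y \<otimes>\<^bsub>R\<^esub> \<delta> 0"
begin

sublocale M: graded_mod R M by (rule M)

definition "P n = principal_module R (\<epsilon> n) (int n)"
definition "D n = (\<lambda>f\<in>carrier (P (Suc n)). \<lambda>i. f i \<otimes>\<^bsub>R\<^esub> \<delta> n)"
definition "e = (\<lambda>f\<in>carrier (P 0). f 0 \<odot>\<^bsub>M\<^esub> m\<^sub>0)"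

lemma eps_carrier [simp]: "\<epsilon> n \<in> carrier R"
  by (rule part_carrier[OF eps_part])

lemma delta_carrier [simp]: "\<delta> n \<in> carrier R"
  by (rule part_carrier[OF delta_part])

lemma m0_carrier [simp]: "m\<^sub>0 \<in> carrier M"
  by (rule M.part_carrier[OF m0_part])

lemma P_graded: "graded_mod R (P n)"
  unfolding P_def by (rule graded_principal[OF eps_part eps_idem])

lemma P_carrier: "f \<in> carrier (P n) \<longleftrightarrow> (\<exists>x\<in>carrier R. x \<otimes>\<^bsub>R\<^esub> \<epsilon> n = x \<and> f = (\<lambda>_. x))"
  by (auto simp: P_def)

lemma P_carrierI: "x \<in> carrier R \<Longrightarrow> x \<otimes>\<^bsub>R\<^esub> \<epsilon> n = x \<Longrightarrow> (\<lambda>_. x) \<in> carrier (P n)"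
  by (auto simp: P_def)

lemma mult_delta_eps: "x \<in> carrier R \<Longrightarrow> (x \<otimes>\<^bsub>R\<^esub> \<delta> n) \<otimes>\<^bsub>R\<^esub> \<epsilon> n = x \<otimes>\<^bsub>R\<^esub> \<delta> n"
  by (simp add: Reg.R.m_assoc delta_eps)

lemma D_apply: "x \<in> carrier R \<Longrightarrow> x \<otimes>\<^bsub>R\<^esub> \<epsilon> (Suc n) = x \<Longrightarrow> D n (\<lambda>_. x) = (\<lambda>_. x \<otimes>\<^bsub>R\<^esub> \<delta> n)"
  by (simp add: D_def P_carrierI)

lemma e_apply: "x \<in> carrier R \<Longrightarrow> x \<otimes>\<^bsub>R\<^esub> \<epsilon> 0 = x \<Longrightarrow> e (\<lambda>_. x) = x \<odot>\<^bsub>M\<^esub> m\<^sub>0"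
  by (simp add: e_def P_carrierI)

lemma D_homs: "D n \<in> graded_homs R (P (Suc n)) (P n) 0"
  unfolding D_def
proof (intro graded_homs_restrictI P_graded)
  fix f assume "f \<in> carrier (P (Suc n))"
  then show "(\<lambda>i. f i \<otimes>\<^bsub>R\<^esub> \<delta> n) \<in> carrier (P n)"
    by (auto simp: P_carrier intro!: mult_delta_eps)
next
  fix f j assume "f \<in> part (P (Suc n)) j"
  then obtain x where x: "x \<in> part R (j - int (Suc n))" "f = (\<lambda>_. x)" by (auto simp: P_def)
  have "x \<otimes>\<^bsub>R\<^esub> \<delta> n \<in> part R (j - int n)" using part_mult[OF x(1) delta_part[of n]] by simp
  then show "(\<lambda>i. f i \<otimes>\<^bsub>R\<^esub> \<delta> n) \<in> part (P n) (j + 0)"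
    using x mult_delta_eps[OF part_carrier[OF x(1)]] by (auto simp: P_def)
qed (auto simp: P_def Reg.R.l_distr Reg.R.m_assoc)

lemma e_homs: "e \<in> graded_homs R (P 0) M 0"
  unfolding e_def
proof (intro graded_homs_restrictI P_graded)
  fix f j assume "f \<in> part (P 0) j"
  then obtain x where x: "x \<in> part R j" "f = (\<lambda>_. x)" by (auto simp: P_def)
  then show "f 0 \<odot>\<^bsub>M\<^esub> m\<^sub>0 \<in> part M (j + 0)" using M.part_smult[OF x(1) m0_part] by simp
qed (auto simp: P_def M.smult_l_distr M.smult_assoc)

sublocale graded_resolution R M P D e
proof
  show "graded_projective_resolution R M P D e"
    unfolding graded_projective_resolution_def
  proof (intro conjI allI)
    show "graded_left_module R (P n)" for n using P_graded by (rule graded_mod.graded)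
    show "fg_projective R (P n)" for n
      unfolding P_def by (rule fg_projective_principal[OF eps_carrier eps_idem])
    show "e ` carrier (P 0) = carrier M"
    proof (intro equalityI subsetI)
      fix m assume "m \<in> carrier M"
      then obtain x where x: "x \<in> carrier R" "m = x \<odot>\<^bsub>M\<^esub> m\<^sub>0" using generated by blast
      have xe: "(x \<otimes>\<^bsub>R\<^esub> \<epsilon> 0) \<otimes>\<^bsub>R\<^esub> \<epsilon> 0 = x \<otimes>\<^bsub>R\<^esub> \<epsilon> 0" using x by (simp add: Reg.R.m_assoc eps_idem)
      have "m = e (\<lambda>_. x \<otimes>\<^bsub>R\<^esub> \<epsilon> 0)" using x xe by (simp add: e_apply M.smult_assoc eps_m0)
      moreover have "(\<lambda>_. x \<otimes>\<^bsub>R\<^esub> \<epsilon> 0) \<in> carrier (P 0)" using x by (intro P_carrierI[OF _ xe]) simp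
      ultimately show "m \<in> e ` carrier (P 0)" by (rule image_eqI)
    qed (use graded_homs_closed[OF e_homs] in auto)
    show "{x \<in> carrier (P 0). e x = \<zero>\<^bsub>M\<^esub>} = D 0 ` carrier (P 1)"
    proof (intro equalityI subsetI)
      fix f assume "f \<in> {x \<in> carrier (P 0). e x = \<zero>\<^bsub>M\<^esub>}"
      then obtain x where x: "x \<in> carrier R" "x \<otimes>\<^bsub>R\<^esub> \<epsilon> 0 = x" "f = (\<lambda>_. x)" "x \<odot>\<^bsub>M\<^esub> m\<^sub>0 = \<zero>\<^bsub>M\<^esub>"
        by (auto simp: P_carrier e_apply)
      then obtain y where y: "y \<in> carrier R" "x = y \<otimes>\<^bsub>R\<^esub> \<delta> 0" using exact_augmentation by blast
      have ye: "(y \<otimes>\<^bsub>R\<^esub> \<epsilon> (Suc 0)) \<otimes>\<^bsub>R\<^esub> \<epsilon> (Suc 0) = y \<otimes>\<^bsub>R\<^esub> \<epsilon> (Suc 0)"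
        using y by (simp add: Reg.R.m_assoc eps_idem)
      have "f = D 0 (\<lambda>_. y \<otimes>\<^bsub>R\<^esub> \<epsilon> (Suc 0))"
        using x(3) y ye by (simp add: D_apply) (simp add: Reg.R.m_assoc eps_delta)
      moreover have "(\<lambda>_. y \<otimes>\<^bsub>R\<^esub> \<epsilon> (Suc 0)) \<in> carrier (P 1)"
        using y P_carrierI[OF _ ye] by simp
      ultimately show "f \<in> D 0 ` carrier (P 1)" by (rule image_eqI)
    next
      fix f assume "f \<in> D 0 ` carrier (P 1)"
      then obtain x where x: "x \<in> carrier R" "x \<otimes>\<^bsub>R\<^esub> \<epsilon> (Suc 0) = x" "f = D 0 (\<lambda>_. x)"
        by (auto simp: P_carrier)
      then have "f = (\<lambda>_. x \<otimes>\<^bsub>R\<^esub> \<delta> 0)" by (simp add: D_apply)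
      then show "f \<in> {x \<in> carrier (P 0). e x = \<zero>\<^bsub>M\<^esub>}"
        using x mult_delta_eps[OF x(1), of 0] by (auto simp: e_apply P_carrierI M.smult_assoc delta_m0)
    qed
    show "{x \<in> carrier (P (Suc n)). D n x = \<zero>\<^bsub>P n\<^esub>} = D (Suc n) ` carrier (P (Suc (Suc n)))" for n
    proof (intro equalityI subsetI)
      fix f assume "f \<in> {x \<in> carrier (P (Suc n)). D n x = \<zero>\<^bsub>P n\<^esub>}"
      then obtain x where x: "x \<in> carrier R" "x \<otimes>\<^bsub>R\<^esub> \<epsilon> (Suc n) = x" "f = (\<lambda>_. x)"
        and "D n (\<lambda>_. x) = \<zero>\<^bsub>P n\<^esub>"
        by (auto simp: P_carrier)
      then have "x \<otimes>\<^bsub>R\<^esub> \<delta> n = \<zero>\<^bsub>R\<^esub>" by (auto simp: D_apply P_def dest: fun_cong)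
      then obtain y where y: "y \<in> carrier R" "x = y \<otimes>\<^bsub>R\<^esub> \<delta> (Suc n)" using exact x by blast
      have ye: "(y \<otimes>\<^bsub>R\<^esub> \<epsilon> (Suc (Suc n))) \<otimes>\<^bsub>R\<^esub> \<epsilon> (Suc (Suc n)) = y \<otimes>\<^bsub>R\<^esub> \<epsilon> (Suc (Suc n))"
        using y by (simp add: Reg.R.m_assoc eps_idem)
      have "f = D (Suc n) (\<lambda>_. y \<otimes>\<^bsub>R\<^esub> \<epsilon> (Suc (Suc n)))"
        using x(3) y ye by (simp add: D_apply) (simp add: Reg.R.m_assoc eps_delta)
      moreover have "(\<lambda>_. y \<otimes>\<^bsub>R\<^esub> \<epsilon> (Suc (Suc n))) \<in> carrier (P (Suc (Suc n)))"
        using y P_carrierI[OF _ ye] by simp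
      ultimately show "f \<in> D (Suc n) ` carrier (P (Suc (Suc n)))" by (rule image_eqI)
    next
      fix f assume "f \<in> D (Suc n) ` carrier (P (Suc (Suc n)))"
      then obtain x where x: "x \<in> carrier R" "x \<otimes>\<^bsub>R\<^esub> \<epsilon> (Suc (Suc n)) = x" "f = D (Suc n) (\<lambda>_. x)"
        by (auto simp: P_carrier)
      then have "f = (\<lambda>_. x \<otimes>\<^bsub>R\<^esub> \<delta> (Suc n))" by (simp add: D_apply)
      moreover have "(x \<otimes>\<^bsub>R\<^esub> \<delta> (Suc n)) \<otimes>\<^bsub>R\<^esub> \<delta> n = \<zero>\<^bsub>R\<^esub>"
        using x by (simp add: Reg.R.m_assoc delta_delta)
      ultimately show "f \<in> {x \<in> carrier (P (Suc n)). D n x = \<zero>\<^bsub>P n\<^esub>}"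
        using x mult_delta_eps[OF x(1), of "Suc n"] by (auto simp: D_apply P_carrierI P_def)
    qed
  qed (use D_homs e_homs in auto)
qed

section \<open>Homomorphisms from principal left ideals\<close>

context
  fixes N :: "('r, 'n) graded_module" assumes N: "graded_mod R N"
begin

interpretation N: graded_mod R N by (rule N)

text \<open>The inverse of evaluation at the generator: a homomorphism on the \<open>n\<close>-th
  left ideal corresponds to its value \<open>y\<close> at \<open>\<epsilon> n\<close>, and the
  possible values are those fixed by \<open>\<epsilon> n\<close>.\<close>

definition "hom_of n y = (\<lambda>f\<in>carrier (P n). f 0 \<odot>\<^bsub>N\<^esub> y)"

lemma eps_in_P [simp]: "(\<lambda>_. \<epsilon> n) \<in> carrier (P n)"
  by (intro P_carrierI) (auto simp: eps_idem)

lemma hom_determined: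
  assumes f: "f \<in> graded_homs R (P n) N d" and x: "x \<in> carrier R" "x \<otimes>\<^bsub>R\<^esub> \<epsilon> n = x"
  shows "f (\<lambda>_. x) = x \<odot>\<^bsub>N\<^esub> f (\<lambda>_. \<epsilon> n)"
  using graded_homs_smult[OF f x(1) eps_in_P] x by (simp add: P_def)

lemma hom_eval:
  assumes f: "f \<in> graded_homs R (P n) N d"
  shows "f (\<lambda>_. \<epsilon> n) \<in> part N (int n + d)" "\<epsilon> n \<odot>\<^bsub>N\<^esub> f (\<lambda>_. \<epsilon> n) = f (\<lambda>_. \<epsilon> n)"
proof -
  have "(\<lambda>_. \<epsilon> n) \<in> part (P n) (int n)" using eps_part eps_idem by (auto simp: P_def)
  then show "f (\<lambda>_. \<epsilon> n) \<in> part N (int n + d)" by (rule graded_homs_part[OF f])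
  show "\<epsilon> n \<odot>\<^bsub>N\<^esub> f (\<lambda>_. \<epsilon> n) = f (\<lambda>_. \<epsilon> n)"
    by (rule hom_determined[OF f eps_carrier eps_idem, symmetric])
qed

lemma hom_of:
  assumes y: "y \<in> part N (int n + d)" and ey: "\<epsilon> n \<odot>\<^bsub>N\<^esub> y = y"
  shows "hom_of n y \<in> graded_homs R (P n) N d" "hom_of n y (\<lambda>_. \<epsilon> n) = y"
proof -
  have yc [simp]: "y \<in> carrier N" by (rule N.part_carrier[OF y])
  show "hom_of n y \<in> graded_homs R (P n) N d"
    unfolding hom_of_def
  proof (intro graded_homs_restrictI P_graded)
    fix f j assume "f \<in> part (P n) j"
    then obtain x where x: "x \<in> part R (j - int n)" "f = (\<lambda>_. x)" by (auto simp: P_def)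
    then show "f 0 \<odot>\<^bsub>N\<^esub> y \<in> part N (j + d)" using N.part_smult[OF x(1) y] by simp
  qed (auto simp: P_def N.smult_l_distr N.smult_assoc)
  show "hom_of n y (\<lambda>_. \<epsilon> n) = y" using ey by (simp add: hom_of_def)
qed

text \<open>Evaluation at generators turns the cochain differential into multiplication by
  \<open>\<delta> n\<close>: the value of \<open>f\<close> at \<open>D n\<close> of \<open>x\<close>
  is \<open>x\<close> times \<open>\<delta> n\<close> times the value of \<open>f\<close> at
  \<open>\<epsilon> n\<close>, and \<open>x = \<epsilon> (Suc n)\<close> isolates the last two
  factors.\<close>

lemma cocycles_iff: "f \<in> cocycles R P D N n d \<longleftrightarrow>
    f \<in> graded_homs R (P n) N d \<and> \<delta> n \<odot>\<^bsub>N\<^esub> f (\<lambda>_. \<epsilon> n) = \<zero>\<^bsub>N\<^esub>"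
proof -
  have "(\<forall>p\<in>carrier (P (Suc n)). f (D n p) = \<zero>\<^bsub>N\<^esub>) \<longleftrightarrow> \<delta> n \<odot>\<^bsub>N\<^esub> f (\<lambda>_. \<epsilon> n) = \<zero>\<^bsub>N\<^esub>"
    if f: "f \<in> graded_homs R (P n) N d"
  proof -
    have fD: "f (D n (\<lambda>_. x)) = x \<odot>\<^bsub>N\<^esub> (\<delta> n \<odot>\<^bsub>N\<^esub> f (\<lambda>_. \<epsilon> n))"
      if x: "x \<in> carrier R" "x \<otimes>\<^bsub>R\<^esub> \<epsilon> (Suc n) = x" for x
      using hom_determined[OF f, of "x \<otimes>\<^bsub>R\<^esub> \<delta> n"] x mult_delta_eps[of x n]
        graded_homs_closed[OF f eps_in_P] by (simp add: D_apply N.smult_assoc)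
    have "f (D n (\<lambda>_. \<epsilon> (Suc n))) = \<delta> n \<odot>\<^bsub>N\<^esub> f (\<lambda>_. \<epsilon> n)"
      using hom_determined[OF f, of "\<delta> n"] by (simp add: D_apply eps_idem eps_delta delta_eps)
    moreover have "(\<lambda>_. \<epsilon> (Suc n)) \<in> carrier (P (Suc n))" by simp
    ultimately show ?thesis using fD by (auto simp: P_carrier)
  qed
  then show ?thesis by (auto simp: cocycles_def)
qed

text \<open>No differential enters degree 0, hence the case distinction. In positive degree a
  suitable \<open>z\<close> yields the preimage \<open>hom_of m z\<close>.\<close>

lemma coboundaries_iff: "f \<in> coboundaries R P D N n d \<longleftrightarrow>
    f \<in> graded_homs R (P n) N d \<and>
    (case n of 0 \<Rightarrow> f (\<lambda>_. \<epsilon> n) = \<zero>\<^bsub>N\<^esub>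
     | Suc m \<Rightarrow> \<exists>z\<in>part N (int m + d). \<epsilon> m \<odot>\<^bsub>N\<^esub> z = z \<and> f (\<lambda>_. \<epsilon> n) = \<delta> m \<odot>\<^bsub>N\<^esub> z)"
proof (cases n)
  case 0
  have "f = (\<lambda>p\<in>carrier (P 0). \<zero>\<^bsub>N\<^esub>) \<longleftrightarrow> f \<in> graded_homs R (P 0) N d \<and> f (\<lambda>_. \<epsilon> 0) = \<zero>\<^bsub>N\<^esub>"
  proof
    assume f: "f \<in> graded_homs R (P 0) N d \<and> f (\<lambda>_. \<epsilon> 0) = \<zero>\<^bsub>N\<^esub>"
    then have "f p = \<zero>\<^bsub>N\<^esub>" if "p \<in> carrier (P 0)" for p
      using hom_determined[of f 0 d] that by (auto simp: P_carrier)
    moreover have "f = (\<lambda>p\<in>carrier (P 0). f p)"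
      by (rule extensional_restrict[OF graded_homs_extensional[OF conjunct1[OF f]], symmetric])
    moreover have "(\<lambda>p\<in>carrier (P 0). f p) = (\<lambda>p\<in>carrier (P 0). \<zero>\<^bsub>N\<^esub>)"
      using calculation(1) by (intro restrict_ext) simp
    ultimately show "f = (\<lambda>p\<in>carrier (P 0). \<zero>\<^bsub>N\<^esub>)" by simp
  qed (use hom_zero[OF P_graded N] in auto)
  then show ?thesis using 0 by (simp add: coboundaries_def hom_space_def)
next
  case (Suc m)
  show ?thesis
  proof
    assume "f \<in> coboundaries R P D N n d"
    then obtain g where g: "g \<in> graded_homs R (P m) N d" "f = compose (carrier (P n)) g (D m)"
      using Suc by (auto simp: coboundaries_def)
    have "f (\<lambda>_. \<epsilon> n) = g (D m (\<lambda>_. \<epsilon> (Suc m)))" using Suc by (simp add: g(2) compose_eq)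
    also have "\<dots> = \<delta> m \<odot>\<^bsub>N\<^esub> g (\<lambda>_. \<epsilon> m)"
      using hom_determined[OF g(1), of "\<delta> m"] by (simp add: D_apply eps_idem eps_delta delta_eps)
    finally show "f \<in> graded_homs R (P n) N d \<and> (case n of 0 \<Rightarrow> f (\<lambda>_. \<epsilon> n) = \<zero>\<^bsub>N\<^esub>
       | Suc m \<Rightarrow> \<exists>z\<in>part N (int m + d). \<epsilon> m \<odot>\<^bsub>N\<^esub> z = z \<and> f (\<lambda>_. \<epsilon> n) = \<delta> m \<odot>\<^bsub>N\<^esub> z)"
      using hom_eval[OF g(1)] graded_homs_compose[OF P_graded D_homs g(1)] Suc g(2) by auto
  next
    assume f: "f \<in> graded_homs R (P n) N d \<and> (case n of 0 \<Rightarrow> f (\<lambda>_. \<epsilon> n) = \<zero>\<^bsub>N\<^esub>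
       | Suc m \<Rightarrow> \<exists>z\<in>part N (int m + d). \<epsilon> m \<odot>\<^bsub>N\<^esub> z = z \<and> f (\<lambda>_. \<epsilon> n) = \<delta> m \<odot>\<^bsub>N\<^esub> z)"
    then obtain z where z: "z \<in> part N (int m + d)" "\<epsilon> m \<odot>\<^bsub>N\<^esub> z = z" "f (\<lambda>_. \<epsilon> n) = \<delta> m \<odot>\<^bsub>N\<^esub> z"
      using Suc by auto
    note zc = N.part_carrier[OF z(1)]
    have "f p = hom_of m z (D m p)" if p: "p \<in> carrier (P n)" for p
    proof -
      obtain x where x: "x \<in> carrier R" "x \<otimes>\<^bsub>R\<^esub> \<epsilon> n = x" "p = (\<lambda>_. x)"
        using p by (auto simp: P_carrier)
      have fh: "f \<in> graded_homs R (P n) N d" using f by blast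
      have "f p = x \<odot>\<^bsub>N\<^esub> (\<delta> m \<odot>\<^bsub>N\<^esub> z)"
        using hom_determined[OF fh x(1,2)] x(3) z(3) by simp
      also have "\<dots> = hom_of m z (D m p)"
        using x Suc zc mult_delta_eps[OF x(1), of m]
        by (simp add: D_apply hom_of_def P_carrierI N.smult_assoc)
      finally show ?thesis .
    qed
    then have "compose (carrier (P n)) (hom_of m z) (D m) = (\<lambda>p\<in>carrier (P n). f p)"
      by (auto simp: compose_def intro!: restrict_ext)
    also have "\<dots> = f"
      by (rule extensional_restrict[OF graded_homs_extensional[OF conjunct1[OF f]]])
    finally show "f \<in> coboundaries R P D N n d"
      using hom_of(1)[OF z(1,2)] Suc by (auto simp: coboundaries_def)
  qed
qed

text \<open>The cohomology is that of the spaces \<open>\<epsilon> n N\<close> with multiplication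
  by \<open>\<delta> n\<close>. The generator has degree \<open>n\<close> in \<open>P n\<close>, so
  a homomorphism of degree \<open>d\<close> takes a value of degree \<open>n + d\<close>
  there.\<close>

lemma principal_functional:
  fixes \<psi> :: "'n \<Rightarrow> complex" and n :: nat and d :: int
  defines "Z \<equiv> {y \<in> part N (int n + d). \<epsilon> n \<odot>\<^bsub>N\<^esub> y = y \<and> \<delta> n \<odot>\<^bsub>N\<^esub> y = \<zero>\<^bsub>N\<^esub>}"
  assumes add: "\<And>y z. y \<in> Z \<Longrightarrow> z \<in> Z \<Longrightarrow> \<psi> (y \<oplus>\<^bsub>N\<^esub> z) = \<psi> y + \<psi> z"
    and scalar: "\<And>c y. y \<in> Z \<Longrightarrow> \<psi> ((c \<odot>\<^bsub>R\<^esub> \<one>\<^bsub>R\<^esub>) \<odot>\<^bsub>N\<^esub> y) = c * \<psi> y"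
    and ker: "\<And>y. y \<in> part N (int n + d) \<Longrightarrow> \<epsilon> n \<odot>\<^bsub>N\<^esub> y = y \<Longrightarrow>
      (case n of 0 \<Rightarrow> y = \<zero>\<^bsub>N\<^esub>
       | Suc m \<Rightarrow> \<exists>z\<in>part N (int m + d). \<epsilon> m \<odot>\<^bsub>N\<^esub> z = z \<and> y = \<delta> m \<odot>\<^bsub>N\<^esub> z) \<longleftrightarrow>
      \<delta> n \<odot>\<^bsub>N\<^esub> y = \<zero>\<^bsub>N\<^esub> \<and> \<psi> y = 0"
  shows "coordinatized (Ext R M N n d) (\<psi> ` Z)"
proof -
  let ?\<psi> = "\<lambda>f. \<psi> (f (\<lambda>_. \<epsilon> n))"
  have Z: "f (\<lambda>_. \<epsilon> n) \<in> Z" if "f \<in> cocycles R P D N n d" for f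
    using that hom_eval by (auto simp: cocycles_iff Z_def)
  have "cohomology_functional R P D N n d ?\<psi>"
    unfolding cohomology_functional_def
  proof (intro conjI ballI allI)
    show "coboundaries R P D N n d = {f \<in> cocycles R P D N n d. ?\<psi> f = 0}"
      using ker hom_eval by (auto simp: cocycles_iff coboundaries_iff)
  qed (use add scalar Z in auto)
  moreover have "?\<psi> ` cocycles R P D N n d = \<psi> ` Z"
  proof (intro equalityI subsetI)
    fix c assume "c \<in> \<psi> ` Z"
    then obtain y where y: "y \<in> Z" "c = \<psi> y" by blast
    then have "hom_of n y \<in> cocycles R P D N n d" "hom_of n y (\<lambda>_. \<epsilon> n) = y"
      using hom_of[of y n d] by (auto simp: cocycles_iff Z_def)
    then show "c \<in> ?\<psi> ` cocycles R P D N n d" using y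
      by (intro image_eqI[of _ _ "hom_of n y"]) simp_all
  qed (use Z in auto)
  ultimately show ?thesis
    using Ext_coordinatized[OF graded_resolution_axioms N, of n d ?\<psi>] by simp
qed

end

end


section \<open>Algebras presented by a basis\<close>

lemma lookup_map_times [simp]:
  "Poly_Mapping.lookup (Poly_Mapping.map (\<lambda>y. c * y) f) k = c * Poly_Mapping.lookup f (k :: 'b)"
  for f :: "'b \<Rightarrow>\<^sub>0 complex"
  by (simp add: map.rep_eq when_def)

lemma poly_mapping_sum_single:
  "f = (\<Sum>k\<in>Poly_Mapping.keys f. Poly_Mapping.single k (Poly_Mapping.lookup f k))"
  for f :: "'b \<Rightarrow>\<^sub>0 'c :: comm_monoid_add"
  by (rule poly_mapping_eqI)
    (auto simp: lookup_sum lookup_single when_def sum.delta in_keys_iff)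

lemma poly_mapping_keys_induct [consumes 1, case_names single add zero]:
  fixes f :: "'b \<Rightarrow>\<^sub>0 'c :: comm_monoid_add"
  assumes "Poly_Mapping.keys f \<subseteq> B"
    and "\<And>b c. b \<in> B \<Longrightarrow> Q (Poly_Mapping.single b c)"
    and "\<And>f g. Poly_Mapping.keys f \<subseteq> B \<Longrightarrow> Poly_Mapping.keys g \<subseteq> B \<Longrightarrow> Q f \<Longrightarrow> Q g \<Longrightarrow> Q (f + g)"
    and "Q 0"
  shows "Q f"
proof -
  have "Q (\<Sum>k\<in>S. Poly_Mapping.single k (Poly_Mapping.lookup f k)) \<and>
      Poly_Mapping.keys (\<Sum>k\<in>S. Poly_Mapping.single k (Poly_Mapping.lookup f k)) \<subseteq> B"
    if "finite S" "S \<subseteq> B" for S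
    using that
  proof (induction S rule: finite_induct)
    case (insert a S)
    have "Poly_Mapping.keys (Poly_Mapping.single a (Poly_Mapping.lookup f a)) \<subseteq> B"
      using insert.prems by (auto split: if_splits)
    moreover have "Poly_Mapping.keys (Poly_Mapping.single a (Poly_Mapping.lookup f a) +
        (\<Sum>k\<in>S. Poly_Mapping.single k (Poly_Mapping.lookup f k))) \<subseteq> B"
      by (rule order.trans[OF Poly_Mapping.keys_add])
        (use calculation insert in \<open>auto simp del: Poly_Mapping.keys_single\<close>)
    ultimately show ?case
      using insert assms(2)[of a "Poly_Mapping.lookup f a"] by (auto intro!: assms(3))
  qed (use assms in auto)
  from this[of "Poly_Mapping.keys f"] show ?thesis
    using assms(1) poly_mapping_sum_single[of f] by simp
qed

lemma keys_smult: "Poly_Mapping.keys (Poly_Mapping.map (\<lambda>y. c * y) f)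
    \<subseteq> Poly_Mapping.keys (f :: 'b \<Rightarrow>\<^sub>0 complex)"
  by (auto simp: in_keys_iff)

definition linear_extension :: "('b \<Rightarrow> 'i \<Rightarrow> complex) \<Rightarrow> ('b \<Rightarrow>\<^sub>0 complex) \<Rightarrow> 'i \<Rightarrow> complex" where
  "linear_extension k f i = (\<Sum>b\<in>Poly_Mapping.keys f. Poly_Mapping.lookup f b * k b i)"

lemma linear_extension_superset:
  "finite S \<Longrightarrow> Poly_Mapping.keys f \<subseteq> S \<Longrightarrow> linear_extension k f i = (\<Sum>b\<in>S. Poly_Mapping.lookup f b * k b i)"
  unfolding linear_extension_def by (intro sum.mono_neutral_left) (auto simp: in_keys_iff)

lemma linear_extension_add: "linear_extension k (f + g) =
    (\<lambda>i. linear_extension k f i + linear_extension k g i)"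
proof
  fix i
  let ?S = "Poly_Mapping.keys f \<union> Poly_Mapping.keys g"
  have "Poly_Mapping.keys (f + g) \<subseteq> ?S" by (rule Poly_Mapping.keys_add)
  then show "linear_extension k (f + g) i = linear_extension k f i + linear_extension k g i"
    by (simp add: linear_extension_superset[of ?S] lookup_add distrib_right sum.distrib)
qed

lemma linear_extension_zero [simp]: "linear_extension k 0 = (\<lambda>_. 0)"
  by (simp add: linear_extension_def fun_eq_iff)

lemma linear_extension_single [simp]: "linear_extension k (Poly_Mapping.single b c) = (\<lambda>i. c * k b i)"
  by (cases "c = 0") (simp_all add: linear_extension_def fun_eq_iff)

lemma linear_extension_sum: "finite S \<Longrightarrow> linear_extension k (\<Sum>i\<in>S. f i) =
    (\<lambda>j. \<Sum>i\<in>S. linear_extension k (f i) j)"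
  by (induction S rule: finite_induct) (simp_all add: linear_extension_add)

lemma linear_extension_smult: "linear_extension k (Poly_Mapping.map (\<lambda>y. c * y) f) =
    (\<lambda>i. c * linear_extension k f i)"
proof
  fix i
  show "linear_extension k (Poly_Mapping.map (\<lambda>y. c * y) f) i = c * linear_extension k f i"
    using linear_extension_superset[where S = "Poly_Mapping.keys f" and k = k and i = i and
        f = "Poly_Mapping.map (\<lambda>y. c * y) f"] keys_smult[of c f]
    by (simp add: linear_extension_def[of k f] sum_distrib_left mult.assoc)
qed

lemma linear_extension_uminus: "linear_extension k (- f) =
    (\<lambda>i. - linear_extension k f i)"
proof -
  have "linear_extension k (- f + f) = (\<lambda>i. linear_extension k (- f) i + linear_extension k f i)"
    by (rule linear_extension_add)
  then show ?thesis by (auto simp: fun_eq_iff eq_neg_iff_add_eq_0)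
qed

lemma linear_extension_diff: "linear_extension k (f - g) =
    (\<lambda>i. linear_extension k f i - linear_extension k g i)"
  using linear_extension_add[of k f "- g"] by (simp add: linear_extension_uminus)

text \<open>\<open>None\<close> stands for the product zero, so associativity is an equation in the
  option monad. The unit axioms give every basis element exactly one left and one right unit in
  \<open>E\<close>, the other members of \<open>E\<close> killing it, as for vertices and paths; the
  sum over \<open>E\<close> is then the identity.\<close>

locale basis_alg =
  fixes B E :: "'b set" and pr :: "'b \<Rightarrow> 'b \<Rightarrow> 'b option" and deg :: "int \<Rightarrow> 'b set"
  assumes finite_units: "finite E" and units_sub: "E \<subseteq> B"
    and pr_closed: "a \<in> B \<Longrightarrow> b \<in> B \<Longrightarrow> pr a b = Some c \<Longrightarrow> c \<in> B"
    and pr_assoc: "a \<in> B \<Longrightarrow> b \<in> B \<Longrightarrow> c \<in> B \<Longrightarrow>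
      Option.bind (pr a b) (\<lambda>x. pr x c) = Option.bind (pr b c) (pr a)"
    and left_unit: "a \<in> B \<Longrightarrow> \<exists>e\<in>E. \<forall>e'\<in>E. pr e' a = (if e' = e then Some a else None)"
    and right_unit: "a \<in> B \<Longrightarrow> \<exists>e\<in>E. \<forall>e'\<in>E. pr a e' = (if e' = e then Some a else None)"
begin

abbreviation "F \<equiv> basis_algebra B E pr deg"

definition "bprod a b x = (case pr a b of None \<Rightarrow> 0 | Some c \<Rightarrow> Poly_Mapping.single c (x :: complex))"

lemma bprod_zero [simp]: "bprod a b 0 = 0" by (simp add: bprod_def split: option.split)

lemma bprod_add: "bprod a b (x + y) = bprod a b x + bprod a b y"
  by (simp add: bprod_def single_add split: option.split)

lemma F_simps [simp]:
  "carrier F = {f. Poly_Mapping.keys f \<subseteq> B}" "zero F = 0" "add F = (+)"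
  "one F = (\<Sum>e\<in>E. Poly_Mapping.single e 1)"
  "smult F = (\<lambda>c. Poly_Mapping.map (\<lambda>y. c * y))"
  "part F d = {f. Poly_Mapping.keys f \<subseteq> B \<inter> deg d}"
  by (simp_all add: basis_algebra_def)

lemma mult_eq: "f \<otimes>\<^bsub>F\<^esub> g = (\<Sum>a\<in>Poly_Mapping.keys f. \<Sum>b\<in>Poly_Mapping.keys g.
    bprod a b (Poly_Mapping.lookup f a * Poly_Mapping.lookup g b))"
  by (simp add: basis_algebra_def bprod_def)

text \<open>The product is defined by sums over supports, which can shrink when terms cancel.
  Summing over larger fixed sets makes bilinearity a termwise statement.\<close>

lemma mult_superset:
  assumes "finite S" "Poly_Mapping.keys f \<subseteq> S" "finite T" "Poly_Mapping.keys g \<subseteq> T"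
  shows "f \<otimes>\<^bsub>F\<^esub> g = (\<Sum>a\<in>S. \<Sum>b\<in>T. bprod a b (Poly_Mapping.lookup f a * Poly_Mapping.lookup g b))"
proof -
  have "f \<otimes>\<^bsub>F\<^esub> g = (\<Sum>a\<in>Poly_Mapping.keys f. \<Sum>b\<in>T.
      bprod a b (Poly_Mapping.lookup f a * Poly_Mapping.lookup g b))"
    unfolding mult_eq using assms
    by (intro sum.cong refl sum.mono_neutral_left) (auto simp: in_keys_iff)
  also have "\<dots> = (\<Sum>a\<in>S. \<Sum>b\<in>T. bprod a b (Poly_Mapping.lookup f a * Poly_Mapping.lookup g b))"
    using assms by (intro sum.mono_neutral_left) (auto simp: in_keys_iff)
  finally show ?thesis .
qed

lemma mult_add_left: "(f + g) \<otimes>\<^bsub>F\<^esub> h = f \<otimes>\<^bsub>F\<^esub> h + g \<otimes>\<^bsub>F\<^esub> h"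
proof -
  let ?S = "Poly_Mapping.keys f \<union> Poly_Mapping.keys g"
  have "Poly_Mapping.keys (f + g) \<subseteq> ?S" by (rule Poly_Mapping.keys_add)
  then show ?thesis
    by (simp add: mult_superset[where S = ?S and T = "Poly_Mapping.keys h"]
        lookup_add distrib_right bprod_add sum.distrib)
qed

lemma mult_add_right: "h \<otimes>\<^bsub>F\<^esub> (f + g) = h \<otimes>\<^bsub>F\<^esub> f + h \<otimes>\<^bsub>F\<^esub> g"
proof -
  let ?S = "Poly_Mapping.keys f \<union> Poly_Mapping.keys g"
  have "Poly_Mapping.keys (f + g) \<subseteq> ?S" by (rule Poly_Mapping.keys_add)
  then show ?thesis
    by (simp add: mult_superset[where T = ?S and S = "Poly_Mapping.keys h"]
        lookup_add distrib_left bprod_add sum.distrib)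
qed

lemma mult_zero [simp]: "0 \<otimes>\<^bsub>F\<^esub> f = 0" "f \<otimes>\<^bsub>F\<^esub> 0 = 0"
  by (simp_all add: mult_eq)

lemma mult_single: "Poly_Mapping.single a x \<otimes>\<^bsub>F\<^esub> Poly_Mapping.single b y = bprod a b (x * y)"
  by (subst mult_superset[where S = "{a}" and T = "{b}"]) auto

lemma keys_bprod: "a \<in> B \<Longrightarrow> b \<in> B \<Longrightarrow> Poly_Mapping.keys (bprod a b x) \<subseteq> B"
  using pr_closed[of a b] by (cases "pr a b") (auto simp: bprod_def)

lemma mult_keys:
  assumes "Poly_Mapping.keys f \<subseteq> B" "Poly_Mapping.keys g \<subseteq> B"
  shows "Poly_Mapping.keys (f \<otimes>\<^bsub>F\<^esub> g) \<subseteq> B"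
  using assms(1)
proof (induction f rule: poly_mapping_keys_induct)
  case (single a x)
  show ?case using assms(2)
  proof (induction g rule: poly_mapping_keys_induct)
    case (single b y)
    then show ?case using \<open>a \<in> B\<close> keys_bprod by (simp add: mult_single)
  next
    case (add f g)
    then show ?case unfolding mult_add_right
      by (intro order.trans[OF Poly_Mapping.keys_add] Un_least)
  qed simp
next
  case (add f g)
  then show ?case unfolding mult_add_left
      by (intro order.trans[OF Poly_Mapping.keys_add] Un_least)
qed simp

lemma mult_assoc_single:
  assumes "a \<in> B" "b \<in> B" "c \<in> B"
  shows "(Poly_Mapping.single a x \<otimes>\<^bsub>F\<^esub> Poly_Mapping.single b y) \<otimes>\<^bsub>F\<^esub> Poly_Mapping.single c z
    = Poly_Mapping.single a x \<otimes>\<^bsub>F\<^esub> (Poly_Mapping.single b y \<otimes>\<^bsub>F\<^esub> Poly_Mapping.single c z)"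
  using pr_assoc[OF assms]
  by (cases "pr a b"; cases "pr b c")
    (auto simp: mult_single mult.assoc, auto simp: bprod_def mult_single mult.assoc)

lemma mult_assoc:
  assumes "Poly_Mapping.keys f \<subseteq> B" "Poly_Mapping.keys g \<subseteq> B" "Poly_Mapping.keys h \<subseteq> B"
  shows "(f \<otimes>\<^bsub>F\<^esub> g) \<otimes>\<^bsub>F\<^esub> h = f \<otimes>\<^bsub>F\<^esub> (g \<otimes>\<^bsub>F\<^esub> h)"
  using assms(1)
proof (induction f rule: poly_mapping_keys_induct)
  case (single a x)
  show ?case using assms(2)
  proof (induction g rule: poly_mapping_keys_induct)
    case (single b y)
    show ?case using assms(3)
    proof (induction h rule: poly_mapping_keys_induct)
      case (single c z)
      show ?case using mult_assoc_single \<open>a \<in> B\<close> \<open>b \<in> B\<close> \<open>c \<in> B\<close> by blast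
    qed (simp_all add: mult_add_right)
  qed (simp_all add: mult_add_left mult_add_right)
qed (simp_all add: mult_add_left)

lemma sum_mult_left: "finite S \<Longrightarrow> (\<Sum>i\<in>S. f i) \<otimes>\<^bsub>F\<^esub> g = (\<Sum>i\<in>S. f i \<otimes>\<^bsub>F\<^esub> g)"
  by (induction S rule: finite_induct) (simp_all add: mult_add_left)

lemma sum_mult_right: "finite S \<Longrightarrow> g \<otimes>\<^bsub>F\<^esub> (\<Sum>i\<in>S. f i) = (\<Sum>i\<in>S. g \<otimes>\<^bsub>F\<^esub> f i)"
  by (induction S rule: finite_induct) (simp_all add: mult_add_right)

lemma one_mult: "Poly_Mapping.keys f \<subseteq> B \<Longrightarrow> \<one>\<^bsub>F\<^esub> \<otimes>\<^bsub>F\<^esub> f = f"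
proof (induction f rule: poly_mapping_keys_induct)
  case (single a x)
  obtain e where e: "e \<in> E" "\<forall>e'\<in>E. pr e' a = (if e' = e then Some a else None)"
    using left_unit[OF single] by blast
  have "\<one>\<^bsub>F\<^esub> \<otimes>\<^bsub>F\<^esub> Poly_Mapping.single a x = (\<Sum>e'\<in>E. bprod e' a x)"
    using finite_units by (simp add: sum_mult_left mult_single)
  also have "\<dots> = (\<Sum>e'\<in>E. if e' = e then Poly_Mapping.single a x else 0)"
    using e by (intro sum.cong refl) (simp add: bprod_def)
  also have "\<dots> = Poly_Mapping.single a x" using e(1) finite_units by simp
  finally show ?case .
qed (simp_all add: mult_add_right)

lemma mult_one: "Poly_Mapping.keys f \<subseteq> B \<Longrightarrow> f \<otimes>\<^bsub>F\<^esub> \<one>\<^bsub>F\<^esub> = f"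
proof (induction f rule: poly_mapping_keys_induct)
  case (single a x)
  obtain e where e: "e \<in> E" "\<forall>e'\<in>E. pr a e' = (if e' = e then Some a else None)"
    using right_unit[OF single] by blast
  have "Poly_Mapping.single a x \<otimes>\<^bsub>F\<^esub> \<one>\<^bsub>F\<^esub> = (\<Sum>e'\<in>E. bprod a e' x)"
    using finite_units by (simp add: sum_mult_right mult_single)
  also have "\<dots> = (\<Sum>e'\<in>E. if e' = e then Poly_Mapping.single a x else 0)"
    using e by (intro sum.cong refl) (simp add: bprod_def)
  also have "\<dots> = Poly_Mapping.single a x" using e(1) finite_units by simp
  finally show ?case .
qed (simp_all add: mult_add_left)

lemma keys_one: "Poly_Mapping.keys \<one>\<^bsub>F\<^esub> \<subseteq> B"
proof -
  have "Poly_Mapping.keys (\<Sum>e\<in>S. Poly_Mapping.single e (1 :: complex)) \<subseteq> S" if "finite S" for S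
    using that
  proof (induction S rule: finite_induct)
    case (insert a S)
    then show ?case
      using Poly_Mapping.keys_add[of "Poly_Mapping.single a 1" "\<Sum>e\<in>S. Poly_Mapping.single e (1 :: complex)"]
      by auto
  qed simp
  from this[OF finite_units] show ?thesis using units_sub by simp
qed

lemma ring_F: "ring F"
proof (rule ringI)
  show "abelian_group F"
  proof (rule abelian_groupI)
    fix f assume "f \<in> carrier F"
    then show "\<exists>g\<in>carrier F. g \<oplus>\<^bsub>F\<^esub> f = \<zero>\<^bsub>F\<^esub>" by (intro bexI[of _ "- f"]) auto
  next
    fix f g assume "f \<in> carrier F" "g \<in> carrier F"
    then show "f \<oplus>\<^bsub>F\<^esub> g \<in> carrier F" using Poly_Mapping.keys_add[of f g] by auto
  qed (auto simp: add_ac)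
  show "Group.monoid F"
    using mult_keys mult_assoc keys_one one_mult mult_one by (intro monoidI) auto
qed (use mult_add_left mult_add_right in auto)

lemma smult_single [simp]:
  "Poly_Mapping.map (\<lambda>y. c * y) (Poly_Mapping.single a x) = Poly_Mapping.single a (c * x :: complex)"
  by (rule poly_mapping_eqI) (simp add: lookup_single when_def)

lemma smult_add: "Poly_Mapping.map (\<lambda>y. c * y) (f + g)
    = Poly_Mapping.map (\<lambda>y. c * y) f + Poly_Mapping.map (\<lambda>y. c * y) (g :: 'b \<Rightarrow>\<^sub>0 complex)"
  by (rule poly_mapping_eqI) (simp add: lookup_add distrib_left)

lemma smult_zero [simp]: "Poly_Mapping.map (\<lambda>y. c * y) 0 = (0 :: 'b \<Rightarrow>\<^sub>0 complex)"
  by (rule poly_mapping_eqI) simp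

lemma smult_bprod [simp]: "Poly_Mapping.map (\<lambda>y. c * y) (bprod a b x) = bprod a b (c * x)"
  by (simp add: bprod_def split: option.split)

lemma smult_mult_left: "Poly_Mapping.keys f \<subseteq> B \<Longrightarrow> Poly_Mapping.keys g \<subseteq> B \<Longrightarrow>
    Poly_Mapping.map (\<lambda>y. c * y) (f \<otimes>\<^bsub>F\<^esub> g) = Poly_Mapping.map (\<lambda>y. c * y) f \<otimes>\<^bsub>F\<^esub> g"
proof (induction f rule: poly_mapping_keys_induct)
  case (single a x)
  show ?case using single(2)
    by (induction g rule: poly_mapping_keys_induct)
      (simp_all add: mult_add_right smult_add mult_single mult.assoc)
qed (simp_all add: mult_add_left smult_add)

lemma smult_mult_right: "Poly_Mapping.keys f \<subseteq> B \<Longrightarrow> Poly_Mapping.keys g \<subseteq> B \<Longrightarrow>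
    Poly_Mapping.map (\<lambda>y. c * y) (f \<otimes>\<^bsub>F\<^esub> g) = f \<otimes>\<^bsub>F\<^esub> Poly_Mapping.map (\<lambda>y. c * y) g"
proof (induction f rule: poly_mapping_keys_induct)
  case (single a x)
  show ?case using single(2)
    by (induction g rule: poly_mapping_keys_induct)
      (simp_all add: mult_add_right smult_add mult_single mult.left_commute)
qed (simp_all add: mult_add_left smult_add)

lemma keys_smult_B: "Poly_Mapping.keys f \<subseteq> B \<Longrightarrow>
    Poly_Mapping.keys (Poly_Mapping.map (\<lambda>y. c * y) (f :: 'b \<Rightarrow>\<^sub>0 complex)) \<subseteq> B"
  using keys_smult by (rule order.trans)

lemma keys_add_B: "Poly_Mapping.keys f \<subseteq> B \<Longrightarrow> Poly_Mapping.keys g \<subseteq> B \<Longrightarrow>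
    Poly_Mapping.keys (f + (g :: 'b \<Rightarrow>\<^sub>0 complex)) \<subseteq> B"
  by (rule order.trans[OF Poly_Mapping.keys_add Un_least])

text \<open>An ideal of the ring absorbs ring elements, and \<open>c f\<close> is the product of
  \<open>c 1\<close> with \<open>f\<close>.\<close>

lemma ideal_smult:
  assumes I: "ideal I F" and f: "f \<in> I"
  shows "Poly_Mapping.map (\<lambda>y. c * y) f \<in> I"
proof -
  interpret ideal I F by fact
  have fc: "Poly_Mapping.keys f \<subseteq> B" using a_Hcarr[OF f] by simp
  have k: "Poly_Mapping.keys (Poly_Mapping.map (\<lambda>y. c * y) \<one>\<^bsub>F\<^esub>) \<subseteq> B"
    by (rule order.trans[OF keys_smult keys_one])
  have "Poly_Mapping.map (\<lambda>y. c * y) f = Poly_Mapping.map (\<lambda>y. c * y) (\<one>\<^bsub>F\<^esub> \<otimes>\<^bsub>F\<^esub> f)"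
    by (simp only: one_mult[OF fc])
  also have "\<dots> = Poly_Mapping.map (\<lambda>y. c * y) \<one>\<^bsub>F\<^esub> \<otimes>\<^bsub>F\<^esub> f"
    by (rule smult_mult_left[OF keys_one fc])
  also have "\<dots> \<in> I" using I_l_closed[OF f, of "Poly_Mapping.map (\<lambda>y. c * y) \<one>\<^bsub>F\<^esub>"] k
    by (simp del: F_simps(4))
  finally show ?thesis .
qed

end

text \<open>The product \<open>\<mu>\<close> and the coordinates \<open>k\<close> of the basis elements determine the quotient of the
  free algebra by the ideal generated by \<open>gens\<close>, because every basis element is congruent to the
  combination of the representatives \<open>nf i\<close> prescribed by its coordinates.\<close>

locale presented_alg = basis_alg B E pr deg
  for B E :: "'b set" and pr :: "'b \<Rightarrow> 'b \<Rightarrow> 'b option" and deg :: "int \<Rightarrow> 'b set" +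
  fixes k :: "'b \<Rightarrow> 'i :: finite \<Rightarrow> complex" and \<mu> :: "('i \<Rightarrow> complex) \<Rightarrow> ('i \<Rightarrow> complex) \<Rightarrow> 'i \<Rightarrow> complex"
    and nf :: "'i \<Rightarrow> 'b" and dg :: "'i \<Rightarrow> int" and gens :: "('b \<Rightarrow>\<^sub>0 complex) set"
  assumes mu_add_left: "\<mu> (\<lambda>i. x i + y i) z = (\<lambda>i. \<mu> x z i + \<mu> y z i)"
    and mu_add_right: "\<mu> z (\<lambda>i. x i + y i) = (\<lambda>i. \<mu> z x i + \<mu> z y i)"
    and mu_scale: "\<mu> (\<lambda>i. c * x i) (\<lambda>i. c' * y i) = (\<lambda>i. c * c' * \<mu> x y i)"
    and k_mult: "a \<in> B \<Longrightarrow> b \<in> B \<Longrightarrow> \<mu> (k a) (k b) = (case pr a b of None \<Rightarrow> (\<lambda>_. 0) | Some c \<Rightarrow> k c)"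
    and nf_basis: "nf i \<in> B" and k_nf: "k (nf i) j = (if i = j then 1 else 0)"
    and gens_carrier: "gens \<subseteq> {f. Poly_Mapping.keys f \<subseteq> B}"
    and gens_zero: "f \<in> gens \<Longrightarrow> linear_extension k f = (\<lambda>_. 0)"
    and reduction: "b \<in> B \<Longrightarrow>
      Poly_Mapping.single b 1 - (\<Sum>i\<in>UNIV. Poly_Mapping.single (nf i) (k b i))
        \<in> Idl\<^bsub>basis_algebra B E pr deg\<^esub> gens"
    and nf_deg: "nf i \<in> deg (dg i)" and k_deg: "b \<in> B \<Longrightarrow> b \<in> deg d \<Longrightarrow> k b i \<noteq> 0 \<Longrightarrow> dg i = d"
begin

abbreviation "\<kappa> \<equiv> linear_extension k"

abbreviation "J \<equiv> Idl\<^bsub>F\<^esub> gens"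

definition "A = graded_quotient F J"

lemma mu_zero: "\<mu> (\<lambda>_. 0) z = (\<lambda>_. 0)" "\<mu> z (\<lambda>_. 0) = (\<lambda>_. 0)"
  using mu_scale[of 0 "\<lambda>_. 0" 1 z] mu_scale[of 1 z 0 "\<lambda>_. 0"] by simp_all

section \<open>The ideal as the kernel of the coordinate map\<close>

lemma kappa_mult: "Poly_Mapping.keys f \<subseteq> B \<Longrightarrow> Poly_Mapping.keys g \<subseteq> B \<Longrightarrow>
    \<kappa> (f \<otimes>\<^bsub>F\<^esub> g) = \<mu> (\<kappa> f) (\<kappa> g)"
proof (induction f rule: poly_mapping_keys_induct)
  case (single a x)
  show ?case using single(2)
  proof (induction g rule: poly_mapping_keys_induct)
    case (single b y)
    then show ?case using k_mult[OF \<open>a \<in> B\<close> \<open>b \<in> B\<close>]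
        mu_scale[of x "k a" y "k b"]
      by (auto simp: mult_single bprod_def split: option.splits)
  qed (simp_all add: mult_add_right linear_extension_add mu_add_right mu_zero)
qed (simp_all add: mult_add_left linear_extension_add mu_add_left mu_zero)

lemma ideal_J: "ideal J F"
  using ring.genideal_ideal[OF ring_F] gens_carrier by simp

lemma kernel_ideal: "ideal {f \<in> carrier F. \<kappa> f = (\<lambda>_. 0)} F"
proof (rule idealI[OF ring_F])
  interpret F: ring F by (rule ring_F)
  show "subgroup {f \<in> carrier F. \<kappa> f = (\<lambda>_. 0)} (add_monoid F)"
  proof (rule F.add.subgroupI)
    fix f assume f: "f \<in> {f \<in> carrier F. \<kappa> f = (\<lambda>_. 0)}"
    then have "\<ominus>\<^bsub>F\<^esub> f = - f" by (intro F.minus_equality) auto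
    then show "\<ominus>\<^bsub>F\<^esub> f \<in> {f \<in> carrier F. \<kappa> f = (\<lambda>_. 0)}" using f by (simp add: linear_extension_uminus)
  next
    fix f g assume "f \<in> {f \<in> carrier F. \<kappa> f = (\<lambda>_. 0)}" "g \<in> {f \<in> carrier F. \<kappa> f = (\<lambda>_. 0)}"
    then show "f \<oplus>\<^bsub>F\<^esub> g \<in> {f \<in> carrier F. \<kappa> f = (\<lambda>_. 0)}"
      using Poly_Mapping.keys_add[of f g] by (auto simp: linear_extension_add)
  qed (auto intro: exI[of _ 0])
qed (use mult_keys in \<open>auto simp: kappa_mult mu_zero\<close>)

lemma normal_form:
  assumes "Poly_Mapping.keys f \<subseteq> B"
  shows "f - (\<Sum>i\<in>UNIV. Poly_Mapping.single (nf i) (\<kappa> f i)) \<in> J"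
  using assms
proof (induction f rule: poly_mapping_keys_induct)
  interpret J: ideal J F by (rule ideal_J)
  {
    case (single b c)
    have "Poly_Mapping.map (\<lambda>y. c * y)
        (Poly_Mapping.single b 1 - (\<Sum>i\<in>UNIV. Poly_Mapping.single (nf i) (k b i))) \<in> J"
      by (rule ideal_smult[OF ideal_J reduction[OF single]])
    moreover have "Poly_Mapping.map (\<lambda>y. c * y)
        (Poly_Mapping.single b 1 - (\<Sum>i\<in>UNIV. Poly_Mapping.single (nf i) (k b i)))
        = Poly_Mapping.single b c - (\<Sum>i\<in>UNIV. Poly_Mapping.single (nf i) (c * k b i))"
      by (rule poly_mapping_eqI)
        (simp add: lookup_minus lookup_sum lookup_single when_def right_diff_distrib
          sum_distrib_left if_distrib cong: if_cong)
    ultimately show ?case by simp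
  next
    case (add f g)
    then have "f - (\<Sum>i\<in>UNIV. Poly_Mapping.single (nf i) (\<kappa> f i))
        + (g - (\<Sum>i\<in>UNIV. Poly_Mapping.single (nf i) (\<kappa> g i))) \<in> J"
      using additive_subgroup.a_closed[OF ideal.axioms(1)[OF ideal_J]] by (simp only: F_simps)
    then show ?case
      by (simp add: linear_extension_add single_add sum.distrib algebra_simps)
  next
    case zero
    show ?case using additive_subgroup.zero_closed[OF ideal.axioms(1)[OF ideal_J]] by simp
  }
qed

text \<open>The generators vanish under \<open>\<kappa>\<close>, whose kernel is an ideal; this is
  one inclusion. For the other, \<open>normal_form\<close> makes an element congruent to the
  representative built from its coordinates, which is zero if these vanish.\<close>

lemma J_eq: "J = {f \<in> carrier F. \<kappa> f = (\<lambda>_. 0)}"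
proof
  show "J \<subseteq> {f \<in> carrier F. \<kappa> f = (\<lambda>_. 0)}"
    using gens_carrier gens_zero
    by (intro ring.genideal_minimal[OF ring_F kernel_ideal]) auto
  show "{f \<in> carrier F. \<kappa> f = (\<lambda>_. 0)} \<subseteq> J"
    using normal_form by fastforce
qed

lemma coset_eq:
  assumes "Poly_Mapping.keys f \<subseteq> B"
  shows "J +>\<^bsub>F\<^esub> f = {g. Poly_Mapping.keys g \<subseteq> B \<and> \<kappa> g = \<kappa> f}"
proof (intro equalityI subsetI)
  fix g assume "g \<in> J +>\<^bsub>F\<^esub> f"
  then obtain h where "h \<in> J" "g = h + f" by (auto simp: a_r_coset_def')
  then show "g \<in> {g. Poly_Mapping.keys g \<subseteq> B \<and> \<kappa> g = \<kappa> f}"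
    using assms Poly_Mapping.keys_add[of h f] by (auto simp: J_eq linear_extension_add)
next
  fix g assume g: "g \<in> {g. Poly_Mapping.keys g \<subseteq> B \<and> \<kappa> g = \<kappa> f}"
  then have "g - f \<in> J"
    using assms Poly_Mapping.keys_diff[of g f] by (auto simp: J_eq linear_extension_diff)
  then show "g \<in> J +>\<^bsub>F\<^esub> f" by (auto simp: a_r_coset_def' intro!: bexI[of _ "g - f"])
qed

abbreviation cls where "cls f \<equiv> J +>\<^bsub>F\<^esub> f"

section \<open>The quotient algebra in coordinates\<close>

lemma A_simps:
  "carrier A = carrier (F Quot J)" "mult A = mult (F Quot J)" "one A = one (F Quot J)"
  "zero A = zero (F Quot J)" "add A = add (F Quot J)"
  "smult A = (\<lambda>r S. \<Union>x\<in>S. J +>\<^bsub>F\<^esub> (r \<odot>\<^bsub>F\<^esub> x))"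
  "part A = (\<lambda>d. cls ` part F d)"
  by (simp_all add: A_def graded_quotient_def quotient_def module.extend_def graded_module.fields_def)

lemma A_carrier: "carrier A = cls ` {f. Poly_Mapping.keys f \<subseteq> B}"
  by (auto simp: A_simps FactRing_def A_RCOSETS_def')

lemma A_carrierI: "Poly_Mapping.keys f \<subseteq> B \<Longrightarrow> cls f \<in> carrier A"
  by (auto simp: A_carrier)

lemma ring_A: "ring A"
proof -
  interpret Q: ring "F Quot J" by (rule ideal.quotient_is_ring[OF ideal_J])
  show ?thesis
  proof (rule ringI)
    show "abelian_group A"
    proof (rule abelian_groupI)
      show "\<exists>T\<in>carrier A. T \<oplus>\<^bsub>A\<^esub> S = \<zero>\<^bsub>A\<^esub>" if "S \<in> carrier A" for S
        using that Q.l_neg[of S] Q.a_inv_closed[of S] unfolding A_simps by blast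
    qed (auto simp: A_simps Q.a_ac)
    show "Group.monoid A"
      using Q.m_assoc by (intro monoidI) (auto simp: A_simps)
  qed (auto simp: A_simps Q.l_distr Q.r_distr)
qed

text \<open>By \<open>coset_eq\<close> the map \<open>\<kappa>\<close> is constant on cosets, so the
  chosen member is immaterial.\<close>

definition "coord S = \<kappa> (SOME f. f \<in> S)"

lemma coord_cls [simp]: "Poly_Mapping.keys f \<subseteq> B \<Longrightarrow> coord (cls f) = \<kappa> f"
proof -
  assume f: "Poly_Mapping.keys f \<subseteq> B"
  have "(SOME g. g \<in> cls f) \<in> cls f"
    using f by (intro someI[of "\<lambda>g. g \<in> cls f" f]) (simp add: coset_eq)
  then show ?thesis using f by (simp add: coord_def coset_eq)
qed

lemma cls_cases:
  assumes "S \<in> carrier A"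
  obtains f where "Poly_Mapping.keys f \<subseteq> B" "S = cls f"
  using assms by (auto simp: A_carrier)

lemma cls_eq_iff:
  assumes "Poly_Mapping.keys f \<subseteq> B" "Poly_Mapping.keys g \<subseteq> B"
  shows "cls f = cls g \<longleftrightarrow> \<kappa> f = \<kappa> g"
proof
  assume "cls f = cls g"
  then have "coord (cls f) = coord (cls g)" by (rule arg_cong)
  then show "\<kappa> f = \<kappa> g" using assms by simp
qed (use assms in \<open>simp add: coset_eq\<close>)

lemma coord_inject: "S \<in> carrier A \<Longrightarrow> T \<in> carrier A \<Longrightarrow> coord S = coord T \<Longrightarrow> S = T"
  by (elim cls_cases) (simp add: cls_eq_iff)

definition "rep x = (\<Sum>i\<in>UNIV. Poly_Mapping.single (nf i) (x i))"

lemma keys_rep: "Poly_Mapping.keys (rep x) \<subseteq> nf ` {i. x i \<noteq> 0}"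
proof -
  have "Poly_Mapping.keys (rep x) \<subseteq> (\<Union>i. Poly_Mapping.keys (Poly_Mapping.single (nf i) (x i)))"
    unfolding rep_def by (rule Poly_Mapping.keys_sum)
  also have "\<dots> \<subseteq> nf ` {i. x i \<noteq> 0}" by auto
  finally show ?thesis .
qed

lemma keys_rep_B: "Poly_Mapping.keys (rep x) \<subseteq> B"
  using keys_rep nf_basis by blast

lemma kappa_rep: "\<kappa> (rep x) = x"
  by (simp add: rep_def linear_extension_sum k_nf fun_eq_iff if_distrib cong: if_cong)

definition "of_coord x = cls (rep x)"

lemma of_coord_carrier [simp]: "of_coord x \<in> carrier A"
  unfolding of_coord_def by (rule A_carrierI[OF keys_rep_B])

lemma coord_of_coord [simp]: "coord (of_coord x) = x"
  by (simp add: of_coord_def keys_rep_B kappa_rep)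

lemma of_coord_coord: "S \<in> carrier A \<Longrightarrow> of_coord (coord S) = S"
  by (rule coord_inject) auto

lemma cls_add: "Poly_Mapping.keys f \<subseteq> B \<Longrightarrow> Poly_Mapping.keys g \<subseteq> B \<Longrightarrow> cls f \<oplus>\<^bsub>A\<^esub> cls g = cls (f + g)"
  using ring_hom_add[OF ideal.rcos_ring_hom[OF ideal_J], of f g] by (simp add: A_simps)

lemma cls_mult: "Poly_Mapping.keys f \<subseteq> B \<Longrightarrow> Poly_Mapping.keys g \<subseteq> B \<Longrightarrow>
    cls f \<otimes>\<^bsub>A\<^esub> cls g = cls (f \<otimes>\<^bsub>F\<^esub> g)"
  using ring_hom_mult[OF ideal.rcos_ring_hom[OF ideal_J], of f g] by (simp add: A_simps)

text \<open>The scalar multiplication of \<open>quotient\<close> is a union over representatives;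
  they all give the same coset, so the union collapses.\<close>

lemma cls_smult:
  assumes "Poly_Mapping.keys f \<subseteq> B"
  shows "c \<odot>\<^bsub>A\<^esub> cls f = cls (Poly_Mapping.map (\<lambda>y. c * y) f)"
proof -
  have kc: "Poly_Mapping.keys (Poly_Mapping.map (\<lambda>y. c * y) g) \<subseteq> B" if "Poly_Mapping.keys g \<subseteq> B" for g
    by (rule keys_smult_B[OF that])
  have "c \<odot>\<^bsub>A\<^esub> cls f = (\<Union>g\<in>cls f. cls (Poly_Mapping.map (\<lambda>y. c * y) g))"
    by (simp add: A_simps)
  also have "\<dots> = (\<Union>g\<in>cls f. cls (Poly_Mapping.map (\<lambda>y. c * y) f))"
    using assms kc by (intro SUP_cong refl) (auto simp: coset_eq linear_extension_smult)
  also have "\<dots> = cls (Poly_Mapping.map (\<lambda>y. c * y) f)"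
    using assms by (auto simp: coset_eq)
  finally show ?thesis .
qed

lemma cls_zero: "\<zero>\<^bsub>A\<^esub> = cls 0"
  by (auto simp: A_simps FactRing_def coset_eq) (auto simp: J_eq)

lemma cls_one: "\<one>\<^bsub>A\<^esub> = cls \<one>\<^bsub>F\<^esub>"
  by (simp add: A_simps FactRing_def)

lemma coord_add [simp]: "S \<in> carrier A \<Longrightarrow> T \<in> carrier A \<Longrightarrow>
    coord (S \<oplus>\<^bsub>A\<^esub> T) = (\<lambda>i. coord S i + coord T i)"
  by (elim cls_cases) (simp add: cls_add keys_add_B linear_extension_add)

lemma coord_mult [simp]: "S \<in> carrier A \<Longrightarrow> T \<in> carrier A \<Longrightarrow>
    coord (S \<otimes>\<^bsub>A\<^esub> T) = \<mu> (coord S) (coord T)"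
  by (elim cls_cases) (simp add: cls_mult mult_keys kappa_mult)

lemma coord_smult [simp]: "S \<in> carrier A \<Longrightarrow> coord (c \<odot>\<^bsub>A\<^esub> S) = (\<lambda>i. c * coord S i)"
  by (elim cls_cases) (simp add: cls_smult keys_smult_B linear_extension_smult)

lemma smult_closed [simp]: "S \<in> carrier A \<Longrightarrow> c \<odot>\<^bsub>A\<^esub> S \<in> carrier A"
  by (elim cls_cases) (simp add: cls_smult keys_smult_B A_carrierI)

lemma coord_zero [simp]: "coord \<zero>\<^bsub>A\<^esub> = (\<lambda>_. 0)"
  by (simp add: cls_zero)

lemma coord_one: "coord \<one>\<^bsub>A\<^esub> = (\<lambda>i. \<Sum>e\<in>E. k e i)"
  using keys_one finite_units by (simp add: cls_one linear_extension_sum del: F_simps(4)) (simp add: linear_extension_sum)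

text \<open>A homogeneous representative has coordinates in its own degree only, by
  \<open>k_deg\<close>. Conversely, if all nonzero coordinates of \<open>S\<close> have degree
  \<open>d\<close>, then the standard representative \<open>rep (coord S)\<close> is homogeneous by
  \<open>nf_deg\<close>.\<close>

lemma part_A: "part A d = {S \<in> carrier A. \<forall>i. coord S i \<noteq> 0 \<longrightarrow> dg i = d}"
proof (intro equalityI subsetI)
  fix S assume "S \<in> part A d"
  then obtain f where f: "Poly_Mapping.keys f \<subseteq> B \<inter> deg d" "S = cls f" by (auto simp: A_simps)
  have "dg i = d" if nz: "\<kappa> f i \<noteq> 0" for i
  proof -
    obtain b where b: "b \<in> Poly_Mapping.keys f" "k b i \<noteq> 0"
      using sum.not_neutral_contains_not_neutral[OF nz[unfolded linear_extension_def]] by auto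
    then show ?thesis using subsetD[OF f(1) b(1)] k_deg[of b d i] by simp
  qed
  moreover have "Poly_Mapping.keys f \<subseteq> B" using f(1) by simp
  ultimately show "S \<in> {S \<in> carrier A. \<forall>i. coord S i \<noteq> 0 \<longrightarrow> dg i = d}"
    using f(2) A_carrierI[of f] by simp
next
  fix S assume S: "S \<in> {S \<in> carrier A. \<forall>i. coord S i \<noteq> 0 \<longrightarrow> dg i = d}"
  have "Poly_Mapping.keys (rep (coord S)) \<subseteq> B \<inter> deg d"
  proof
    fix b assume "b \<in> Poly_Mapping.keys (rep (coord S))"
    then obtain i where i: "b = nf i" "coord S i \<noteq> 0" using keys_rep[of "coord S"] by auto
    then have "dg i = d" using S by simp
    then show "b \<in> B \<inter> deg d" using i(1) nf_basis[of i] nf_deg[of i] by simp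
  qed
  then have "of_coord (coord S) \<in> part A d" by (auto simp: A_simps of_coord_def)
  then show "S \<in> part A d" using of_coord_coord S by simp
qed

end


section \<open>The algebra of the graph\<close>

text \<open>Vertices and arrows are indexed by the type \<open>3\<close> of residues modulo 3; an index
  \<open>(s, i)\<close> of type \<open>bool \<times> 3\<close> stands for the path that starts at vertex \<open>i\<close> and has
  length 1 if \<open>s\<close> holds and length 0 otherwise.\<close>

lemma cases_3: "i = 0 \<or> i = 1 \<or> i = (2 :: 3)"
proof (cases i rule: bit1_cases)
  case (of_int z)
  then have "z = 0 \<or> z = 1 \<or> z = 2" by auto
  then show ?thesis using of_int by auto
qed

lemma UNIV_3: "(UNIV :: 3 set) = {0, 1, 2}"
  using cases_3 by auto

lemma sum_3: "sum f (UNIV :: 3 set) = f 0 + f 1 + f 2"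
  unfolding UNIV_3 by (simp add: add.assoc)

text \<open>The numbering follows the orientation: the arrows run from (0,0) to (1,0), from (1,0) to
  (0,1) and from (0,1) to (0,0), so every arrow raises the index by 1 modulo 3.\<close>

definition vtx :: "3 \<Rightarrow> int \<times> int" where
  "vtx i = (if i = 0 then (0, 0) else if i = 1 then (1, 0) else (0, 1))"

definition arc :: "3 \<Rightarrow> (int \<times> int) \<times> (int \<times> int)" where
  "arc i = (vtx i, vtx (i + 1))"

lemma vtx_eq [simp]: "vtx i = vtx j \<longleftrightarrow> i = j"
  using cases_3[of i] cases_3[of j] by (auto simp: vtx_def)

lemma arc_eq [simp]: "arc i = arc j \<longleftrightarrow> i = j"
  by (auto simp: arc_def)

lemma verts_graph_A: "verts (graph_A 4) = range vtx"
proof -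
  have "verts (graph_A 4) = {(0, 0), (1, 0), (0, 1)}"
    by (auto simp: graph_A_def Let_def)
  also have "\<dots> = range vtx" unfolding UNIV_3 by (auto simp: vtx_def)
  finally show ?thesis .
qed

lemma arcs_graph_A: "arcs (graph_A 4) = range arc"
proof -
  have "arcs (graph_A 4) = {((0, 0), (1, 0)), ((1, 0), (0, 1)), ((0, 1), (0, 0))}"
    by (auto simp: graph_A_def Let_def)
  also have "\<dots> = range arc" unfolding UNIV_3 by (simp add: arc_def vtx_def)
  finally show ?thesis .
qed

lemma graph_A_ends [simp]: "tail (graph_A n) = fst" "head (graph_A n) = snd"
  by (simp_all add: graph_A_def Let_def)

lemma arcs_from_to_graph_A:
  "arcs_from_to (graph_A 4) (vtx i) (vtx j) = (if j = i + 1 then {arc i} else {})"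
  by (auto simp: arcs_from_to_def arcs_graph_A arc_def)

primrec walk :: "3 \<Rightarrow> nat \<Rightarrow> ((int \<times> int) \<times> (int \<times> int)) list" where
  "walk i 0 = []"
| "walk i (Suc l) = arc i # walk (i + 1) l"

lemma length_walk [simp]: "length (walk i l) = l"
  by (induction l arbitrary: i) simp_all

lemma walk_append: "walk i l @ walk (i + of_nat l) m = walk i (l + m)"
proof (induction l arbitrary: i)
  case (Suc l)
  then show ?case using Suc.IH[of "i + 1"] by (simp add: add.assoc)
qed simp

lemma last_walk_verts [simp]:
  "last (pre_digraph.awalk_verts (graph_A 4) (vtx i) (walk i l)) = vtx (i + of_nat l)"
proof (induction l arbitrary: i)
  case 0
  show ?case by (simp add: pre_digraph.awalk_verts.simps)
next
  case (Suc l)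
  then show ?case
    by (simp add: pre_digraph.awalk_verts.simps pre_digraph.awalk_verts_non_Nil arc_def add.assoc)
qed

text \<open>Exactly one arrow leaves each vertex, so a path is determined by its start and its
  length.\<close>

lemma paths_graph_A: "paths (graph_A 4) = {(vtx i, walk i l) | i l. True}"
proof (intro equalityI subsetI)
  have cas: "\<exists>l. p = walk i l" if "pre_digraph.cas (graph_A 4) (vtx i) p v" "set p \<subseteq> range arc" for i p v
    using that
  proof (induction p arbitrary: i)
    case Nil
    then show ?case by (intro exI[of _ 0]) simp
  next
    case (Cons a p)
    then have a: "a = arc i" by (auto simp: pre_digraph.cas.simps arc_def)
    then obtain l where "p = walk (i + 1) l"
      using Cons by (auto simp: pre_digraph.cas.simps arc_def)
    then show ?case using a by (intro exI[of _ "Suc l"]) simp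
  qed
  fix x assume "x \<in> paths (graph_A 4)"
  then show "x \<in> {(vtx i, walk i l) | i l. True}"
    using cas by (fastforce simp: paths_def pre_digraph.awalk_def verts_graph_A arcs_graph_A)
next
  fix x assume "x \<in> {(vtx i, walk i l) | i l. True}"
  then obtain i l where x: "x = (vtx i, walk i l)" by blast
  have "set (walk i l) \<subseteq> range arc" for i l by (induction l arbitrary: i) auto
  moreover have "pre_digraph.cas (graph_A 4) (vtx i) (walk i l) (vtx (i + of_nat l))" for i l
  proof (induction l arbitrary: i)
    case (Suc l)
    then show ?case using Suc.IH[of "i + 1"] by (simp add: pre_digraph.cas.simps arc_def add.assoc)
  qed (simp add: pre_digraph.cas.simps)
  ultimately have "pre_digraph.awalk (graph_A 4) (vtx i) (walk i l) (vtx (i + of_nat l))"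
    by (simp add: pre_digraph.awalk_def verts_graph_A arcs_graph_A)
  then show "x \<in> paths (graph_A 4)" unfolding x paths_def by blast
qed

lemma walk_path [simp]: "(vtx i, walk i l) \<in> paths (graph_A 4)"
  unfolding paths_graph_A by blast

lemma path_concat_walk: "path_concat (graph_A 4) (vtx i, walk i l) (vtx j, walk j m)
    = (if j = i + of_nat l then Some (vtx i, walk i (l + m)) else None)"
  by (auto simp: path_concat_def walk_append)

text \<open>For paths written as \<open>walk i l\<close>, concatenation adds lengths and requires
  the second start to be \<open>i + of_nat l\<close>, so the axioms become arithmetic of indices.
  The two units of a path are the walks of length 0 at its start and at its end.\<close>

interpretation PA: basis_alg "paths (graph_A 4)" "(\<lambda>v. (v, [])) ` verts (graph_A 4)"
  "path_concat (graph_A 4)" "\<lambda>d. {(u, p). int (length p) = d}"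
proof
  let ?E = "(\<lambda>v. (v, [] :: ((int \<times> int) \<times> (int \<times> int)) list)) ` verts (graph_A 4)"
  have E: "?E = range (\<lambda>i. (vtx i, walk i 0))" by (auto simp: verts_graph_A)
  show "finite ?E" by (simp add: E)
  show "?E \<subseteq> paths (graph_A 4)" unfolding E paths_graph_A by blast
  fix a b assume a: "a \<in> paths (graph_A 4)"
  then obtain i l where [simp]: "a = (vtx i, walk i l)" by (auto simp: paths_graph_A)
  show "\<exists>e\<in>?E. \<forall>e'\<in>?E. path_concat (graph_A 4) e' a = (if e' = e then Some a else None)"
    unfolding E by (intro bexI[of _ "(vtx i, walk i 0)"]) (auto simp del: walk.simps simp: path_concat_walk)
  show "\<exists>e\<in>?E. \<forall>e'\<in>?E. path_concat (graph_A 4) a e' = (if e' = e then Some a else None)"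
    unfolding E by (intro bexI[of _ "(vtx (i + of_nat l), walk (i + of_nat l) 0)"])
      (auto simp del: walk.simps simp: path_concat_walk)
  assume b: "b \<in> paths (graph_A 4)"
  then obtain j m where [simp]: "b = (vtx j, walk j m)" by (auto simp: paths_graph_A)
  show "c \<in> paths (graph_A 4)" if "path_concat (graph_A 4) a b = Some c" for c
    using that by (auto simp: path_concat_walk paths_graph_A split: if_splits)
  show "Option.bind (path_concat (graph_A 4) a b) (\<lambda>x. path_concat (graph_A 4) x c)
      = Option.bind (path_concat (graph_A 4) b c) (path_concat (graph_A 4) a)"
    if c: "c \<in> paths (graph_A 4)" for c
  proof -
    obtain k n where [simp]: "c = (vtx k, walk k n)" using c by (auto simp: paths_graph_A)
    show ?thesis by (auto simp: path_concat_walk add.assoc)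
  qed
qed

text \<open>The pairs of paths of length at most 1 whose product is the given path. Products of
  length 2 vanish in \<open>A\<close>, so the convolution over these pairs is its
  multiplication.\<close>

definition factorizations :: "bool \<times> 3 \<Rightarrow> ((bool \<times> 3) \<times> (bool \<times> 3)) set" where
  "factorizations = (\<lambda>(s, i). if s then {((False, i), (True, i)), ((True, i), (False, i + 1))}
     else {((False, i), (False, i))})"

definition cycle_mult :: "(bool \<times> 3 \<Rightarrow> complex) \<Rightarrow> (bool \<times> 3 \<Rightarrow> complex) \<Rightarrow> bool \<times> 3 \<Rightarrow> complex" where
  "cycle_mult x y p = (\<Sum>(p\<^sub>1, p\<^sub>2)\<in>factorizations p. x p\<^sub>1 * y p\<^sub>2)"

lemma cycle_mult_simps [simp]:
  "cycle_mult x y (False, i) = x (False, i) * y (False, i)"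
  "cycle_mult x y (True, i) = x (False, i) * y (True, i) + x (True, i) * y (False, i + 1)"
  by (simp_all add: cycle_mult_def factorizations_def)

definition cycle_degree :: "bool \<times> 3 \<Rightarrow> int" where
  "cycle_degree p = (if fst p then 1 else 0)"

text \<open>Paths of length at least 2 receive the zero vector, matching their vanishing in
  \<open>A\<close>. Start and length are compared because they determine a path on the
  cycle.\<close>

definition path_coord :: "(int \<times> int, (int \<times> int) \<times> (int \<times> int)) path \<Rightarrow> bool \<times> 3 \<Rightarrow> complex" where
  "path_coord a p = (if fst a = vtx (snd p) \<and> length (snd a) = (if fst p then 1 else 0) then 1 else 0)"

definition path_of :: "bool \<times> 3 \<Rightarrow> (int \<times> int, (int \<times> int) \<times> (int \<times> int)) path" where
  "path_of p = (vtx (snd p), walk (snd p) (if fst p then 1 else 0))"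

text \<open>The three arrows go once around the cycle. An invertible weight only rescales its
  relation, so the ideal does not depend on the values of the weights.\<close>

locale cell_weights =
  fixes W :: "(int \<times> int) \<times> (int \<times> int) \<Rightarrow> (int \<times> int) \<times> (int \<times> int)
    \<Rightarrow> (int \<times> int) \<times> (int \<times> int) \<Rightarrow> complex"
  assumes weights_nonzero: "W (arc i) (arc (i + 1)) (arc (i + 2)) \<noteq> 0"
begin

lemma cell_relation_arc: "cell_relation (graph_A 4) W (arc i) =
    Poly_Mapping.single (vtx (i + 1), walk (i + 1) 2) (W (arc i) (arc (i + 1)) (arc (i + 2)))"
proof -
  have inj: "inj vtx" by (simp add: inj_on_def)
  have "cell_relation (graph_A 4) W (arc i) =
    (\<Sum>k\<in>UNIV. \<Sum>b\<in>arcs_from_to (graph_A 4) (vtx (i + 1)) (vtx k).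
      \<Sum>b'\<in>arcs_from_to (graph_A 4) (vtx k) (vtx i). Poly_Mapping.single (vtx (i + 1), [b, b']) (W (arc i) b b'))"
    unfolding cell_relation_def verts_graph_A by (subst sum.reindex[OF inj]) (simp add: arc_def)
  also have "\<dots> = (\<Sum>k\<in>UNIV. if k = i + 2 then
      Poly_Mapping.single (vtx (i + 1), walk (i + 1) 2) (W (arc i) (arc (i + 1)) (arc (i + 2))) else 0)"
  proof (intro sum.cong refl)
    fix k :: 3
    \<comment> \<open>An arrow from \<open>k\<close> to \<open>i\<close> requires
      \<open>i = k + 1\<close>; as 3 is 0 in the index type, this says
      \<open>k = i + 2\<close>.\<close>
    have "i = k + 1 \<longleftrightarrow> k = i + 2" using cases_3[of i] cases_3[of k] by (elim disjE) simp_all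
    moreover have "i + 1 + 1 = i + 2" by simp
    ultimately show "(\<Sum>b\<in>arcs_from_to (graph_A 4) (vtx (i + 1)) (vtx k).
      \<Sum>b'\<in>arcs_from_to (graph_A 4) (vtx k) (vtx i). Poly_Mapping.single (vtx (i + 1), [b, b']) (W (arc i) b b'))
      = (if k = i + 2 then
      Poly_Mapping.single (vtx (i + 1), walk (i + 1) 2) (W (arc i) (arc (i + 1)) (arc (i + 2))) else 0)"
      by (simp add: arcs_from_to_graph_A numeral_2_eq_2 add.assoc)
  qed
  also have "\<dots> = Poly_Mapping.single (vtx (i + 1), walk (i + 1) 2) (W (arc i) (arc (i + 1)) (arc (i + 2)))"
    by simp
  finally show ?thesis .
qed

abbreviation "relations \<equiv> cell_relation (graph_A 4) W ` arcs (graph_A 4)"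

lemma relations_carrier: "relations \<subseteq> {f. Poly_Mapping.keys f \<subseteq> paths (graph_A 4)}"
  by (auto simp: arcs_graph_A cell_relation_arc paths_graph_A split: if_splits)

text \<open>The relation of the arrow with index \<open>i - 1\<close> is a nonzero multiple of the
  path of length 2 starting at \<open>i\<close>. Multiplying on the right by the remaining
  \<open>l - 2\<close> steps gives the longer paths.\<close>

lemma long_path_in_ideal:
  assumes "l \<ge> 2"
  shows "Poly_Mapping.single (vtx i, walk i l) 1 \<in> Idl\<^bsub>PA.F\<^esub> relations"
proof -
  let ?I = "Idl\<^bsub>PA.F\<^esub> relations"
  have I: "ideal ?I PA.F" using ring.genideal_ideal[OF PA.ring_F] relations_carrier by simp
  let ?w = "W (arc (i - 1)) (arc (i - 1 + 1)) (arc (i - 1 + 2))"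
  have "cell_relation (graph_A 4) W (arc (i - 1)) \<in> ?I"
    using subsetD[OF ring.genideal_self[OF PA.ring_F, of relations]] relations_carrier
    by (simp add: arcs_graph_A)
  then have "Poly_Mapping.single (vtx i, walk i 2) ?w \<in> ?I"
    using cell_relation_arc[of "i - 1"] by simp
  from PA.ideal_smult[OF I this, of "inverse ?w"]
  have two: "Poly_Mapping.single (vtx i, walk i 2) 1 \<in> ?I"
    using weights_nonzero[of "i - 1"] by simp
  have "Poly_Mapping.single (vtx i, walk i 2) 1
      \<otimes>\<^bsub>PA.F\<^esub> Poly_Mapping.single (vtx (i + of_nat 2), walk (i + of_nat 2) (l - 2)) 1 \<in> ?I"
    by (rule ideal.I_r_closed[OF I two]) simp
  then show ?thesis
    unfolding PA.mult_single PA.bprod_def path_concat_walk le_add_diff_inverse[OF assms] by simp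
qed

sublocale presented_alg "paths (graph_A 4)" "(\<lambda>v. (v, [])) ` verts (graph_A 4)"
  "path_concat (graph_A 4)" "\<lambda>d. {(u, p). int (length p) = d}"
  path_coord cycle_mult path_of cycle_degree relations
proof
  show "cycle_mult (\<lambda>i. x i + y i) z = (\<lambda>i. cycle_mult x z i + cycle_mult y z i)" for x y z
    by (auto simp: cycle_mult_def sum.distrib[symmetric] distrib_right intro!: sum.cong)
  show "cycle_mult z (\<lambda>i. x i + y i) = (\<lambda>i. cycle_mult z x i + cycle_mult z y i)" for x y z
    by (auto simp: cycle_mult_def sum.distrib[symmetric] distrib_left intro!: sum.cong)
  show "cycle_mult (\<lambda>i. c * x i) (\<lambda>i. c' * y i) = (\<lambda>i. c * c' * cycle_mult x y i)" for c c' x y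
    by (rule ext) (auto simp: cycle_mult_def sum_distrib_left intro!: sum.cong)
  show "relations \<subseteq> {f. Poly_Mapping.keys f \<subseteq> paths (graph_A 4)}" by (rule relations_carrier)
  show "linear_extension path_coord f = (\<lambda>_. 0)" if "f \<in> relations" for f
    using that by (auto simp: arcs_graph_A cell_relation_arc path_coord_def)
  show "path_of i \<in> paths (graph_A 4)" for i unfolding path_of_def by (rule walk_path)
  show "path_coord (path_of i) j = (if i = j then 1 else 0)" for i j
    by (cases i; cases j) (auto simp: path_of_def path_coord_def)
  show "path_of i \<in> {(u, p). int (length p) = cycle_degree i}" for i
    by (simp add: path_of_def cycle_degree_def)
  show "cycle_degree i = d" if "b \<in> {(u, p). int (length p) = d}" "path_coord b i \<noteq> 0" for b d i
    using that by (auto simp: path_coord_def cycle_degree_def split: if_splits)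
next
  fix a b assume "a \<in> paths (graph_A 4)" "b \<in> paths (graph_A 4)"
  then obtain i l j m where ab [simp]: "a = (vtx i, walk i l)" "b = (vtx j, walk j m)"
    by (auto simp: paths_graph_A)
  show "cycle_mult (path_coord a) (path_coord b)
      = (case path_concat (graph_A 4) a b of None \<Rightarrow> (\<lambda>_. 0) | Some c \<Rightarrow> path_coord c)"
  proof
    fix p :: "bool \<times> 3"
    obtain s k where p [simp]: "p = (s, k)" by (cases p)
    show "cycle_mult (path_coord a) (path_coord b) p
      = (case path_concat (graph_A 4) a b of None \<Rightarrow> (\<lambda>_. 0) | Some c \<Rightarrow> path_coord c) p"
      \<comment> \<open>A concatenation of length 1 has one factor of length 0 and one of length 1,
        which is what \<open>add_is_1\<close> provides.\<close>
      by (cases s) (auto simp: path_concat_walk path_coord_def add_is_1)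
  qed
next
  fix b assume "b \<in> paths (graph_A 4)"
  then obtain i l where b [simp]: "b = (vtx i, walk i l)" by (auto simp: paths_graph_A)
  let ?I = "Idl\<^bsub>PA.F\<^esub> relations"
  have I: "ideal ?I PA.F" using ring.genideal_ideal[OF PA.ring_F] relations_carrier by simp
  let ?s = "\<Sum>p\<in>UNIV. Poly_Mapping.single (path_of p) (path_coord b p)"
  show "Poly_Mapping.single b 1 - ?s \<in> ?I"
  \<comment> \<open>A path of length at most 1 is its own normal form; a longer one lies in the
    ideal and has zero coordinates.\<close>
  proof (cases "l < 2")
    case True
    define p where "p = (l = 1, i)"
    have "b = path_of p" using True by (auto simp: p_def path_of_def less_2_cases_iff)
    moreover have "path_coord (path_of p) q = (if p = q then 1 else 0)" for q
      by (cases q) (auto simp: p_def path_of_def path_coord_def)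
    ultimately have "?s = (\<Sum>q\<in>UNIV. if p = q then Poly_Mapping.single b 1 else 0)"
      by (intro sum.cong) auto
    then have "?s = Poly_Mapping.single b 1" by simp
    then show ?thesis using additive_subgroup.zero_closed[OF ideal.axioms(1)[OF I]] by simp
  next
    case False
    then have "path_coord b p = 0" for p by (auto simp: path_coord_def)
    then show ?thesis using long_path_in_ideal[of l i] False by simp
  qed
qed

lemma A_eq: "A = almost_calabi_yau_algebra (graph_A 4) W"
  by (simp add: A_def almost_calabi_yau_algebra_def path_algebra_def)

lemma coord_unit: "coord \<one>\<^bsub>A\<^esub> = (\<lambda>p. if fst p then 0 else 1)"
proof
  fix p :: "bool \<times> 3"
  have inj: "inj (\<lambda>i. (vtx i, [] :: ((int \<times> int) \<times> (int \<times> int)) list))" by (simp add: inj_on_def)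
  have "coord \<one>\<^bsub>A\<^esub> p = (\<Sum>e\<in>(\<lambda>v. (v, [])) ` verts (graph_A 4). path_coord e p)"
    by (simp only: coord_one)
  also have "\<dots> = (\<Sum>i\<in>UNIV. path_coord (vtx i, []) p)"
    unfolding verts_graph_A image_image by (subst sum.reindex[OF inj]) simp
  also have "\<dots> = (if fst p then 0 else 1)" by (simp add: path_coord_def)
  finally show "coord \<one>\<^bsub>A\<^esub> p = (if fst p then 0 else 1)" .
qed

end

text \<open>Here \<open>q\<close> is an eighth root of unity with \<open>q ^ 4 = -1\<close>, so
  neither \<open>q ^ 2\<close> nor \<open>q\<close> equals its own inverse.\<close>

lemma quantum_int_4_2: "quantum_int 4 2 \<noteq> 0"
proof -
  define q where "q = exp (\<i> * complex_of_real pi / 4)"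
  have "q ^ 4 = exp (\<i> * complex_of_real pi)"
    unfolding q_def by (simp add: exp_of_nat_mult[symmetric])
  then have q4: "q ^ 4 = -1" by (simp add: exp_eq_polar)
  have q0: "q \<noteq> 0" by (simp add: q_def)
  have "q ^ 2 - inverse (q ^ 2) \<noteq> 0"
  proof
    assume "q ^ 2 - inverse (q ^ 2) = 0"
    then have "q ^ 2 * q ^ 2 = 1" using q0 by (simp add: field_simps)
    then show False using q4 by (simp flip: power_add)
  qed
  \<comment> \<open>A zero denominator would make the quotient 0, so it has to be excluded as
    well.\<close>
  moreover have "q - inverse q \<noteq> 0"
  proof
    assume "q - inverse q = 0"
    then have "q * q = 1" using q0 by (simp add: field_simps)
    then have "q ^ 4 = 1" by (simp add: power4_eq_xxxx)
    then show False using q4 by simp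
  qed
  ultimately show ?thesis
    by (simp add: quantum_int_def Let_def q_def[symmetric] power_int_minus power_int_numeral)
qed

text \<open>In condition (I) with equal arrows the sum reduces to the squared modulus of the weight
  of the only closed path through the arrow. The right-hand side is nonzero because the entries of
  the eigenvector are positive.\<close>

lemma cell_system_weights:
  assumes "perron_frobenius_eigenvector (graph_A 4) 4 \<phi>" "cell_system (graph_A 4) 4 \<phi> W"
  shows "cell_weights W"
proof
  fix i :: 3
  have v: "vtx j \<in> verts (graph_A 4)" for j by (simp add: verts_graph_A)
  have \<phi>: "\<phi> (vtx j) > 0" for j using assms(1) v by (auto simp: perron_frobenius_eigenvector_def)
  have a: "arc i \<in> arcs_from_to (graph_A 4) (vtx i) (vtx (i + 1))" by (simp add: arcs_from_to_graph_A)
  have inj: "inj vtx" by (simp add: inj_on_def)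
  have "(\<Sum>k\<in>verts (graph_A 4). \<Sum>b\<^sub>1\<in>arcs_from_to (graph_A 4) (vtx (i + 1)) k.
      \<Sum>b\<^sub>2\<in>arcs_from_to (graph_A 4) k (vtx i). W (arc i) b\<^sub>1 b\<^sub>2 * cnj (W (arc i) b\<^sub>1 b\<^sub>2))
      = (if arc i = arc i then 1 else 0) * quantum_int 4 2 * of_real (\<phi> (vtx i)) * of_real (\<phi> (vtx (i + 1)))"
    using assms(2) v a unfolding cell_system_def by blast
  moreover have "\<dots> \<noteq> 0" using quantum_int_4_2 \<phi>[of i] \<phi>[of "i + 1"] by simp
  ultimately have nz: "(\<Sum>k\<in>UNIV. \<Sum>b\<^sub>1\<in>arcs_from_to (graph_A 4) (vtx (i + 1)) (vtx k).
      \<Sum>b\<^sub>2\<in>arcs_from_to (graph_A 4) (vtx k) (vtx i). W (arc i) b\<^sub>1 b\<^sub>2 * cnj (W (arc i) b\<^sub>1 b\<^sub>2)) \<noteq> 0"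
    unfolding verts_graph_A by (subst (asm) sum.reindex[OF inj]) simp
  show "W (arc i) (arc (i + 1)) (arc (i + 2)) \<noteq> 0"
  proof
    assume W: "W (arc i) (arc (i + 1)) (arc (i + 2)) = 0"
    have "(\<Sum>b\<^sub>1\<in>arcs_from_to (graph_A 4) (vtx (i + 1)) (vtx k).
      \<Sum>b\<^sub>2\<in>arcs_from_to (graph_A 4) (vtx k) (vtx i). W (arc i) b\<^sub>1 b\<^sub>2 * cnj (W (arc i) b\<^sub>1 b\<^sub>2)) = 0" for k
      using W by (simp add: arcs_from_to_graph_A add.assoc)
    then show False using nz by simp
  qed
qed


section \<open>The enveloping algebra\<close>

text \<open>When every coordinate has a fixed degree, the projection to degree \<open>d\<close>
  keeps the coordinates of that degree, and only the finitely many degrees in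
  \<open>range dg\<close> occur. This grades both \<open>A\<close> as a bimodule and the enveloping
  algebra over itself.\<close>

lemma graded_left_module_coords:
  fixes co :: "'m \<Rightarrow> 'i :: finite \<Rightarrow> complex" and dg :: "'i \<Rightarrow> int"
    and R :: "(complex, 'r) graded_module" and M :: "('r, 'm) graded_module"
  assumes lm: "left_module R M"
    and inject: "\<And>x y. x \<in> carrier M \<Longrightarrow> y \<in> carrier M \<Longrightarrow> co x = co y \<Longrightarrow> x = y"
    and surj: "\<And>f. \<exists>x\<in>carrier M. co x = f"
    and add: "\<And>x y. x \<in> carrier M \<Longrightarrow> y \<in> carrier M \<Longrightarrow> co (x \<oplus>\<^bsub>M\<^esub> y) = (\<lambda>i. co x i + co y i)"
    and part: "\<And>d. part M d = {x \<in> carrier M. \<forall>i. co x i \<noteq> 0 \<longrightarrow> dg i = d}"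
    and sm: "\<And>i j r x. r \<in> part R i \<Longrightarrow> x \<in> part M j \<Longrightarrow> r \<odot>\<^bsub>M\<^esub> x \<in> part M (i + j)"
  shows "graded_left_module R M"
proof -
  interpret left_mod R M by unfold_locales fact
  define el where "el f = (SOME x. x \<in> carrier M \<and> co x = f)" for f
  have el [simp]: "el f \<in> carrier M" "co (el f) = f" for f
    using someI_ex[of "\<lambda>x. x \<in> carrier M \<and> co x = f"] surj[of f] by (auto simp: el_def)
  have eqI: "x = el f" if "x \<in> carrier M" "co x = f" for x f
    using inject[of x "el f"] that by simp
  have zero [simp]: "co \<zero>\<^bsub>M\<^esub> = (\<lambda>_. 0)"
    using add[of "\<zero>\<^bsub>M\<^esub>" "\<zero>\<^bsub>M\<^esub>"] by (auto simp: fun_eq_iff)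
  have neg: "co (\<ominus>\<^bsub>M\<^esub> x) = (\<lambda>i. - co x i)" if "x \<in> carrier M" for x
    using add[of "\<ominus>\<^bsub>M\<^esub> x" x] that by (auto simp: fun_eq_iff M.l_neg eq_neg_iff_add_eq_0)
  have fs: "co (finsum M c S) = (\<lambda>i. \<Sum>s\<in>S. co (c s) i)" if "finite S" "c \<in> S \<rightarrow> carrier M" for c and S :: "int set"
    using that by (induction S rule: finite_induct) (auto simp: add)
  define pr where "pr d x = el (\<lambda>i. if dg i = d then co x i else 0)" for d x
  have pr [simp]: "pr d x \<in> carrier M" "co (pr d x) = (\<lambda>i. if dg i = d then co x i else 0)" for d x
    by (simp_all add: pr_def)
  show ?thesis
  proof (rule graded_left_moduleI[where pr = pr])
    show "additive_subgroup (part M d) M" for d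
    proof (intro additive_subgroup.intro M.add.subgroupI)
      show "part M d \<subseteq> carrier M" by (auto simp: part)
      have "\<zero>\<^bsub>M\<^esub> \<in> part M d" by (simp add: part)
      then show "part M d \<noteq> {}" by blast
      show "\<ominus>\<^bsub>M\<^esub> x \<in> part M d" if "x \<in> part M d" for x
        using that by (auto simp: part neg)
      show "x \<oplus>\<^bsub>M\<^esub> y \<in> part M d" if xy: "x \<in> part M d" "y \<in> part M d" for x y
      proof -
        have "co x i + co y i \<noteq> 0 \<Longrightarrow> dg i = d" for i
          using xy by (cases "co x i = 0") (auto simp: part)
        then show ?thesis using xy by (auto simp: part add)
      qed
    qed
    show "pr d x \<in> part M d" for d x by (simp add: part)
    show "pr d (x \<oplus>\<^bsub>M\<^esub> y) = pr d x \<oplus>\<^bsub>M\<^esub> pr d y" if "x \<in> carrier M" "y \<in> carrier M" for d x y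
      using that by (intro inject) (auto simp: add fun_eq_iff)
    show "pr d x = (if d = j then x else \<zero>\<^bsub>M\<^esub>)" if "x \<in> part M j" for d j x
      using that by (intro inject) (auto simp: part fun_eq_iff)
    show "\<exists>S. finite S \<and> (\<forall>d. d \<notin> S \<longrightarrow> pr d x = \<zero>\<^bsub>M\<^esub>) \<and> x = (\<Oplus>\<^bsub>M\<^esub>d\<in>S. pr d x)"
      if x: "x \<in> carrier M" for x
    proof (intro exI[of _ "range dg"] conjI allI impI)
      show "pr d x = \<zero>\<^bsub>M\<^esub>" if "d \<notin> range dg" for d
        using that by (intro inject) (auto simp: fun_eq_iff)
      have "co (\<Oplus>\<^bsub>M\<^esub>d\<in>range dg. pr d x) = co x" by (subst fs) (auto simp: fun_eq_iff)
      then show "x = (\<Oplus>\<^bsub>M\<^esub>d\<in>range dg. pr d x)" using x by (intro inject) auto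
    qed simp
  qed (use lm sm in auto)
qed

text \<open>An interface that isolates the coordinates and structure constants of \<open>A\<close>
  from its construction as a quotient of the path algebra; \<open>co\<close> is a bijection onto all
  functions on the six indices.\<close>

locale truncated_cycle =
  fixes A :: "(complex, 'a) graded_module" and co :: "'a \<Rightarrow> bool \<times> 3 \<Rightarrow> complex"
  assumes ring_A: "ring A"
    and smult_closed [simp]: "a \<in> carrier A \<Longrightarrow> c \<odot>\<^bsub>A\<^esub> a \<in> carrier A"
    and co_inject: "a \<in> carrier A \<Longrightarrow> b \<in> carrier A \<Longrightarrow> co a = co b \<Longrightarrow> a = b"
    and co_surj: "\<exists>a\<in>carrier A. co a = f"
    and co_add [simp]: "a \<in> carrier A \<Longrightarrow> b \<in> carrier A \<Longrightarrow> co (a \<oplus>\<^bsub>A\<^esub> b) = (\<lambda>p. co a p + co b p)"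
    and co_mult [simp]: "a \<in> carrier A \<Longrightarrow> b \<in> carrier A \<Longrightarrow> co (a \<otimes>\<^bsub>A\<^esub> b) = cycle_mult (co a) (co b)"
    and co_smult [simp]: "a \<in> carrier A \<Longrightarrow> co (c \<odot>\<^bsub>A\<^esub> a) = (\<lambda>p. c * co a p)"
    and co_one [simp]: "co \<one>\<^bsub>A\<^esub> = (\<lambda>p. if fst p then 0 else 1)"
    and part_A: "part A d = {a \<in> carrier A. \<forall>p. co a p \<noteq> 0 \<longrightarrow> cycle_degree p = d}"

lemma (in cell_weights) truncated_cycle: "truncated_cycle A coord"
proof (rule truncated_cycle.intro[OF ring_A])
  show "\<exists>a\<in>carrier A. coord a = f" for f by (intro bexI[of _ "of_coord f"]) auto
qed (rule smult_closed coord_inject coord_add coord_mult coord_smult coord_unit part_A; assumption)+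

text \<open>Structure constants of the enveloping algebra. Its first tensor factor is the opposite
  algebra, so there \<open>x\<close> takes the second piece \<open>p\<^sub>2\<close> and
  \<open>y\<close> the first.\<close>

definition env_mult ::
    "((bool \<times> 3) \<times> (bool \<times> 3) \<Rightarrow> complex) \<Rightarrow> ((bool \<times> 3) \<times> (bool \<times> 3) \<Rightarrow> complex)
      \<Rightarrow> (bool \<times> 3) \<times> (bool \<times> 3) \<Rightarrow> complex" where
  "env_mult x y u = (\<Sum>(p\<^sub>1, p\<^sub>2)\<in>factorizations (fst u). \<Sum>(q\<^sub>1, q\<^sub>2)\<in>factorizations (snd u).
     x (p\<^sub>2, q\<^sub>1) * y (p\<^sub>1, q\<^sub>2))"

lemma env_mult_simps [simp]:
  "env_mult x y ((False, i), (False, j)) = x ((False, i), (False, j)) * y ((False, i), (False, j))"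
  "env_mult x y ((True, i), (False, j)) =
     x ((True, i), (False, j)) * y ((False, i), (False, j)) +
     x ((False, i + 1), (False, j)) * y ((True, i), (False, j))"
  "env_mult x y ((False, i), (True, j)) =
     x ((False, i), (False, j)) * y ((False, i), (True, j)) +
     x ((False, i), (True, j)) * y ((False, i), (False, j + 1))"
  "env_mult x y ((True, i), (True, j)) =
     x ((True, i), (False, j)) * y ((False, i), (True, j)) +
     x ((True, i), (True, j)) * y ((False, i), (False, j + 1)) +
     (x ((False, i + 1), (False, j)) * y ((True, i), (True, j)) +
      x ((False, i + 1), (True, j)) * y ((True, i), (False, j + 1)))"
  by (simp_all add: env_mult_def factorizations_def)

text \<open>Coordinates of \<open>b x a\<close> for the tensor \<open>a \<otimes> b\<close>: the
  path \<open>q\<close> is cut into three pieces, the first taken from \<open>b\<close>, the middle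
  from \<open>x\<close> and the last from \<open>a\<close>.\<close>

definition env_act ::
    "((bool \<times> 3) \<times> (bool \<times> 3) \<Rightarrow> complex) \<Rightarrow> (bool \<times> 3 \<Rightarrow> complex) \<Rightarrow> bool \<times> 3 \<Rightarrow> complex" where
  "env_act r x q = (\<Sum>(q\<^sub>1\<^sub>2, q\<^sub>3)\<in>factorizations q. \<Sum>(q\<^sub>1, q\<^sub>2)\<in>factorizations q\<^sub>1\<^sub>2.
     r (q\<^sub>3, q\<^sub>1) * x q\<^sub>2)"

lemma env_act_simps [simp]:
  "env_act r x (False, i) = r ((False, i), (False, i)) * x (False, i)"
  "env_act r x (True, i) = r ((True, i), (False, i)) * x (False, i) +
     (r ((False, i + 1), (False, i)) * x (True, i) + r ((False, i + 1), (True, i)) * x (False, i + 1))"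
  by (simp_all add: env_act_def factorizations_def)

text \<open>Splitting by path length brings the expanded forms of the structure constants into play,
  so that identities between them become ring arithmetic.\<close>

lemma fun_eq_bool3I:
  assumes "\<And>i. f (False, i) = g (False, i)" "\<And>i. f (True, i) = g (True, i)"
  shows "f = (g :: bool \<times> 3 \<Rightarrow> 'b)"
proof
  fix p :: "bool \<times> 3"
  show "f p = g p" using assms by (cases p, cases "fst p") auto
qed

lemma fun_eq_env_indexI:
  assumes "\<And>i j. f ((False, i), (False, j)) = g ((False, i), (False, j))"
    "\<And>i j. f ((True, i), (False, j)) = g ((True, i), (False, j))"
    "\<And>i j. f ((False, i), (True, j)) = g ((False, i), (True, j))"
    "\<And>i j. f ((True, i), (True, j)) = g ((True, i), (True, j))"
  shows "f = (g :: (bool \<times> 3) \<times> (bool \<times> 3) \<Rightarrow> 'b)"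
proof
  fix u :: "(bool \<times> 3) \<times> (bool \<times> 3)"
  obtain s i t j where u: "u = ((s, i), (t, j))" by (metis surj_pair)
  show "f u = g u" unfolding u using assms by (cases s; cases t) auto
qed

section \<open>The tensor product in coordinates\<close>

context truncated_cycle
begin

sublocale A: ring A by (rule ring_A)

definition "el f = (SOME a. a \<in> carrier A \<and> co a = f)"

lemma el [simp]: "el f \<in> carrier A" "co (el f) = f"
  using someI_ex[of "\<lambda>a. a \<in> carrier A \<and> co a = f"] co_surj[of f] by (auto simp: el_def)

lemma co_zero [simp]: "co \<zero>\<^bsub>A\<^esub> = (\<lambda>_. 0)"
  using co_add[of "\<zero>\<^bsub>A\<^esub>" "\<zero>\<^bsub>A\<^esub>"] by (auto simp: fun_eq_iff)

lemma co_finsum: "finite S \<Longrightarrow> c \<in> S \<rightarrow> carrier A \<Longrightarrow>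
    co (finsum A c S) = (\<lambda>p. \<Sum>s\<in>S. co (c s) p)"
  by (induction S rule: finite_induct) auto

abbreviation "pair_mult \<equiv> \<lambda>(a, b) (a', b'). Some (a' \<otimes>\<^bsub>A\<^esub> a, b \<otimes>\<^bsub>A\<^esub> b')"
abbreviation "pair_deg \<equiv> \<lambda>d. {(a, b). \<exists>i j. i + j = d \<and> a \<in> part A i \<and> b \<in> part A j}"
abbreviation "relations \<equiv> bilinear_relations (opposite A) A"
definition "pair_coord = (\<lambda>(a, b) (p, q). co a p * co b q)"
definition "unit_el p = el (\<lambda>q. if p = q then 1 else 0)"
definition "unit_pair = (\<lambda>(p, q). (unit_el p, unit_el q))"
definition "pair_degree = (\<lambda>(p, q). cycle_degree p + cycle_degree q)"

sublocale T: basis_alg "carrier A \<times> carrier A" "{(\<one>\<^bsub>A\<^esub>, \<one>\<^bsub>A\<^esub>)}" pair_mult pair_deg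
  by unfold_locales (auto simp: A.m_assoc)

lemma opposite_simps [simp]:
  "carrier (opposite A) = carrier A" "add (opposite A) = add A" "smult (opposite A) = smult A"
  "one (opposite A) = one A" "part (opposite A) = part A" "a \<otimes>\<^bsub>opposite A\<^esub> b = b \<otimes>\<^bsub>A\<^esub> a"
  by (simp_all add: opposite_def)

lemma relations_carrier: "relations \<subseteq> {f. Poly_Mapping.keys f \<subseteq> carrier A \<times> carrier A}"
proof -
  have s: "Poly_Mapping.keys (Poly_Mapping.single p (c :: complex)) \<subseteq> carrier A \<times> carrier A"
    if "p \<in> carrier A \<times> carrier A" for p c using that by simp
  have d: "Poly_Mapping.keys (f - g) \<subseteq> carrier A \<times> carrier A"
    if "Poly_Mapping.keys f \<subseteq> carrier A \<times> carrier A" "Poly_Mapping.keys g \<subseteq> carrier A \<times> carrier A"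
    for f g :: "'a \<times> 'a \<Rightarrow>\<^sub>0 complex"
    by (rule order.trans[OF Poly_Mapping.keys_diff Un_least[OF that]])
  show ?thesis
  proof
    fix f assume "f \<in> relations"
    then show "f \<in> {f. Poly_Mapping.keys f \<subseteq> carrier A \<times> carrier A}"
      unfolding bilinear_relations_def
      by (elim UnE CollectE exE conjE) (simp only: mem_Collect_eq, (intro d s; simp))+
  qed
qed

definition "J = Idl\<^bsub>T.F\<^esub> relations"

lemma ideal_J: "ideal J T.F"
  unfolding J_def using ring.genideal_ideal[OF T.ring_F] relations_carrier by simp

lemma J_add: "f \<in> J \<Longrightarrow> g \<in> J \<Longrightarrow> f + g \<in> J"
  using additive_subgroup.a_closed[OF ideal.axioms(1)[OF ideal_J], of f g] by simp

lemma J_zero: "0 \<in> J"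
  using additive_subgroup.zero_closed[OF ideal.axioms(1)[OF ideal_J]] by simp

lemma J_smult: "f \<in> J \<Longrightarrow> Poly_Mapping.map (\<lambda>y. c * y) f \<in> J"
  by (rule T.ideal_smult[OF ideal_J])

lemma J_sum: "finite S \<Longrightarrow> (\<And>i. i \<in> S \<Longrightarrow> f i \<in> J) \<Longrightarrow> sum f S \<in> J"
  by (induction S rule: finite_induct) (auto simp: J_zero J_add)

lemma J_relation: "f \<in> relations \<Longrightarrow> f \<in> J"
  using subsetD[OF ring.genideal_self[OF T.ring_F, of relations]] relations_carrier
  by (simp add: J_def)

lemma map_diff: "Poly_Mapping.map (\<lambda>y. c * y) (f - g)
    = Poly_Mapping.map (\<lambda>y. c * y) f - Poly_Mapping.map (\<lambda>y. c * y) (g :: 'a \<times> 'a \<Rightarrow>\<^sub>0 complex)"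
  by (rule poly_mapping_eqI) (simp add: lookup_minus right_diff_distrib)

lemma J_add_left:
  assumes "a \<in> carrier A" "a' \<in> carrier A" "b \<in> carrier A"
  shows "Poly_Mapping.single (a \<oplus>\<^bsub>A\<^esub> a', b) c - Poly_Mapping.single (a, b) c
    - Poly_Mapping.single (a', b) c \<in> J"
proof -
  have "Poly_Mapping.single (a \<oplus>\<^bsub>A\<^esub> a', b) 1 - Poly_Mapping.single (a, b) 1
    - Poly_Mapping.single (a', b) 1 \<in> J"
    by (rule J_relation, unfold bilinear_relations_def opposite_simps, rule UnI1, rule UnI1, rule UnI1)
      (use assms in blast)
  from J_smult[OF this, of c] show ?thesis by (simp add: map_diff)
qed

lemma J_add_right:
  assumes "a \<in> carrier A" "b \<in> carrier A" "b' \<in> carrier A"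
  shows "Poly_Mapping.single (a, b \<oplus>\<^bsub>A\<^esub> b') c - Poly_Mapping.single (a, b) c
    - Poly_Mapping.single (a, b') c \<in> J"
proof -
  have "Poly_Mapping.single (a, b \<oplus>\<^bsub>A\<^esub> b') 1 - Poly_Mapping.single (a, b) 1
    - Poly_Mapping.single (a, b') 1 \<in> J"
    by (rule J_relation, unfold bilinear_relations_def opposite_simps, rule UnI1, rule UnI1, rule UnI2)
      (use assms in blast)
  from J_smult[OF this, of c] show ?thesis by (simp add: map_diff)
qed

lemma J_smult_left:
  assumes "a \<in> carrier A" "b \<in> carrier A"
  shows "Poly_Mapping.single (x \<odot>\<^bsub>A\<^esub> a, b) c - Poly_Mapping.single (a, b) (c * x) \<in> J"
proof -
  have "Poly_Mapping.single (x \<odot>\<^bsub>A\<^esub> a, b) 1 - Poly_Mapping.single (a, b) x \<in> J"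
    by (rule J_relation, unfold bilinear_relations_def opposite_simps, rule UnI1, rule UnI2)
      (use assms in blast)
  from J_smult[OF this, of c] show ?thesis by (simp add: map_diff)
qed

lemma J_smult_right:
  assumes "a \<in> carrier A" "b \<in> carrier A"
  shows "Poly_Mapping.single (a, x \<odot>\<^bsub>A\<^esub> b) c - Poly_Mapping.single (a, b) (c * x) \<in> J"
proof -
  have "Poly_Mapping.single (a, x \<odot>\<^bsub>A\<^esub> b) 1 - Poly_Mapping.single (a, b) x \<in> J"
    by (rule J_relation, unfold bilinear_relations_def opposite_simps, rule UnI2)
      (use assms in blast)
  from J_smult[OF this, of c] show ?thesis by (simp add: map_diff)
qed

lemma el_insert: "p \<notin> K \<Longrightarrow> el (\<lambda>q. if q \<in> insert p K then f q else 0)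
    = el (\<lambda>q. if q \<in> K then f q else 0) \<oplus>\<^bsub>A\<^esub> f p \<odot>\<^bsub>A\<^esub> unit_el p"
  by (rule co_inject) (auto simp: unit_el_def fun_eq_iff)

text \<open>Written as a multiple by 0, the zero element is covered by the scaling relation, which
  puts pairs with a zero entry into the ideal.\<close>

lemma el_zero: "el (\<lambda>_. 0) = 0 \<odot>\<^bsub>A\<^esub> el (\<lambda>_. 0)"
  by (rule co_inject) auto

lemma el_co: "a \<in> carrier A \<Longrightarrow> el (co a) = a"
  by (rule co_inject) auto

lemma unit_el_carrier [simp]: "unit_el p \<in> carrier A"
  by (simp add: unit_el_def)

text \<open>Distinct pairs are independent symbols, so linearity in the first entry holds only
  modulo \<open>J\<close>. The coordinates of \<open>a\<close> are switched on one at a time over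
  growing sets \<open>K\<close>, at the cost of one additivity and one scaling relation
  each.\<close>

lemma reduce_left:
  assumes "a \<in> carrier A" "b \<in> carrier A"
  shows "Poly_Mapping.single (a, b) c - (\<Sum>p\<in>UNIV. Poly_Mapping.single (unit_el p, b) (c * co a p)) \<in> J"
proof -
  have "Poly_Mapping.single (el (\<lambda>q. if q \<in> K then co a q else 0), b) c
      - (\<Sum>p\<in>K. Poly_Mapping.single (unit_el p, b) (c * co a p)) \<in> J" if "finite K" for K
    using that
  proof (induction K rule: finite_induct)
    case empty
    have "Poly_Mapping.single (el (\<lambda>_. 0), b) c \<in> J"
      using J_smult_left[OF el(1) assms(2), of 0 "\<lambda>_. 0" c] el_zero by simp
    then show ?case by simp
  next
    case (insert p K)
    let ?a = "el (\<lambda>q. if q \<in> K then co a q else 0)" and ?p = "co a p \<odot>\<^bsub>A\<^esub> unit_el p"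
    have "Poly_Mapping.single (?a \<oplus>\<^bsub>A\<^esub> ?p, b) c - Poly_Mapping.single (?a, b) c
        - Poly_Mapping.single (?p, b) c \<in> J"
      using assms by (intro J_add_left) auto
    moreover have "Poly_Mapping.single (?p, b) c - Poly_Mapping.single (unit_el p, b) (c * co a p) \<in> J"
      using assms by (intro J_smult_left) auto
    ultimately have "(Poly_Mapping.single (?a \<oplus>\<^bsub>A\<^esub> ?p, b) c - Poly_Mapping.single (?a, b) c
        - Poly_Mapping.single (?p, b) c) + (Poly_Mapping.single (?p, b) c
        - Poly_Mapping.single (unit_el p, b) (c * co a p))
        + (Poly_Mapping.single (?a, b) c - (\<Sum>p\<in>K. Poly_Mapping.single (unit_el p, b) (c * co a p))) \<in> J"
      using insert.IH by (intro J_add)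
    then show ?case
      unfolding el_insert[OF insert.hyps(2)] using insert.hyps by (simp add: algebra_simps)
  qed
  from this[of UNIV] show ?thesis using assms by (simp add: el_co)
qed

lemma reduce_right:
  assumes "a \<in> carrier A" "b \<in> carrier A"
  shows "Poly_Mapping.single (a, b) c - (\<Sum>p\<in>UNIV. Poly_Mapping.single (a, unit_el p) (c * co b p)) \<in> J"
proof -
  have "Poly_Mapping.single (a, el (\<lambda>q. if q \<in> K then co b q else 0)) c
      - (\<Sum>p\<in>K. Poly_Mapping.single (a, unit_el p) (c * co b p)) \<in> J" if "finite K" for K
    using that
  proof (induction K rule: finite_induct)
    case empty
    have "Poly_Mapping.single (a, el (\<lambda>_. 0)) c \<in> J"
      using J_smult_right[OF assms(1) el(1), of 0 "\<lambda>_. 0" c] el_zero by simp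
    then show ?case by simp
  next
    case (insert p K)
    let ?b = "el (\<lambda>q. if q \<in> K then co b q else 0)" and ?p = "co b p \<odot>\<^bsub>A\<^esub> unit_el p"
    have "Poly_Mapping.single (a, ?b \<oplus>\<^bsub>A\<^esub> ?p) c - Poly_Mapping.single (a, ?b) c
        - Poly_Mapping.single (a, ?p) c \<in> J"
      using assms by (intro J_add_right) auto
    moreover have "Poly_Mapping.single (a, ?p) c - Poly_Mapping.single (a, unit_el p) (c * co b p) \<in> J"
      using assms by (intro J_smult_right) auto
    ultimately have "(Poly_Mapping.single (a, ?b \<oplus>\<^bsub>A\<^esub> ?p) c - Poly_Mapping.single (a, ?b) c
        - Poly_Mapping.single (a, ?p) c) + (Poly_Mapping.single (a, ?p) c
        - Poly_Mapping.single (a, unit_el p) (c * co b p))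
        + (Poly_Mapping.single (a, ?b) c - (\<Sum>p\<in>K. Poly_Mapping.single (a, unit_el p) (c * co b p))) \<in> J"
      using insert.IH by (intro J_add)
    then show ?case
      unfolding el_insert[OF insert.hyps(2)] using insert.hyps by (simp add: algebra_simps)
  qed
  from this[of UNIV] show ?thesis using assms by (simp add: el_co)
qed

text \<open>The first entry is expanded, then the second entry of every resulting term; the
  differences telescope.\<close>

lemma reduce_pair:
  assumes "a \<in> carrier A" "b \<in> carrier A"
  shows "Poly_Mapping.single (a, b) 1
    - (\<Sum>u\<in>UNIV. Poly_Mapping.single (unit_pair u) (pair_coord (a, b) u)) \<in> J"
proof -
  let ?l = "\<lambda>p. Poly_Mapping.single (unit_el p, b) (co a p)"
  let ?r = "\<lambda>p q. Poly_Mapping.single (unit_el p, unit_el q) (co a p * co b q)"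
  have "(Poly_Mapping.single (a, b) 1 - (\<Sum>p\<in>UNIV. ?l p)) + (\<Sum>p\<in>UNIV. ?l p - (\<Sum>q\<in>UNIV. ?r p q)) \<in> J"
    using reduce_left[OF assms, of 1] assms
    by (intro J_add J_sum reduce_right) auto
  moreover have "(\<Sum>u\<in>UNIV. Poly_Mapping.single (unit_pair u) (pair_coord (a, b) u))
      = (\<Sum>p\<in>UNIV. \<Sum>q\<in>UNIV. ?r p q)"
    unfolding UNIV_Times_UNIV[symmetric] sum.cartesian_product[symmetric]
    by (simp add: sum.cartesian_product unit_pair_def pair_coord_def case_prod_unfold)
  ultimately show ?thesis by (simp add: sum_subtractf)
qed

text \<open>The tensors of basis paths serve as representatives, one for each of the 36
  coordinates.\<close>

sublocale Env: presented_alg "carrier A \<times> carrier A" "{(\<one>\<^bsub>A\<^esub>, \<one>\<^bsub>A\<^esub>)}" pair_mult pair_deg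
  pair_coord env_mult unit_pair pair_degree relations
proof
  show "env_mult (\<lambda>i. x i + y i) z = (\<lambda>i. env_mult x z i + env_mult y z i)" for x y z
    by (rule fun_eq_env_indexI) (simp_all add: algebra_simps)
  show "env_mult z (\<lambda>i. x i + y i) = (\<lambda>i. env_mult z x i + env_mult z y i)" for x y z
    by (rule fun_eq_env_indexI) (simp_all add: algebra_simps)
  show "env_mult (\<lambda>i. c * x i) (\<lambda>i. c' * y i) = (\<lambda>i. c * c' * env_mult x y i)" for c c' x y
    by (rule fun_eq_env_indexI) (simp_all add: algebra_simps)
  show "relations \<subseteq> {f. Poly_Mapping.keys f \<subseteq> carrier A \<times> carrier A}" by (rule relations_carrier)
  show "linear_extension pair_coord f = (\<lambda>_. 0)" if "f \<in> relations" for f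
    using that
    by (auto simp: bilinear_relations_def linear_extension_diff pair_coord_def fun_eq_iff
        distrib_left distrib_right)
  show "unit_pair i \<in> carrier A \<times> carrier A" for i by (simp add: unit_pair_def case_prod_unfold)
  show "pair_coord (unit_pair i) j = (if i = j then 1 else 0)" for i j
    by (cases i; cases j) (auto simp: unit_pair_def pair_coord_def unit_el_def)
  show "unit_pair i \<in> pair_deg (pair_degree i)" for i
    by (cases i) (auto simp: unit_pair_def pair_degree_def part_A unit_el_def split: if_splits)
  show "pair_degree i = d" if "b \<in> pair_deg d" "pair_coord b i \<noteq> 0" for b d i
    using that by (cases i) (auto simp: pair_coord_def pair_degree_def part_A)
next
  fix a b assume "a \<in> carrier A \<times> carrier A" "b \<in> carrier A \<times> carrier A"
  then show "env_mult (pair_coord a) (pair_coord b)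
      = (case pair_mult a b of None \<Rightarrow> (\<lambda>_. 0) | Some c \<Rightarrow> pair_coord c)"
    by (intro fun_eq_env_indexI) (auto simp: pair_coord_def algebra_simps)
next
  fix b assume "b \<in> carrier A \<times> carrier A"
  then show "Poly_Mapping.single b 1 - (\<Sum>i\<in>UNIV. Poly_Mapping.single (unit_pair i) (pair_coord b i))
      \<in> Idl\<^bsub>T.F\<^esub> relations"
    using reduce_pair by (auto simp: J_def)
qed

lemma Env_eq: "Env.A = enveloping_algebra A"
  by (simp add: Env.A_def enveloping_algebra_def tensor_algebra_def Let_def)

section \<open>The algebra as a module over its enveloping algebra\<close>

abbreviation "E \<equiv> enveloping_algebra A"
abbreviation "M \<equiv> algebra_as_bimodule A"

lemmas ring_E = Env.ring_A[unfolded Env_eq]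
lemmas E_inject = Env.coord_inject[unfolded Env_eq]
lemmas E_of_coord [simp] = Env.of_coord_carrier[unfolded Env_eq]
lemmas E_add [simp] = Env.coord_add[unfolded Env_eq]
lemmas E_mult [simp] = Env.coord_mult[unfolded Env_eq]
lemmas E_smult [simp] = Env.coord_smult[unfolded Env_eq]
lemmas E_smult_closed [simp] = Env.smult_closed[unfolded Env_eq]
lemmas E_zero [simp] = Env.coord_zero[unfolded Env_eq]
lemmas part_E = Env.part_A[unfolded Env_eq]

sublocale E: ring E by (rule ring_E)

lemma E_one [simp]: "Env.coord \<one>\<^bsub>E\<^esub> = (\<lambda>u. if fst (fst u) \<or> fst (snd u) then 0 else 1)"
  using Env.coord_one unfolding Env_eq by (auto simp: pair_coord_def fun_eq_iff)

lemma M_simps [simp]: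
  "carrier M = carrier A" "mult M = mult A" "one M = one A" "zero M = zero A" "add M = add A"
  "part M = part A"
  by (simp_all add: algebra_as_bimodule_def)

text \<open>The action is defined through representatives of \<open>t\<close>. The sum
  \<open>?L\<close> depends on a representative only through its coordinates, so its image over the
  coset is a singleton, whose member \<open>the_elem\<close> returns.\<close>

lemma act_coords:
  assumes t: "t \<in> carrier E" and x: "x \<in> carrier A"
  shows "t \<odot>\<^bsub>M\<^esub> x \<in> carrier A" "co (t \<odot>\<^bsub>M\<^esub> x) = env_act (Env.coord t) (co x)"
proof -
  let ?L = "\<lambda>f. \<Oplus>\<^bsub>A\<^esub>p\<in>Poly_Mapping.keys f.
      Poly_Mapping.lookup f p \<odot>\<^bsub>A\<^esub> (snd p \<otimes>\<^bsub>A\<^esub> x \<otimes>\<^bsub>A\<^esub> fst p)"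
  have t': "t \<in> carrier Env.A" using t by (simp add: Env_eq)
  obtain f where f: "Poly_Mapping.keys f \<subseteq> carrier A \<times> carrier A" "t = Env.cls f"
    by (rule Env.cls_cases[OF t'])
  have L: "?L g = el (env_act (linear_extension pair_coord g) (co x))"
    if g: "Poly_Mapping.keys g \<subseteq> carrier A \<times> carrier A" for g
  proof (rule co_inject)
    have c: "(\<lambda>p. Poly_Mapping.lookup g p \<odot>\<^bsub>A\<^esub> (snd p \<otimes>\<^bsub>A\<^esub> x \<otimes>\<^bsub>A\<^esub> fst p))
        \<in> Poly_Mapping.keys g \<rightarrow> carrier A"
      using g x by fastforce
    then show "?L g \<in> carrier A" by (rule A.finsum_closed)
    have "co (?L g) = (\<lambda>q. \<Sum>p\<in>Poly_Mapping.keys g. Poly_Mapping.lookup g p *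
        cycle_mult (cycle_mult (co (snd p)) (co x)) (co (fst p)) q)"
      unfolding co_finsum[OF finite_keys c] using g x
      by (intro ext sum.cong refl) (auto dest!: subsetD)
    also have "\<dots> = env_act (linear_extension pair_coord g) (co x)"
      by (rule fun_eq_bool3I)
        (simp_all add: linear_extension_def pair_coord_def case_prod_unfold sum_distrib_left
          sum.distrib algebra_simps)
    finally show "co (?L g) = co (el (env_act (linear_extension pair_coord g) (co x)))" by simp
  qed simp
  have ct: "Env.coord t = linear_extension pair_coord f" using f by simp
  have "?L ` t = {el (env_act (linear_extension pair_coord f) (co x))}"
    using f L by (auto simp: Env.coset_eq image_iff intro!: exI[of _ f])
  then have "t \<odot>\<^bsub>M\<^esub> x = el (env_act (Env.coord t) (co x))"
    by (simp add: algebra_as_bimodule_def ct)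
  then show "t \<odot>\<^bsub>M\<^esub> x \<in> carrier A" "co (t \<odot>\<^bsub>M\<^esub> x) = env_act (Env.coord t) (co x)" by simp_all
qed

lemma left_module_M: "left_module E M"
proof (rule left_moduleI[OF ring_E])
  show "abelian_group M"
  proof (rule abelian_groupI)
    show "\<exists>y\<in>carrier M. y \<oplus>\<^bsub>M\<^esub> x = \<zero>\<^bsub>M\<^esub>" if "x \<in> carrier M" for x
      using that A.l_neg[of x] by (intro bexI[of _ "\<ominus>\<^bsub>A\<^esub> x"]) auto
  qed (auto simp: A.a_ac)
  fix r s x y assume r: "r \<in> carrier E" and s: "s \<in> carrier E"
    and x: "x \<in> carrier M" and y: "y \<in> carrier M"
  then have x: "x \<in> carrier A" and y: "y \<in> carrier A" by simp_all
  note [simp] = act_coords r s x y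
  show "r \<odot>\<^bsub>M\<^esub> x \<in> carrier M" by simp
  show "(r \<oplus>\<^bsub>E\<^esub> s) \<odot>\<^bsub>M\<^esub> x = r \<odot>\<^bsub>M\<^esub> x \<oplus>\<^bsub>M\<^esub> s \<odot>\<^bsub>M\<^esub> x"
    by (rule co_inject) (auto intro!: fun_eq_bool3I simp: algebra_simps)
  show "r \<odot>\<^bsub>M\<^esub> (x \<oplus>\<^bsub>M\<^esub> y) = r \<odot>\<^bsub>M\<^esub> x \<oplus>\<^bsub>M\<^esub> r \<odot>\<^bsub>M\<^esub> y"
    by (rule co_inject) (auto intro!: fun_eq_bool3I simp: algebra_simps)
  show "(r \<otimes>\<^bsub>E\<^esub> s) \<odot>\<^bsub>M\<^esub> x = r \<odot>\<^bsub>M\<^esub> (s \<odot>\<^bsub>M\<^esub> x)"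
    by (rule co_inject) (auto intro!: fun_eq_bool3I simp: algebra_simps)
next
  fix x assume "x \<in> carrier M"
  then show "\<one>\<^bsub>E\<^esub> \<odot>\<^bsub>M\<^esub> x = x"
    by (intro co_inject) (auto intro!: fun_eq_bool3I simp: act_coords)
qed

lemma cycle_degree_simps [simp]: "cycle_degree (False, i) = 0" "cycle_degree (True, i) = 1"
  by (simp_all add: cycle_degree_def)

lemma graded_M: "graded_mod E M"
proof (rule graded_mod.intro, rule graded_left_module_coords[where co = co and dg = cycle_degree])
  fix i j r x assume "r \<in> part E i" "x \<in> part M j"
  then have r: "r \<in> carrier E" "\<forall>u. Env.coord r u \<noteq> 0 \<longrightarrow> pair_degree u = i"
    and x: "x \<in> carrier A" "\<forall>p. co x p \<noteq> 0 \<longrightarrow> cycle_degree p = j"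
    by (simp_all add: part_E part_A)
  \<comment> \<open>Nonzero coordinates have degrees \<open>i\<close> and \<open>j\<close>, while
    every term of \<open>env_act\<close> at \<open>p\<close> has total degree
    \<open>cycle_degree p\<close>; if this is not \<open>i + j\<close>, all terms vanish.\<close>
  have z: "Env.coord r u * co x p = 0" if "pair_degree u + cycle_degree p \<noteq> i + j" for u p
    using r(2)[rule_format, of u] x(2)[rule_format, of p] that by auto
  have "env_act (Env.coord r) (co x) p = 0" if "cycle_degree p \<noteq> i + j" for p
  proof (cases p)
    case (Pair s k)
    then show ?thesis using that by (cases s) (auto simp: pair_degree_def z)
  qed
  then show "r \<odot>\<^bsub>M\<^esub> x \<in> part M (i + j)" using r x by (auto simp: part_A act_coords)
qed (use co_inject co_surj part_A left_module_M in auto)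

lemma graded_alg_E: "graded_alg E"
proof
  show "graded_left_module E (graded_regular E)"
  proof (rule graded_left_module_coords[where co = Env.coord and dg = pair_degree])
    show "left_module E (graded_regular E)"
    proof (rule left_moduleI[OF ring_E])
      show "abelian_group (graded_regular E)"
      proof (rule abelian_groupI)
        show "\<exists>y\<in>carrier (graded_regular E). y \<oplus>\<^bsub>graded_regular E\<^esub> x = \<zero>\<^bsub>graded_regular E\<^esub>"
          if "x \<in> carrier (graded_regular E)" for x
          using that E.l_neg[of x] by (intro bexI[of _ "\<ominus>\<^bsub>E\<^esub> x"]) auto
      qed (auto simp: E.a_ac)
    qed (auto simp: E.l_distr E.r_distr E.m_assoc)
    show "\<exists>x\<in>carrier (graded_regular E). Env.coord x = f" for f
      by (intro bexI[of _ "Env.of_coord f"]) auto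
    fix i j r x assume "r \<in> part E i" "x \<in> part (graded_regular E) j"
    then have r: "r \<in> carrier E" "\<forall>u. Env.coord r u \<noteq> 0 \<longrightarrow> pair_degree u = i"
      and x: "x \<in> carrier E" "\<forall>u. Env.coord x u \<noteq> 0 \<longrightarrow> pair_degree u = j"
      by (simp_all add: part_E)
    have z: "Env.coord r u * Env.coord x v = 0" if "pair_degree u + pair_degree v \<noteq> i + j" for u v
      using r(2)[rule_format, of u] x(2)[rule_format, of v] that by auto
    have "env_mult (Env.coord r) (Env.coord x) u = 0" if d: "pair_degree u \<noteq> i + j" for u
    proof -
      obtain s k t l where u: "u = ((s, k), (t, l))" by (metis surj_pair)
      show ?thesis using d unfolding u by (cases s; cases t) (auto simp: pair_degree_def z)
    qed
    then show "r \<odot>\<^bsub>graded_regular E\<^esub> x \<in> part (graded_regular E) (i + j)"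
      using r x by (auto simp: part_E)
  qed (use E_inject part_E in auto)
  show "c \<odot>\<^bsub>E\<^esub> \<one>\<^bsub>E\<^esub> \<in> part E 0" for c by (auto simp: part_E pair_degree_def cycle_degree_def)
  show "(c \<odot>\<^bsub>E\<^esub> \<one>\<^bsub>E\<^esub>) \<otimes>\<^bsub>E\<^esub> r = r \<otimes>\<^bsub>E\<^esub> (c \<odot>\<^bsub>E\<^esub> \<one>\<^bsub>E\<^esub>)" if "r \<in> carrier E" for c r
    using that by (intro E_inject) (auto intro!: fun_eq_env_indexI)
  show "(c + c') \<odot>\<^bsub>E\<^esub> \<one>\<^bsub>E\<^esub> = c \<odot>\<^bsub>E\<^esub> \<one>\<^bsub>E\<^esub> \<oplus>\<^bsub>E\<^esub> c' \<odot>\<^bsub>E\<^esub> \<one>\<^bsub>E\<^esub>" for c c'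
    by (intro E_inject) (auto simp: distrib_right)
  show "(c * c') \<odot>\<^bsub>E\<^esub> \<one>\<^bsub>E\<^esub> = (c \<odot>\<^bsub>E\<^esub> \<one>\<^bsub>E\<^esub>) \<otimes>\<^bsub>E\<^esub> (c' \<odot>\<^bsub>E\<^esub> \<one>\<^bsub>E\<^esub>)" for c c'
    by (intro E_inject) (auto intro!: fun_eq_env_indexI)
  show "1 \<odot>\<^bsub>E\<^esub> \<one>\<^bsub>E\<^esub> = \<one>\<^bsub>E\<^esub>"
    by (intro E_inject) auto
qed

end


section \<open>Hochschild cohomology\<close>

lemma three_eq_0 [simp]: "(3 :: 3) = 0"
  by simp

lemma of_nat_3: "of_nat n = (of_nat (n mod 3) :: 3)"
proof -
  have "of_nat n = (of_nat (3 * (n div 3) + n mod 3) :: 3)" by simp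
  also have "\<dots> = of_nat (n mod 3)"
  proof -
    have "of_nat 3 = (0 :: 3)" by simp
    then show ?thesis unfolding of_nat_add of_nat_mult by (simp only: mult_zero_left add_0)
  qed
  finally show ?thesis .
qed

lemma of_nat_3_eq_0: "of_nat n = (0 :: 3) \<longleftrightarrow> n mod 3 = 0"
  and of_nat_3_eq_1: "of_nat n = (1 :: 3) \<longleftrightarrow> n mod 3 = 1"
proof -
  have "n mod 3 = 0 \<or> n mod 3 = 1 \<or> n mod 3 = 2" by linarith
  then show "of_nat n = (0 :: 3) \<longleftrightarrow> n mod 3 = 0" "of_nat n = (1 :: 3) \<longleftrightarrow> n mod 3 = 1"
    using of_nat_3[of n] by auto
qed

lemma all_3: "(\<forall>i :: 3. Q i) \<longleftrightarrow> Q 0 \<and> Q 1 \<and> Q 2"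
  using cases_3 by metis

context truncated_cycle
begin

text \<open>Write \<open>e\<^sub>i\<close> for the idempotent at vertex \<open>i\<close> and \<open>a\<^sub>i\<close> for the arrow starting there.
  In the Koszul resolution the summand \<open>A e\<^sub>i \<otimes> e\<^bsub>i+n\<^esub> A\<close> of the term of degree \<open>n\<close> is the left
  ideal of the enveloping algebra generated by \<open>e\<^bsub>i+n\<^esub> \<otimes> e\<^sub>i\<close>, and the differential is right
  multiplication by the sum of the elements
  \<open>e\<^bsub>i+n+1\<^esub> \<otimes> a\<^sub>i + (-1)\<^bsup>n+1\<^esup> a\<^bsub>i+n\<^esub> \<otimes> e\<^sub>i\<close>.\<close>

definition koszul_idempotent :: "nat \<Rightarrow> ('a \<times> 'a \<Rightarrow>\<^sub>0 complex) set" where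
  "koszul_idempotent n = Env.of_coord (\<lambda>((s, i), (t, j)).
     if \<not> s \<and> \<not> t \<and> i = j + of_nat n then 1 else 0)"

definition koszul_differential :: "nat \<Rightarrow> ('a \<times> 'a \<Rightarrow>\<^sub>0 complex) set" where
  "koszul_differential n = Env.of_coord (\<lambda>((s, i), (t, j)).
     if \<not> s \<and> t \<and> i = j + of_nat n + 1 then 1
     else if s \<and> \<not> t \<and> i = j + of_nat n then (- 1) ^ (n + 1) else 0)"

lemma koszul_carrier [simp]: "koszul_idempotent n \<in> carrier E" "koszul_differential n \<in> carrier E"
  by (simp_all add: koszul_idempotent_def koszul_differential_def)

lemma koszul_coord [simp]:
  "Env.coord (koszul_idempotent n) ((s, i), (t, j)) =
     (if \<not> s \<and> \<not> t \<and> i = j + of_nat n then 1 else 0)"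
  "Env.coord (koszul_differential n) ((s, i), (t, j)) =
     (if \<not> s \<and> t \<and> i = j + of_nat n + 1 then 1
      else if s \<and> \<not> t \<and> i = j + of_nat n then (- 1) ^ (n + 1) else 0)"
  by (simp_all add: koszul_idempotent_def koszul_differential_def)

text \<open>Right multiplication of \<open>p \<otimes> q\<close> by a tensor of two vertices
  compares the first vertex with the start of \<open>p\<close> and the second with the end of
  \<open>q\<close>. An arrow \<open>q\<close> from \<open>j\<close> ends at \<open>j + 1\<close>,
  hence the extra 1 in the last two cases.\<close>

lemma idempotent_support:
  assumes "x \<in> carrier E" "x \<otimes>\<^bsub>E\<^esub> koszul_idempotent n = x"
  shows "i \<noteq> j + of_nat n \<Longrightarrow> Env.coord x ((False, i), (False, j)) = 0"
    "i \<noteq> j + of_nat n \<Longrightarrow> Env.coord x ((True, i), (False, j)) = 0"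
    "i \<noteq> j + 1 + of_nat n \<Longrightarrow> Env.coord x ((False, i), (True, j)) = 0"
    "i \<noteq> j + 1 + of_nat n \<Longrightarrow> Env.coord x ((True, i), (True, j)) = 0"
proof -
  have "env_mult (Env.coord x) (Env.coord (koszul_idempotent n)) = Env.coord x"
    using assms E_mult[of x "koszul_idempotent n"] by simp
  note c = fun_cong[OF this, symmetric]
  show "i \<noteq> j + of_nat n \<Longrightarrow> Env.coord x ((False, i), (False, j)) = 0"
    by (subst c) simp
  show "i \<noteq> j + of_nat n \<Longrightarrow> Env.coord x ((True, i), (False, j)) = 0"
    by (subst c) simp
  show "i \<noteq> j + 1 + of_nat n \<Longrightarrow> Env.coord x ((False, i), (True, j)) = 0"
    by (subst c) simp
  show "i \<noteq> j + 1 + of_nat n \<Longrightarrow> Env.coord x ((True, i), (True, j)) = 0"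
    by (subst c) simp
qed

text \<open>The vanishing product kills the vertex-vertex coordinates of \<open>x\<close> and ties
  the arrow-vertex ones to the vertex-arrow ones. Thus \<open>x\<close> is determined by its
  coordinates with an arrow in the second entry, and stripping that arrow yields
  \<open>y\<close>.\<close>

lemma koszul_exact:
  assumes x: "x \<in> carrier E" "x \<otimes>\<^bsub>E\<^esub> koszul_idempotent (Suc n) = x"
    and d: "x \<otimes>\<^bsub>E\<^esub> koszul_differential n = \<zero>\<^bsub>E\<^esub>"
  shows "\<exists>y\<in>carrier E. x = y \<otimes>\<^bsub>E\<^esub> koszul_differential (Suc n)"
proof -
  let ?X = "Env.coord x"
  note s = idempotent_support[OF x]
  have "env_mult ?X (Env.coord (koszul_differential n)) = (\<lambda>_. 0)"
    using x(1) d E_mult[of x "koszul_differential n"] by simp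
  note c = fun_cong[OF this]
  have x00: "?X ((False, i), (False, j)) = 0" for i j
    using c[of "((False, i), (True, j))"] s(1)[of i j] by (cases "i = j + of_nat n + 1") (simp_all add: add_ac)
  have x10: "?X ((True, j + of_nat n + 1), (False, j)) = (- 1) ^ n * ?X ((False, j + of_nat n + 2), (True, j))" for j
    using c[of "((True, j + of_nat n + 1), (True, j))"] by (simp add: add_ac)
  \<comment> \<open>The arrow in the second entry becomes the vertex at its start. The position
    \<open>i = j + of_nat n + 2\<close> is that of the left ideal of index
    \<open>n + 2\<close>.\<close>
  define Y where "Y = (\<lambda>((s, i :: 3), (t, j :: 3)).
    if \<not> t \<and> i = j + of_nat n + 2 then ?X ((s, i), (True, j)) else 0)"
  have "x = Env.of_coord Y \<otimes>\<^bsub>E\<^esub> koszul_differential (Suc n)"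
  proof (rule E_inject)
    show "?X = Env.coord (Env.of_coord Y \<otimes>\<^bsub>E\<^esub> koszul_differential (Suc n))"
    proof (subst E_mult, simp, simp, subst Env.coord_of_coord, rule fun_eq_env_indexI)
      fix i j
      let ?Z = "env_mult Y (Env.coord (koszul_differential (Suc n)))"
      show "?X ((False, i), (False, j)) = ?Z ((False, i), (False, j))"
        by (simp add: x00)
      show "?X ((True, i), (False, j)) = ?Z ((True, i), (False, j))"
        using s(2)[of i j] x10[of j] by (cases "i = j + of_nat n + 1") (simp_all add: Y_def add_ac)
      show "?X ((False, i), (True, j)) = ?Z ((False, i), (True, j))"
        using s(3)[of i j] by (cases "i = j + of_nat n + 2") (simp_all add: Y_def add_ac)
      show "?X ((True, i), (True, j)) = ?Z ((True, i), (True, j))"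
        using s(4)[of i j] by (cases "i = j + of_nat n + 2") (simp_all add: Y_def add_ac)
    qed
  qed (use x in simp_all)
  then show ?thesis using E_of_coord by blast
qed

text \<open>The same argument with the multiplication map in place of the preceding
  differential.\<close>

lemma koszul_exact_augmentation:
  assumes x: "x \<in> carrier E" "x \<otimes>\<^bsub>E\<^esub> koszul_idempotent 0 = x"
    and d: "x \<odot>\<^bsub>M\<^esub> \<one>\<^bsub>A\<^esub> = \<zero>\<^bsub>M\<^esub>"
  shows "\<exists>y\<in>carrier E. x = y \<otimes>\<^bsub>E\<^esub> koszul_differential 0"
proof -
  let ?X = "Env.coord x"
  note s = idempotent_support[OF x]
  have "env_act ?X (co \<one>\<^bsub>A\<^esub>) = (\<lambda>_. 0)"
    using x(1) d act_coords(2)[of x "\<one>\<^bsub>A\<^esub>"] by simp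
  note c = fun_cong[OF this]
  have x00: "?X ((False, i), (False, j)) = 0" for i j
    using c[of "(False, i)"] s(1)[of i j] by (cases "i = j") simp_all
  have x10: "?X ((True, j), (False, j)) = - ?X ((False, j + 1), (True, j))" for j
    using c[of "(True, j)"] by (simp add: add_eq_0_iff2)
  define Y where "Y = (\<lambda>((s, i :: 3), (t, j :: 3)).
    if \<not> t \<and> i = j + 1 then ?X ((s, i), (True, j)) else 0)"
  have "x = Env.of_coord Y \<otimes>\<^bsub>E\<^esub> koszul_differential 0"
  proof (rule E_inject)
    show "?X = Env.coord (Env.of_coord Y \<otimes>\<^bsub>E\<^esub> koszul_differential 0)"
    proof (subst E_mult, simp, simp, subst Env.coord_of_coord, rule fun_eq_env_indexI)
      fix i j
      let ?Z = "env_mult Y (Env.coord (koszul_differential 0))"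
      show "?X ((False, i), (False, j)) = ?Z ((False, i), (False, j))"
        by (simp add: x00)
      show "?X ((True, i), (False, j)) = ?Z ((True, i), (False, j))"
        using s(2)[of i j] x10[of j] by (cases "i = j") (simp_all add: Y_def)
      show "?X ((False, i), (True, j)) = ?Z ((False, i), (True, j))"
        using s(3)[of i j] by (cases "i = j + 1") (simp_all add: Y_def)
      show "?X ((True, i), (True, j)) = ?Z ((True, i), (True, j))"
        using s(4)[of i j] by (cases "i = j + 1") (simp_all add: Y_def)
    qed
  qed (use x in simp_all)
  then show ?thesis using E_of_coord by blast
qed

lemma generated_by_one:
  assumes "m \<in> carrier M"
  shows "\<exists>x\<in>carrier E. m = x \<odot>\<^bsub>M\<^esub> \<one>\<^bsub>A\<^esub>"
proof -
  \<comment> \<open>The sum of \<open>p\<close> tensor the vertex at its start, over all basis paths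
    \<open>p\<close>, weighted by the coordinates of \<open>m\<close>; each summand acts on the unit
    to give \<open>p\<close>.\<close>
  define x where "x = Env.of_coord (\<lambda>((s, i), (t, j)). if \<not> t \<and> i = j then co m (s, i) else 0)"
  have x: "x \<in> carrier E" by (simp add: x_def)
  have xc: "Env.coord x ((s, i), (t, j)) = (if \<not> t \<and> i = j then co m (s, i) else 0)" for s t i j
    by (simp add: x_def)
  have "m = x \<odot>\<^bsub>M\<^esub> \<one>\<^bsub>A\<^esub>"
    using assms x by (intro co_inject) (auto simp: act_coords xc intro!: fun_eq_bool3I)
  then show ?thesis using x by blast
qed

sublocale K: principal_complex E M "\<one>\<^bsub>A\<^esub>" koszul_idempotent koszul_differential
proof (intro principal_complex.intro principal_complex_axioms.intro graded_alg_E graded_M)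
  fix n
  show "koszul_idempotent n \<in> part E 0"
    by (auto simp: part_E pair_degree_def split: if_splits)
  show "koszul_differential n \<in> part E 1"
    by (auto simp: part_E pair_degree_def split: if_splits)
  show "koszul_idempotent n \<otimes>\<^bsub>E\<^esub> koszul_idempotent n = koszul_idempotent n"
    by (rule E_inject) (auto intro!: fun_eq_env_indexI)
  show "koszul_idempotent (Suc n) \<otimes>\<^bsub>E\<^esub> koszul_differential n = koszul_differential n"
    by (rule E_inject) (auto intro!: fun_eq_env_indexI simp: add_ac)
  show "koszul_differential n \<otimes>\<^bsub>E\<^esub> koszul_idempotent n = koszul_differential n"
    by (rule E_inject) (auto intro!: fun_eq_env_indexI simp: add_ac)
  show "koszul_differential (Suc n) \<otimes>\<^bsub>E\<^esub> koszul_differential n = \<zero>\<^bsub>E\<^esub>"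
    by (rule E_inject) (auto intro!: fun_eq_env_indexI simp: add_ac)
  show "\<one>\<^bsub>A\<^esub> \<in> part M 0" by (auto simp: part_A split: if_splits)
  show "koszul_idempotent 0 \<odot>\<^bsub>M\<^esub> \<one>\<^bsub>A\<^esub> = \<one>\<^bsub>A\<^esub>"
    by (rule co_inject) (auto simp: act_coords intro!: fun_eq_bool3I)
  show "koszul_differential 0 \<odot>\<^bsub>M\<^esub> \<one>\<^bsub>A\<^esub> = \<zero>\<^bsub>M\<^esub>"
    unfolding M_simps by (rule co_inject) (auto simp: act_coords intro!: fun_eq_bool3I)
qed (use koszul_exact koszul_exact_augmentation generated_by_one in auto)

section \<open>The cochain complex with values in the algebra\<close>

lemma part_iff: "y \<in> part A k \<longleftrightarrow> y \<in> carrier A \<and> (k \<noteq> 0 \<longrightarrow> (\<forall>i. co y (False, i) = 0)) \<and>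
    (k \<noteq> 1 \<longrightarrow> (\<forall>i. co y (True, i) = 0))"
proof -
  have "(\<forall>p. co y p \<noteq> 0 \<longrightarrow> cycle_degree p = k) \<longleftrightarrow>
      (\<forall>i. co y (False, i) \<noteq> 0 \<longrightarrow> 0 = k) \<and> (\<forall>i. co y (True, i) \<noteq> 0 \<longrightarrow> 1 = k)"
    unfolding split_paired_All all_bool_eq by auto
  then show ?thesis unfolding part_A by auto
qed

lemma eq_iff:
  assumes "y \<in> carrier A" "z \<in> carrier A"
  shows "y = z \<longleftrightarrow> (\<forall>i. co y (False, i) = co z (False, i)) \<and> (\<forall>i. co y (True, i) = co z (True, i))"
  using co_inject[OF assms] fun_eq_bool3I[of "co y" "co z"] by auto

lemma idempotent_act:
  assumes "y \<in> carrier A"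
  shows "koszul_idempotent n \<odot>\<^bsub>M\<^esub> y = y \<longleftrightarrow> (n mod 3 \<noteq> 0 \<longrightarrow> (\<forall>i. co y (False, i) = 0)) \<and>
    (n mod 3 \<noteq> 1 \<longrightarrow> (\<forall>i. co y (True, i) = 0))"
  using assms of_nat_3_eq_0[of n] of_nat_3_eq_1[of n]
  by (subst eq_iff) (auto simp: act_coords)

text \<open>Each summand multiplies \<open>y\<close> by an arrow from the left or from the right. An
  arrow results only if \<open>y\<close> contributes a vertex: \<open>i + 1\<close> for the left
  product, \<open>i\<close> for the right one, and both fit only if \<open>n\<close> is 0 modulo
  3.\<close>

lemma differential_act:
  assumes "y \<in> carrier A"
  shows "co (koszul_differential n \<odot>\<^bsub>M\<^esub> y) (False, i) = 0"
    "co (koszul_differential n \<odot>\<^bsub>M\<^esub> y) (True, i) = (if n mod 3 = 0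
      then (- 1) ^ (n + 1) * co y (False, i) + co y (False, i + 1) else 0)"
  using assms of_nat_3_eq_0[of n] by (auto simp: act_coords)

text \<open>If \<open>n\<close> is 0 modulo 6, a cocycle has the same coordinate at all vertices, so
  one of them suffices. If \<open>n\<close> is 1 modulo 6, the coboundaries are the families of
  differences around the cycle, which are those with sum zero.\<close>

definition "class_functional n y = (if n mod 6 = 0 then co y (False, 0)
  else if n mod 6 = 1 then \<Sum>i\<in>UNIV. co y (True, i) else 0)"

lemma HH_kernel:
  assumes y: "y \<in> part M (int n + d)" and fx: "koszul_idempotent n \<odot>\<^bsub>M\<^esub> y = y"
  shows "(case n of 0 \<Rightarrow> y = \<zero>\<^bsub>M\<^esub>
       | Suc m \<Rightarrow> \<exists>z\<in>part M (int m + d). koszul_idempotent m \<odot>\<^bsub>M\<^esub> z = z \<and> y = koszul_differential m \<odot>\<^bsub>M\<^esub> z) \<longleftrightarrow>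
      koszul_differential n \<odot>\<^bsub>M\<^esub> y = \<zero>\<^bsub>M\<^esub> \<and> class_functional n y = 0"
    (is "?lhs \<longleftrightarrow> ?rhs")
proof -
  have yA: "y \<in> carrier A" using y by (simp add: part_iff)
  note fx' = fx[unfolded idempotent_act[OF yA]]
  have y0: "y = \<zero>\<^bsub>M\<^esub> \<longleftrightarrow> (\<forall>i. co y (False, i) = 0) \<and> (\<forall>i. co y (True, i) = 0)"
    using eq_iff[OF yA, of "\<zero>\<^bsub>A\<^esub>"] by simp
  have dy: "koszul_differential n \<odot>\<^bsub>M\<^esub> y = \<zero>\<^bsub>M\<^esub> \<longleftrightarrow>
      (n mod 3 = 0 \<longrightarrow> (\<forall>i. (- 1) ^ (n + 1) * co y (False, i) + co y (False, i + 1) = 0))"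
    using yA act_coords(1)[OF koszul_carrier(2) yA] eq_iff[of "koszul_differential n \<odot>\<^bsub>M\<^esub> y" "\<zero>\<^bsub>A\<^esub>"]
    by (simp add: differential_act)
  \<comment> \<open>The differential entering degree \<open>n\<close> acts as zero unless
    \<open>n\<close> is 1 modulo 3, so otherwise zero is the only coboundary.\<close>
  have lhs0: "?lhs \<longleftrightarrow> y = \<zero>\<^bsub>M\<^esub>" if "n mod 3 \<noteq> 1"
  proof (cases n)
    case (Suc m)
    have m: "m mod 3 \<noteq> 0" using that Suc by presburger
    show ?thesis
    proof
      assume ?lhs
      then obtain z where z: "z \<in> part M (int m + d)" "koszul_idempotent m \<odot>\<^bsub>M\<^esub> z = z"
        "y = koszul_differential m \<odot>\<^bsub>M\<^esub> z" using Suc by auto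
      have "z \<in> carrier A" using z(1) by (simp add: part_iff)
      then show "y = \<zero>\<^bsub>M\<^esub>" unfolding y0 unfolding z(3) using m by (simp add: differential_act)
    next
      assume "y = \<zero>\<^bsub>M\<^esub>"
      moreover have "koszul_idempotent m \<odot>\<^bsub>M\<^esub> \<zero>\<^bsub>M\<^esub> = \<zero>\<^bsub>M\<^esub>" "koszul_differential m \<odot>\<^bsub>M\<^esub> \<zero>\<^bsub>M\<^esub> = \<zero>\<^bsub>M\<^esub>"
        using K.M.smult_zero koszul_carrier by blast+
      ultimately show ?lhs using Suc K.M.part_zero by auto
    qed
  qed simp
  have "n mod 6 = 0 \<or> n mod 6 = 1 \<or> n mod 6 = 2 \<or> n mod 6 = 3 \<or> n mod 6 = 4 \<or> n mod 6 = 5"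
    by linarith
  moreover have "n mod 6 = 2 \<or> n mod 6 = 5 \<longrightarrow> n mod 3 = 2" by presburger
  ultimately consider "n mod 6 = 0" | "n mod 6 = 3" | "n mod 3 = 2" "n mod 6 \<noteq> 0" "n mod 6 \<noteq> 1"
    | "n mod 6 = 1" | "n mod 6 = 4" by fastforce
  then show ?thesis
  proof cases
    case 1
    then have n: "n mod 3 = 0" "n mod 3 \<noteq> 1" "even n" by presburger+
    have "co y (True, i) = 0" for i using fx' n(1) by simp
    moreover have "class_functional n y = co y (False, 0)" using 1 by (simp add: class_functional_def)
    moreover have "(- 1) ^ (n + 1) * p + q = 0 \<longleftrightarrow> q = p" for p q :: complex
      using n(3) by (simp add: add_eq_0_iff)
    moreover have "(q = p \<and> r = q \<and> p = r) \<and> p = 0 \<longleftrightarrow> p = 0 \<and> q = 0 \<and> r = 0" for p q r :: complex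
      by auto
    ultimately show ?thesis
      unfolding lhs0[OF n(2)] unfolding dy y0 all_3 using n(1) by simp
  next
    case 2
    then have n: "n mod 3 = 0" "n mod 3 \<noteq> 1" "odd n" by presburger+
    have "co y (True, i) = 0" for i using fx' n(1) by simp
    moreover have "class_functional n y = 0" using 2 by (simp add: class_functional_def)
    moreover have "(- 1) ^ (n + 1) * p + q = 0 \<longleftrightarrow> q = - p" for p q :: complex
      using n(3) by (simp add: add_eq_0_iff)
    moreover have "q = - p \<and> r = - q \<and> p = - r \<longleftrightarrow> p = 0 \<and> q = 0 \<and> r = 0" for p q r :: complex
      by auto
    ultimately show ?thesis
      unfolding lhs0[OF n(2)] unfolding dy y0 all_3 using n(1) by simp
  next
    case 3
    then have n: "n mod 3 \<noteq> 0" "n mod 3 \<noteq> 1" by presburger+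
    have "co y (True, i) = 0" "co y (False, i) = 0" for i using fx' n by simp_all
    moreover have "class_functional n y = 0" using 3 by (simp add: class_functional_def)
    ultimately show ?thesis
      unfolding lhs0[OF n(2)] unfolding dy y0 using n(1) by simp
  next
    case 4
    then obtain m where n: "n = Suc m" by (cases n) auto
    have m: "m mod 3 = 0" "even m" "n mod 3 = 1" "n mod 6 = 1" "n mod 6 \<noteq> 0" using 4 n by presburger+
    have y00: "co y (False, i) = 0" for i using fx' m by auto
    have rhs: "?rhs \<longleftrightarrow> co y (True, 0) + co y (True, 1) + co y (True, 2) = 0"
      using m unfolding dy by (simp add: class_functional_def sum_3)
    show ?thesis
    proof
      assume ?lhs
      then obtain z where z: "z \<in> part M (int m + d)" "y = koszul_differential m \<odot>\<^bsub>M\<^esub> z" using n by auto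
      have "z \<in> carrier A" using z(1) by (simp add: part_iff)
      then show ?rhs unfolding rhs unfolding z(2) using m by (simp add: differential_act)
    next
      assume ?rhs
      then have s: "co y (True, 0) + co y (True, 1) + co y (True, 2) = 0" unfolding rhs .
      then have t: "co y (True, 2) = - (co y (True, 0) + co y (True, 1))"
        by (rule minus_unique[symmetric])
      \<comment> \<open>Partial sums of \<open>y\<close> starting from 0 at vertex 0 have the
        differences required on the first two arrows; the third difference is right because the
        total sum vanishes.\<close>
      define z where "z = el (\<lambda>(s, i). if s \<or> i = 0 then 0 else if i = 1 then co y (True, 0)
        else co y (True, 0) + co y (True, 1))"
      have zA: "z \<in> carrier A" by (simp add: z_def)
      have zc: "co z (True, i) = 0" "co z (False, 0) = 0" "co z (False, 1) = co y (True, 0)"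
        "co z (False, 2) = co y (True, 0) + co y (True, 1)" for i
        by (simp_all add: z_def)
      have "z \<in> part M (int m + d)"
        unfolding M_simps part_iff all_3 using zA zc y n unfolding M_simps part_iff by auto
      moreover have "koszul_idempotent m \<odot>\<^bsub>M\<^esub> z = z"
        unfolding idempotent_act[OF zA] using m zc by simp
      moreover have "y = koszul_differential m \<odot>\<^bsub>M\<^esub> z"
        unfolding eq_iff[OF yA act_coords(1)[OF koszul_carrier(2) zA]] all_3
        using m zc y00 t zA by (simp add: differential_act)
      ultimately show ?lhs using n by auto
    qed
  next
    case 5
    then obtain m where n: "n = Suc m" by (cases n) auto
    have m: "m mod 3 = 0" "odd m" "n mod 3 = 1" "n mod 6 \<noteq> 1" "n mod 6 \<noteq> 0" using 5 n by presburger+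
    have y00: "co y (False, i) = 0" for i using fx' m by auto
    \<comment> \<open>Now the equations read \<open>z_i + z_{i+1} = y_i\<close>. Adding the two that
      contain \<open>z_i\<close> and subtracting the third leaves twice \<open>z_i\<close>.\<close>
    define z where "z = el (\<lambda>(s, i). if s then 0
      else if i = 0 then (co y (True, 0) + co y (True, 2) - co y (True, 1)) / 2
      else if i = 1 then (co y (True, 0) + co y (True, 1) - co y (True, 2)) / 2
      else (co y (True, 1) + co y (True, 2) - co y (True, 0)) / 2)"
    have zA: "z \<in> carrier A" by (simp add: z_def)
    have zc: "co z (True, i) = 0"
      "co z (False, 0) = (co y (True, 0) + co y (True, 2) - co y (True, 1)) / 2"
      "co z (False, 1) = (co y (True, 0) + co y (True, 1) - co y (True, 2)) / 2"
      "co z (False, 2) = (co y (True, 1) + co y (True, 2) - co y (True, 0)) / 2" for i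
      by (simp_all add: z_def)
    have zs: "co y (True, 0) = co z (False, 0) + co z (False, 1)"
      "co y (True, 1) = co z (False, 1) + co z (False, 2)"
      "co y (True, 2) = co z (False, 2) + co z (False, 0)"
      unfolding zc by (simp_all add: field_simps)
    have "z \<in> part M (int m + d)"
      unfolding M_simps part_iff all_3 using zA zc y n unfolding M_simps part_iff by auto
    moreover have "koszul_idempotent m \<odot>\<^bsub>M\<^esub> z = z"
      unfolding idempotent_act[OF zA] using m zc by simp
    moreover have "y = koszul_differential m \<odot>\<^bsub>M\<^esub> z"
      unfolding eq_iff[OF yA act_coords(1)[OF koszul_carrier(2) zA]] all_3
      using m zc(1) zs y00 zA by (simp add: differential_act)
    ultimately have ?lhs using n by auto
    moreover have ?rhs unfolding dy using m by (simp add: class_functional_def)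
    ultimately show ?thesis by blast
  qed
qed

text \<open>Vertex coordinates have degree 0 and arrow coordinates degree 1, so the value of degree
  \<open>n + d\<close> can be detected by the functional only for \<open>d = - int n\<close> or
  \<open>d = 1 - int n\<close> respectively.\<close>

theorem HH_coordinatized:
  "coordinatized (HH A n d)
     (if (n mod 6 = 0 \<and> d = - int n) \<or> (n mod 6 = 1 \<and> d = 1 - int n) then UNIV else {0})"
proof -
  let ?Z = "{y \<in> part M (int n + d). koszul_idempotent n \<odot>\<^bsub>M\<^esub> y = y \<and>
    koszul_differential n \<odot>\<^bsub>M\<^esub> y = \<zero>\<^bsub>M\<^esub>}"
  let ?S = "if (n mod 6 = 0 \<and> d = - int n) \<or> (n mod 6 = 1 \<and> d = 1 - int n) then UNIV else {0 :: complex}"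
  have ZA: "y \<in> carrier A" if "y \<in> ?Z" for y using that by (simp add: part_iff)
  have "coordinatized (Ext E M M n d) (class_functional n ` ?Z)"
  proof (rule K.principal_functional[OF graded_M])
    show "class_functional n (y \<oplus>\<^bsub>M\<^esub> z) = class_functional n y + class_functional n z"
      if "y \<in> ?Z" "z \<in> ?Z" for y z
      using ZA[OF that(1)] ZA[OF that(2)] by (simp add: class_functional_def sum.distrib)
    show "class_functional n ((c \<odot>\<^bsub>E\<^esub> \<one>\<^bsub>E\<^esub>) \<odot>\<^bsub>M\<^esub> y) = c * class_functional n y" if "y \<in> ?Z" for c y
      using ZA[OF that] by (simp add: class_functional_def act_coords sum_distrib_left)
  qed (rule HH_kernel)
  moreover have "class_functional n ` ?Z = ?S"
  proof (cases "(n mod 6 = 0 \<and> d = - int n) \<or> (n mod 6 = 1 \<and> d = 1 - int n)")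
    case True
    have "c \<in> class_functional n ` ?Z" for c
      using True
    proof
      assume n: "n mod 6 = 0 \<and> d = - int n"
      then have n3: "n mod 3 = 0" "even n" by presburger+
      \<comment> \<open>A multiple of the unit of \<open>A\<close>, whose equal vertex coordinates
        cancel in the differential for even \<open>n\<close>.\<close>
      let ?y = "el (\<lambda>(s, i). if s then 0 else c)"
      have "koszul_differential n \<odot>\<^bsub>M\<^esub> ?y = \<zero>\<^bsub>M\<^esub>"
        unfolding M_simps eq_iff[OF act_coords(1)[OF koszul_carrier(2) el(1)] A.zero_closed]
        using n3 by (simp add: differential_act)
      moreover have "koszul_idempotent n \<odot>\<^bsub>M\<^esub> ?y = ?y"
        unfolding idempotent_act[OF el(1)] using n3 by simp
      moreover have "?y \<in> part M (int n + d)" unfolding M_simps part_iff using n by simp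
      moreover have "class_functional n ?y = c" using n by (simp add: class_functional_def)
      ultimately show ?thesis by (intro image_eqI[of _ _ ?y]) simp_all
    next
      assume n: "n mod 6 = 1 \<and> d = 1 - int n"
      then have n3: "n mod 3 = 1" by presburger
      \<comment> \<open>Any family of arrow coordinates with sum \<open>c\<close> would represent
        this class; here it sits on the arrow at vertex 0.\<close>
      let ?y = "el (\<lambda>(s, i). if s \<and> i = 0 then c else 0)"
      have "koszul_differential n \<odot>\<^bsub>M\<^esub> ?y = \<zero>\<^bsub>M\<^esub>"
        unfolding M_simps eq_iff[OF act_coords(1)[OF koszul_carrier(2) el(1)] A.zero_closed]
        using n3 by (simp add: differential_act)
      moreover have "koszul_idempotent n \<odot>\<^bsub>M\<^esub> ?y = ?y"
        unfolding idempotent_act[OF el(1)] using n3 by simp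
      moreover have "?y \<in> part M (int n + d)" unfolding M_simps part_iff using n by simp
      moreover have "class_functional n ?y = c" using n by (simp add: class_functional_def sum_3)
      ultimately show ?thesis by (intro image_eqI[of _ _ ?y]) simp_all
    qed
    then show ?thesis using True by auto
  next
    case False
    have "class_functional n y = 0" if y: "y \<in> ?Z" for y
    proof -
      have "y \<in> part M (int n + d)" using y by simp
      then show ?thesis using False unfolding M_simps part_iff class_functional_def by auto
    qed
    moreover have "\<zero>\<^bsub>M\<^esub> \<in> ?Z"
      using K.M.part_zero K.M.smult_zero[OF koszul_carrier(1)] K.M.smult_zero[OF koszul_carrier(2)]
      by blast
    ultimately show ?thesis using False by auto
  qed
  ultimately show ?thesis by (simp only: HH_def)
qed

end

section \<open>Spaces of dimension at most one and their duals\<close>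

lemma vectorspace_coordinatized:
  assumes V: "vectorspace complex_field V" and fd: "vectorspace.fin_dim complex_field V"
    and dim: "vectorspace.dim complex_field V = (if b then 1 else 0)"
  shows "coordinatized V (if b then UNIV else {0})"
proof -
  interpret vectorspace complex_field V by fact
  obtain \<beta> where \<beta>: "finite \<beta>" "basis \<beta>" using finite_basis_exists[OF fd] by blast
  have card: "card \<beta> = (if b then 1 else 0)" using dim_basis[OF \<beta>] dim by simp
  have \<beta>c: "\<beta> \<subseteq> carrier V" and li: "\<not> lin_dep \<beta>" and gen: "carrier V = {lincomb a \<beta> | a. a \<in> \<beta> \<rightarrow> UNIV}"
    using \<beta> finite_span[OF \<beta>(1)] by (auto simp: basis_def)
  show ?thesis
  proof (cases b)
    case False
    then have "\<beta> = {}" using card \<beta>(1) by simp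
    then have c: "carrier V = {\<zero>\<^bsub>V\<^esub>}" using gen by (auto simp: lincomb_def)
    have "(\<lambda>_. 0) \<in> module_hom complex_field V (regular complex_field)"
      by (auto simp: LinearCombinations.module_hom_def)
    then show ?thesis
      using False c smult_closed[of _ "\<zero>\<^bsub>V\<^esub>"]
      unfolding coordinatized_def by (auto simp: inj_on_def intro!: bexI[of _ "\<lambda>_. 0"])
  next
    case True
    then obtain v where v: "\<beta> = {v}" using card by (auto simp: card_1_singleton_iff)
    have vc: "v \<in> carrier V" using v \<beta>c by simp
    have carr: "carrier V = {c \<odot>\<^bsub>V\<^esub> v | c. True}"
      unfolding gen v using vc by (auto simp: lincomb_def intro: exI[of _ "\<lambda>_. _"])
    have zero: "c = 0" if "c \<odot>\<^bsub>V\<^esub> v = \<zero>\<^bsub>V\<^esub>" for c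
    proof (rule ccontr)
      assume "c \<noteq> 0"
      moreover have "lincomb (\<lambda>_. c) {v} = \<zero>\<^bsub>V\<^esub>" using that vc by (simp add: lincomb_def)
      ultimately have "lin_dep {v}"
        unfolding lin_dep_def by (intro exI[of _ "{v}"] exI[of _ "\<lambda>_. c"] exI[of _ v]) auto
      then show False using li v by simp
    qed
    have inj: "c = c'" if "c \<odot>\<^bsub>V\<^esub> v = c' \<odot>\<^bsub>V\<^esub> v" for c c'
    proof -
      have "(c - c') \<odot>\<^bsub>V\<^esub> v \<oplus>\<^bsub>V\<^esub> c' \<odot>\<^bsub>V\<^esub> v = c' \<odot>\<^bsub>V\<^esub> v"
        using smult_l_distr[of "c - c'" c' v] vc that by simp
      then have "(c - c') \<odot>\<^bsub>V\<^esub> v = \<zero>\<^bsub>V\<^esub>" using vc smult_closed[of _ v] by simp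
      then show ?thesis using zero[of "c - c'"] by simp
    qed
    define F where "F x = (THE c. x = c \<odot>\<^bsub>V\<^esub> v)" for x
    have F: "F (c \<odot>\<^bsub>V\<^esub> v) = c" for c unfolding F_def using inj by (intro the_equality) auto
    have "F \<in> module_hom complex_field V (regular complex_field)"
    proof (rule module_homI)
      fix x y assume "x \<in> carrier V" "y \<in> carrier V"
      then obtain c c' where "x = c \<odot>\<^bsub>V\<^esub> v" "y = c' \<odot>\<^bsub>V\<^esub> v" using carr by auto
      then show "F (x \<oplus>\<^bsub>V\<^esub> y) = F x \<oplus>\<^bsub>regular complex_field\<^esub> F y"
        using smult_l_distr[of c c' v] vc F[of "c + c'"] by (simp add: F)
    next
      fix r x assume "x \<in> carrier V"
      then obtain c where "x = c \<odot>\<^bsub>V\<^esub> v" using carr by auto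
      then show "F (r \<odot>\<^bsub>V\<^esub> x) = r \<odot>\<^bsub>regular complex_field\<^esub> F x"
        using smult_assoc1[of r c v] vc F[of "r * c"] by (simp add: F)
    qed simp
    moreover have "inj_on F (carrier V)" unfolding carr by (auto simp: inj_on_def F)
    moreover have "F ` carrier V = UNIV"
    proof (intro equalityI subsetI UNIV_I)
      fix c
      have "c \<odot>\<^bsub>V\<^esub> v \<in> carrier V" using vc by (intro smult_closed) simp_all
      then show "c \<in> F ` carrier V" using F[of c] by (intro image_eqI[of _ _ "c \<odot>\<^bsub>V\<^esub> v"]) simp_all
    qed
    moreover have "c \<odot>\<^bsub>V\<^esub> x \<in> carrier V" if "x \<in> carrier V" for c x
      using that by (intro smult_closed) simp_all
    ultimately have "coordinatized V UNIV" unfolding coordinatized_def by auto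
    then show ?thesis using True by simp
  qed
qed

text \<open>A functional on such a space is determined by its value at a spanning vector
  \<open>v\<close>, normalised by \<open>F v = 1\<close> in dimension one and equal to zero in
  dimension zero. Evaluation at \<open>v\<close> is the coordinate on the dual.\<close>

lemma dual_coordinatized:
  assumes "coordinatized (V (- j)) (if b then UNIV else {0})"
  shows "coordinatized (graded_dual V j) (if b then UNIV else {0})"
proof -
  let ?V = "V (- j)" and ?D = "graded_dual V j"
  let ?H = "module_hom complex_field ?V (regular complex_field)"
  obtain F where F: "F \<in> ?H" "inj_on F (carrier ?V)" "F ` carrier ?V = (if b then UNIV else {0})"
    using assms unfolding coordinatized_def by blast
  have Va: "x \<oplus>\<^bsub>?V\<^esub> y \<in> carrier ?V" if "x \<in> carrier ?V" "y \<in> carrier ?V" for x y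
    using assms that unfolding coordinatized_def by blast
  have Vs: "c \<odot>\<^bsub>?V\<^esub> x \<in> carrier ?V" if "x \<in> carrier ?V" for c x
    using assms that unfolding coordinatized_def by blast
  have Vz: "\<zero>\<^bsub>?V\<^esub> \<in> carrier ?V" using assms unfolding coordinatized_def by blast
  have carr: "carrier ?D = ?H \<inter> extensional (carrier ?V)" by (simp add: graded_dual_def)
  have add: "f \<oplus>\<^bsub>?D\<^esub> g = (\<lambda>x\<in>carrier ?V. f x + g x)" for f g by (simp add: graded_dual_def)
  have sm: "c \<odot>\<^bsub>?D\<^esub> f = (\<lambda>x\<in>carrier ?V. c * f x)" for c f by (simp add: graded_dual_def)
  have z: "\<zero>\<^bsub>?D\<^esub> = (\<lambda>x\<in>carrier ?V. 0)" by (simp add: graded_dual_def)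
  have hom: "(\<lambda>x\<in>carrier ?V. f x) \<in> carrier ?D"
    if "\<And>x y. x \<in> carrier ?V \<Longrightarrow> y \<in> carrier ?V \<Longrightarrow> f (x \<oplus>\<^bsub>?V\<^esub> y) = f x + f y"
      "\<And>c x. x \<in> carrier ?V \<Longrightarrow> f (c \<odot>\<^bsub>?V\<^esub> x) = c * f x" for f
    unfolding carr using that Va Vs by (auto intro!: module_homI)
  have fa: "f (x \<oplus>\<^bsub>?V\<^esub> y) = f x + f y" if "f \<in> ?H" "x \<in> carrier ?V" "y \<in> carrier ?V" for f x y
    using LinearCombinations.module_hom_add[OF that] by simp
  have fs: "f (c \<odot>\<^bsub>?V\<^esub> x) = c * f x" if "f \<in> ?H" "x \<in> carrier ?V" for f c x
    using LinearCombinations.module_hom_smult[OF that(1) _ that(2), of c] by simp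
  have Da: "f \<oplus>\<^bsub>?D\<^esub> g \<in> carrier ?D" if "f \<in> carrier ?D" "g \<in> carrier ?D" for f g
    unfolding add using that
    by (intro hom) (auto simp: carr distrib_left fa[of f] fa[of g] fs[of f] fs[of g])
  have Ds: "c \<odot>\<^bsub>?D\<^esub> f \<in> carrier ?D" if "f \<in> carrier ?D" for c f
    unfolding sm using that by (intro hom) (auto simp: carr distrib_left fa[of f] fs[of f])
  have Dz: "\<zero>\<^bsub>?D\<^esub> \<in> carrier ?D" unfolding z by (intro hom) auto
  define v where "v = (if b then inv_into (carrier ?V) F 1 else \<zero>\<^bsub>?V\<^esub>)"
  have v: "v \<in> carrier ?V" using F(3) Vz by (auto simp: v_def inv_into_into)
  have Fv: "F v = 1" if b using F(3) that by (auto simp: v_def f_inv_into_f)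
  have span: "x = F x \<odot>\<^bsub>?V\<^esub> v" if x: "x \<in> carrier ?V" for x
  proof (rule inj_onD[OF F(2)])
    show "F x = F (F x \<odot>\<^bsub>?V\<^esub> v)"
    proof (cases b)
      case True
      then show ?thesis using fs[OF F(1) v] Fv by simp
    next
      case False
      have "F x = 0" "F (F x \<odot>\<^bsub>?V\<^esub> v) = 0" using F(3) False x Vs[OF v] by auto
      then show ?thesis by simp
    qed
  qed (use x Vs v in auto)
  let ?G = "\<lambda>f. f v"
  have "?G \<in> module_hom complex_field ?D (regular complex_field)"
    by (rule module_homI) (auto simp: add sm v)
  moreover have "inj_on ?G (carrier ?D)"
  proof (rule inj_onI)
    fix f g assume f: "f \<in> carrier ?D" and g: "g \<in> carrier ?D" and fg: "f v = g v"
    have "f x = g x" if x: "x \<in> carrier ?V" for x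
    proof -
      have "f x = F x * f v" "g x = F x * g v"
        using span[OF x] fs[OF _ v, of f "F x"] fs[OF _ v, of g "F x"] f g by (auto simp: carr)
      then show ?thesis using fg by simp
    qed
    then show "f = g" using f g unfolding carr by (intro extensionalityI[of _ "carrier ?V"]) auto
  qed
  moreover have "?G ` carrier ?D = (if b then UNIV else {0})"
  proof (cases b)
    case True
    have "c \<in> ?G ` carrier ?D" for c
    proof (rule image_eqI)
      show "(\<lambda>x\<in>carrier ?V. c * F x) \<in> carrier ?D"
        using fa[OF F(1)] fs[OF F(1)] by (intro hom) (auto simp: distrib_left)
      show "c = (\<lambda>x\<in>carrier ?V. c * F x) v" using v Fv[OF True] by simp
    qed
    then show ?thesis using True by auto
  next
    case False
    have "f v = 0" if f: "f \<in> carrier ?D" for f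
    proof -
      have "F v = 0" using F(3) False v by auto
      then have "v = 0 \<odot>\<^bsub>?V\<^esub> v" using span[OF v] by simp
      then have "f v = 0 * f v" using fs[OF _ v, of f 0] f by (auto simp: carr)
      then show ?thesis by simp
    qed
    then have "?G ` carrier ?D \<subseteq> {0}" "?G \<zero>\<^bsub>?D\<^esub> = 0" using Dz by blast+
    then show ?thesis using False Dz by (intro equalityI) (auto intro!: image_eqI[OF _ Dz])
  qed
  ultimately show ?thesis unfolding coordinatized_def using Da Ds Dz by blast
qed

theorem theorem4p2:
  fixes \<phi> :: "int \<times> int \<Rightarrow> real"
    and W :: "(int \<times> int) \<times> (int \<times> int) \<Rightarrow> (int \<times> int) \<times> (int \<times> int)
                \<Rightarrow> (int \<times> int) \<times> (int \<times> int) \<Rightarrow> complex"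
    and A :: "(complex, ((int \<times> int, (int \<times> int) \<times> (int \<times> int)) path \<Rightarrow>\<^sub>0 complex) set) graded_module"
    and X :: "'x graded_space"
  assumes "perron_frobenius_eigenvector (graph_A 4) 4 \<phi>"
    and "cell_system (graph_A 4) 4 \<phi> W"
    and "A = almost_calabi_yau_algebra (graph_A 4) W"
    and "graded_vector_space X"
    and "has_hilbert_series X (fls_X ^ 3)"
  shows "graded_iso (HH A 0) (shift X (-3)) \<and>
         graded_iso (HH A 1) (shift X (-3)) \<and>
         graded_iso (HH A 6) (shift (graded_dual X) (-3)) \<and>
         graded_iso (HH A 7) (shift (graded_dual X) (-3)) \<and>
         graded_iso (HH A 12) (shift X (-15)) \<and>
         (\<forall>j\<in>{2, 3, 4, 5, 8, 9, 10, 11}. graded_zero (HH A j)) \<and>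
         (\<forall>i\<ge>1. graded_iso (HH A (12 + i)) (shift (HH A i) (-12)))"
proof -
  interpret W: cell_weights W by (rule cell_system_weights[OF assms(1,2)])
  interpret truncated_cycle A W.coord
    using W.truncated_cycle by (simp add: W.A_eq assms(3))
  have X: "coordinatized (X j) (if j = 3 then UNIV else {0})" for j
  proof (rule vectorspace_coordinatized)
    show "vectorspace complex_field (X j)" "vectorspace.fin_dim complex_field (X j)"
      using assms(4,5) by (auto simp: graded_vector_space_def has_hilbert_series_def)
    have "int (vectorspace.dim complex_field (X j)) = fls_nth (fls_X ^ 3) j"
      using assms(5) by (simp add: has_hilbert_series_def)
    then show "vectorspace.dim complex_field (X j) = (if j = 3 then 1 else 0)"
      by (auto simp: fls_X_power_nth split: if_splits)
  qed
  have dual: "coordinatized (graded_dual X j) (if j = -3 then UNIV else {0})" for j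
  proof (rule dual_coordinatized)
    have "(- j = 3) = (j = -3)" by auto
    then show "coordinatized (X (- j)) (if j = -3 then UNIV else {0})" using X[of "- j"] by simp
  qed
  have iso: "graded_iso (HH A n) U"
    if "\<And>j. coordinatized (U j)
      (if (n mod 6 = 0 \<and> j = - int n) \<or> (n mod 6 = 1 \<and> j = 1 - int n) then UNIV else {0})"
    for n and U :: "'u graded_space"
    unfolding graded_iso_def using coordinatized_iso[OF HH_coordinatized that] by blast
  \<comment> \<open>\<open>X\<close> lies in degree 3 and its dual in degree -3, so the two shifts
    of \<open>X\<close> by -3 lie in degree 0, those of the dual in degree -6, and the shift of
    \<open>X\<close> by -15 in degree -12.\<close>
  have "graded_iso (HH A 0) (shift X (-3))"
  proof (rule iso)
    show "coordinatized (shift X (-3) j) (if ((0 :: nat) mod 6 = 0 \<and> j = - int 0) \<or>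
        ((0 :: nat) mod 6 = 1 \<and> j = 1 - int 0) then UNIV else {0})" for j
      using X[of "j + 3"] by (simp add: shift_def)
  qed
  moreover have "graded_iso (HH A 1) (shift X (-3))"
  proof (rule iso)
    show "coordinatized (shift X (-3) j) (if ((1 :: nat) mod 6 = 0 \<and> j = - int 1) \<or>
        ((1 :: nat) mod 6 = 1 \<and> j = 1 - int 1) then UNIV else {0})" for j
      using X[of "j + 3"] by (simp add: shift_def)
  qed
  moreover have "graded_iso (HH A 6) (shift (graded_dual X) (-3))"
  proof (rule iso)
    show "coordinatized (shift (graded_dual X) (-3) j) (if ((6 :: nat) mod 6 = 0 \<and> j = - int 6) \<or>
        ((6 :: nat) mod 6 = 1 \<and> j = 1 - int 6) then UNIV else {0})" for j
      using dual[of "j + 3"] by (simp add: shift_def add_eq_0_iff)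
  qed
  moreover have "graded_iso (HH A 7) (shift (graded_dual X) (-3))"
  proof (rule iso)
    show "coordinatized (shift (graded_dual X) (-3) j) (if ((7 :: nat) mod 6 = 0 \<and> j = - int 7) \<or>
        ((7 :: nat) mod 6 = 1 \<and> j = 1 - int 7) then UNIV else {0})" for j
      using dual[of "j + 3"] by (simp add: shift_def add_eq_0_iff)
  qed
  moreover have "graded_iso (HH A 12) (shift X (-15))"
  proof (rule iso)
    show "coordinatized (shift X (-15) j) (if ((12 :: nat) mod 6 = 0 \<and> j = - int 12) \<or>
        ((12 :: nat) mod 6 = 1 \<and> j = 1 - int 12) then UNIV else {0})" for j
      using X[of "j + 15"] by (simp add: shift_def add_eq_0_iff)
  qed
  moreover have "\<forall>j\<in>{2, 3, 4, 5, 8, 9, 10, 11}. graded_zero (HH A j)"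
  proof
    fix j :: nat assume "j \<in> {2, 3, 4, 5, 8, 9, 10, 11}"
    then have "j mod 6 \<noteq> 0" "j mod 6 \<noteq> 1" by auto
    then have "coordinatized (HH A j k) {0}" for k using HH_coordinatized[of j k] by simp
    then show "graded_zero (HH A j)"
      unfolding graded_zero_def by (intro allI coordinatized_zero)
  qed
  \<comment> \<open>The criterion depends only on \<open>n mod 6\<close> and on
    \<open>n + d\<close>, and both are preserved when \<open>n\<close> is raised and
    \<open>d\<close> is lowered by 12.\<close>
  moreover have "graded_iso (HH A (12 + i)) (shift (HH A i) (-12))" for i
  proof (rule iso)
    fix j
    have "(12 + i) mod 6 = i mod 6" by presburger
    moreover have "j - - 12 = - int i \<longleftrightarrow> j = - int (12 + i)"
      "j - - 12 = 1 - int i \<longleftrightarrow> j = 1 - int (12 + i)" by auto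
    ultimately show "coordinatized (shift (HH A i) (-12) j) (if ((12 + i) mod 6 = 0 \<and> j = - int (12 + i)) \<or>
        ((12 + i) mod 6 = 1 \<and> j = 1 - int (12 + i)) then UNIV else {0})"
      using HH_coordinatized[of i "j - - 12"] by (simp only: shift_def)
  qed
  ultimately show ?thesis by blast
qed

end
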